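(* Let $p$ be a prime or the symbol $\infty$, let $G$ be a finite group, let $(\mathscr L_H)_{H\le G}$ be an admissible family of nonempty sublattices of a finite $G$-lattice $\mathscr L$ (see context), and let $\boldsymbol\Gamma=\mathbf{El}(\dot T^{M_{\mathscr L}}_G)$ be the category defined in the context. Then: (a) $\boldsymbol\Gamma$ has an epi-mono factorization system, and for any object $I$ of $\boldsymbol\Gamma$, any $\sigma\in\mathrm{Aut}(I)_p$ has a coequalizer $c_\sigma:I\to I/\sigma$ of $\sigma$ and $\mathrm{id}_I$. (b) The abstract Burnside ring $\mathbb Z_{(p)}\boldsymbol\Gamma$ is isomorphic to the $p$-local lattice Burnside ring $\Omega(G,M_{\mathscr L})_{(p)}$. (c) For all $(U,t)\in\mathcal S(G,M_{\mathscr L})$ and $gU\in W_G(U,t)$, the coequalizer of $\sigma_g$ and the identity of $(G/U,\pi_t)$ is $$(G/U,\pi_t)/\sigma_g=(G/(\langle g\rangle U),\pi_{s_{(g,t)}}),\qquad s_{(g,t)}=\inf\{s\in\mathscr L_{\langle g\rangle U}\mid s\geq t\}.$$ (d) For all $(K,s),(U,t)\in\mathcal S(G,M_{\mathscr L})$, $$|\mathrm{Hom}((G/U,\pi_t),(G/K,\pi_s))|=|\{gK\in G/K\mid U\leq{}^gK\text{ and }t\leq{}^gs\}|.$$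
   Context: Write ${}^gH=gHg^{-1}$. A finite $G$-lattice is a finite lattice $\mathscr L$ with an order-preserving left $G$-action $(g,s)\mapsto{}^gs$. An admissible family consists of nonempty sublattices $\mathscr L_H\subseteq\mathscr L$, $H\leq G$, such that for all $K\le H\leq G$, $g\in G$: (1) $\mathscr L_{{}^gH}=\{{}^gs\mid s\in\mathscr L_H\}$; (2) ${}^hs=s$ for $h\in H$, $s\in\mathscr L_H$; (3) $s\wedge\sup\mathscr L_K\in\mathscr L_K$ for $s\in\mathscr L_H$; (4) $\sup\mathscr L_K\leq\sup\mathscr L_H$. $M_{\mathscr L}$ denotes the resulting functor $H\mapsto\mathscr L_H$ (monoids under $\wedge$), with restriction maps $s\mapsto s\wedge\sup\mathscr L_K$ and conjugation maps $s\mapsto{}^gs$. $\mathcal S(G,M_{\mathscr L})=\{(K,s)\mid K\leq G,\ s\in\mathscr L_K\}$ with $G$-action $g.(K,s)=({}^gK,{}^gs)$; $N_G(K,s)$ is the stabilizer of $(K,s)$ and $W_G(K,s)=N_G(K,s)/K$. The lattice Burnside ring $\Omega(G,M_{\mathscr L})$ is the free abelian group on symbols $[(G/K)_s]$, one for each $G$-orbit of pairs $(K,s)\in\mathcal S(G,M_{\mathscr L})$ (so $[(G/{}^gK)_{{}^gs}]=[(G/K)_s]$), with multiplication $[(G/K)_s]\cdot[(G/U)_t]=\sum_{KhU\in K\backslash G/U}[(G/(K\cap{}^hU))_{s\wedge{}^ht\wedge\sup\mathscr L_{K\cap{}^hU}}]$. For an abelian group $R$, $R_{(p)}=\mathbb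 Z_{(p)}\otimes_{\mathbb Z}R$ if $p$ is a prime ($\mathbb Z_{(p)}$ the localization at $p$), and $R_{(\infty)}=R$, $\mathbb Z_{(\infty)}=\mathbb Z$. The category $\mathbf{El}(\dot T^{M_{\mathscr L}}_G)$: objects are pairs $(G/K,\pi_s)$, $(K,s)\in\mathcal S(G,M_{\mathscr L})$, where $\pi_s$ is the map $rK\mapsto{}^rs$ on $G/K$; morphisms $(G/U,\pi_t)\to(G/K,\pi_s)$ are the $G$-maps $\lambda_g:G/U\to G/K$, $rU\mapsto rgK$, where $gK\in G/K$ satisfies $U\leq{}^gK$ and $t\leq{}^gs$; composition is composition of maps. The automorphisms of $(G/U,\pi_t)$ are the maps $\sigma_g:rU\mapsto rgU$ with $gU\in W_G(U,t)$. For a category $\boldsymbol\Gamma$ equivalent to a finite one: $\boldsymbol\Gamma/\!\simeq$ is the set of isomorphism classes $[I]$ of objects; $\mathbb Z_{(p)}\boldsymbol\Gamma$ is the free $\mathbb Z_{(p)}$-module on $\boldsymbol\Gamma/\!\simeq$; $\mathbb Z_{(p)}^{\boldsymbol\Gamma}=\prod_{[I]\in\boldsymbol\Gamma/\simeq}\mathbb Z_{(p)}$ is the ghost ring; the Burnside map is the linear map $\varphi^{(p)}_{\boldsymbol\Gamma}:[J]\mapsto(|\boldsymbol\Gamma(I,J)|)_{[I]}$. $\mathbb Z_{(p)}\boldsymbol\Gamma$ is called an abstract Burnside ring if it has a $\mathbb Z_{(p)}$-algebra structure for which $\varphi^{(p)}_{\boldsymbol\Gamma}$ is an injective $\mathbb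 Z_{(p)}$-algebra homomorphism. $\mathrm{Aut}(I)_p$ is a Sylow $p$-subgroup of $\mathrm{Aut}(I)$, and $\mathrm{Aut}(I)_\infty=\mathrm{Aut}(I)$. A coequalizer of $\sigma\in\mathrm{Aut}(I)$ and $\mathrm{id}_I$ is a morphism $c_\sigma:I\to I/\sigma$ with $c_\sigma\circ\sigma=c_\sigma$, universal with this property. An epi-mono factorization system is a pair $(\mathcal E,\mathcal M)$ of classes of morphisms, $\mathcal E$ consisting of epimorphisms and $\mathcal M$ of monomorphisms, both closed under composition with isomorphisms, such that every morphism factors as $m\circ e$ with $e\in\mathcal E$, $m\in\mathcal M$, uniquely up to unique isomorphism. It is a known theorem that the two properties in (a) imply that $\varphi^{(p)}_{\boldsymbol\Gamma}$ is injective and $\mathbb Z_{(p)}\boldsymbol\Gamma$ is an abstract Burnside ring (its algebra structure is then unique). *)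

theory Defs
  imports
    "HOL-Algebra.Group_Action" "HOL-Algebra.Left_Coset" "HOL-Algebra.Free_Abelian_Groups"
    "HOL-Algebra.Module" "HOL-Algebra.QuotRing" "HOL-Algebra.Sylow" "HOL-Library.Extended_Nat"
begin

section \<open>Finite \<open>G\<close>-lattices and admissible families\<close>

text \<open>The finite lattice is a type of sort \<open>{finite, lattice}\<close>. Meets are written
  \<^term>\<open>inf_class.inf\<close> because HOL-Algebra reuses the short name for another constant.
  In a finite lattice the supremum (infimum) of a nonempty subset is \<^const>\<open>Sup_fin\<close>
  (\<^const>\<open>Inf_fin\<close>).\<close>

definition conj_set :: "('a, 'm) monoid_scheme \<Rightarrow> 'a \<Rightarrow> 'a set \<Rightarrow> 'a set" where
  "conj_set G g H = (g <#\<^bsub>G\<^esub> H) #>\<^bsub>G\<^esub> (inv\<^bsub>G\<^esub> g)"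

locale finite_G_lattice =
  group_action G "UNIV :: 'l set" act
  for G :: "('a, 'm) monoid_scheme" (structure)
    and act :: "'a \<Rightarrow> 'l::{finite, lattice} \<Rightarrow> 'l" +
  assumes finite_group: "finite (carrier G)"
    and act_mono: "\<lbrakk>g \<in> carrier G; s \<le> t\<rbrakk> \<Longrightarrow> act g s \<le> act g t"

locale admissible_family = finite_G_lattice G act
  for G :: "('a, 'm) monoid_scheme" (structure)
    and act :: "'a \<Rightarrow> 'l::{finite, lattice} \<Rightarrow> 'l" +
  fixes LL :: "'a set \<Rightarrow> 'l set"
  assumes nonempty: "subgroup H G \<Longrightarrow> LL H \<noteq> {}"
    and inf_closed: "\<lbrakk>subgroup H G; s \<in> LL H; t \<in> LL H\<rbrakk> \<Longrightarrow> inf_class.inf s t \<in> LL H"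
    and sup_closed: "\<lbrakk>subgroup H G; s \<in> LL H; t \<in> LL H\<rbrakk> \<Longrightarrow> sup_class.sup s t \<in> LL H"
    and conj_image: "\<lbrakk>subgroup H G; g \<in> carrier G\<rbrakk> \<Longrightarrow> LL (conj_set G g H) = act g ` LL H"
    and fixed: "\<lbrakk>subgroup H G; h \<in> H; s \<in> LL H\<rbrakk> \<Longrightarrow> act h s = s"
    and restriction: "\<lbrakk>subgroup K G; subgroup H G; K \<subseteq> H; s \<in> LL H\<rbrakk>
      \<Longrightarrow> inf_class.inf s (Sup_fin (LL K)) \<in> LL K"
    and Sup_mono: "\<lbrakk>subgroup K G; subgroup H G; K \<subseteq> H\<rbrakk> \<Longrightarrow> Sup_fin (LL K) \<le> Sup_fin (LL H)"

definition pairs :: "('a, 'm) monoid_scheme \<Rightarrow> ('a set \<Rightarrow> 'l set) \<Rightarrow> ('a set \<times> 'l) set" where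
  "pairs G LL = {(K, s). subgroup K G \<and> s \<in> LL K}"

definition pair_act ::
  "('a, 'm) monoid_scheme \<Rightarrow> ('a \<Rightarrow> 'l \<Rightarrow> 'l) \<Rightarrow> 'a \<Rightarrow> 'a set \<times> 'l \<Rightarrow> 'a set \<times> 'l" where
  "pair_act G act g = (\<lambda>(K, s). (conj_set G g K, act g s))"

definition pair_normalizer ::
  "('a, 'm) monoid_scheme \<Rightarrow> ('a \<Rightarrow> 'l \<Rightarrow> 'l) \<Rightarrow> 'a set \<Rightarrow> 'l \<Rightarrow> 'a set" where
  "pair_normalizer G act K s = stabilizer G (pair_act G act) (K, s)"

definition pair_weyl ::
  "('a, 'm) monoid_scheme \<Rightarrow> ('a \<Rightarrow> 'l \<Rightarrow> 'l) \<Rightarrow> 'a set \<Rightarrow> 'l \<Rightarrow> 'a set monoid" where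
  "pair_weyl G act K s = (G\<lparr>carrier := pair_normalizer G act K s\<rparr>) LMod K"


section \<open>The lattice Burnside ring and localization\<close>

text \<open>The symbol \<open>[(G/K)\<^sub>s]\<close> is the \<open>G\<close>-orbit of \<open>(K, s)\<close>.\<close>

definition symb ::
  "('a, 'm) monoid_scheme \<Rightarrow> ('a \<Rightarrow> 'l \<Rightarrow> 'l) \<Rightarrow> 'a set \<Rightarrow> 'l \<Rightarrow> ('a set \<times> 'l) set" where
  "symb G act K s = orbit G (pair_act G act) (K, s)"

definition double_cosets ::
  "('a, 'm) monoid_scheme \<Rightarrow> 'a set \<Rightarrow> 'a set \<Rightarrow> 'a set set" where
  "double_cosets G K U = {(K #>\<^bsub>G\<^esub> h) <#>\<^bsub>G\<^esub> U | h. h \<in> carrier G}"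

text \<open>The summands do not depend on the representative \<open>h\<close> of a double coset, and the sum
  depends only on the orbits of \<open>(K, s)\<close> and \<open>(U, t)\<close>; the choices below are immaterial.\<close>

definition pair_product ::
  "('a, 'm) monoid_scheme \<Rightarrow> ('a \<Rightarrow> 'l::lattice \<Rightarrow> 'l) \<Rightarrow> ('a set \<Rightarrow> 'l set)
    \<Rightarrow> 'a set \<times> 'l \<Rightarrow> 'a set \<times> 'l \<Rightarrow> (('a set \<times> 'l) set \<Rightarrow>\<^sub>0 int)" where
  "pair_product G act LL = (\<lambda>(K, s) (U, t).
     \<Sum>D \<in> double_cosets G K U.
       let h = (SOME h. h \<in> D); V = K \<inter> conj_set G h U in
       frag_of (symb G act V (inf_class.inf (inf_class.inf s (act h t)) (Sup_fin (LL V)))))"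

definition symb_product ::
  "('a, 'm) monoid_scheme \<Rightarrow> ('a \<Rightarrow> 'l::lattice \<Rightarrow> 'l) \<Rightarrow> ('a set \<Rightarrow> 'l set)
    \<Rightarrow> ('a set \<times> 'l) set \<Rightarrow> ('a set \<times> 'l) set \<Rightarrow> (('a set \<times> 'l) set \<Rightarrow>\<^sub>0 int)" where
  "symb_product G act LL A B = pair_product G act LL (SOME x. x \<in> A) (SOME y. y \<in> B)"

text \<open>The identity element is forced by the multiplication to be \<open>[(G/G)\<^sub>s]\<close> with
  \<open>s = sup LL\<^sub>G\<close>.\<close>

definition lattice_Burnside_ring ::
  "('a, 'm) monoid_scheme \<Rightarrow> ('a \<Rightarrow> 'l::lattice \<Rightarrow> 'l) \<Rightarrow> ('a set \<Rightarrow> 'l set)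
    \<Rightarrow> (('a set \<times> 'l) set \<Rightarrow>\<^sub>0 int) ring" where
  "lattice_Burnside_ring G act LL =
    \<lparr>carrier = carrier (free_Abelian_group (orbits G (pairs G LL) (pair_act G act))),
     monoid.mult = (\<lambda>x y. frag_extend (\<lambda>A. frag_extend (\<lambda>B. symb_product G act LL A B) y) x),
     one = frag_of (symb G act (carrier G) (Sup_fin (LL (carrier G)))),
     zero = 0,
     add = (+)\<rparr>"

text \<open>A prime \<open>q\<close> is encoded as \<open>enat q\<close>. The rings \<open>\<int>\<^bsub>(q)\<^esub>\<close> and \<open>\<int>\<^bsub>(\<infinity>)\<^esub> = \<int>\<close> are
  taken as subrings of the field \<^typ>\<open>rat\<close>.\<close>

definition Z_loc :: "enat \<Rightarrow> rat ring" where
  "Z_loc p =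
    \<lparr>carrier = (case p of
       enat q \<Rightarrow> {of_int a / of_int b | a b. \<not> int q dvd b}
     | \<infinity> \<Rightarrow> \<int>),
     monoid.mult = (*), one = 1, zero = 0, add = (+)\<rparr>"

text \<open>The tensor product over \<open>\<int>\<close> of two rings: the free abelian group on pairs modulo the
  subgroup generated by the biadditivity relations, with the multiplication induced by
  \<open>(a, r) * (b, s) = (a * b, r * s)\<close>.\<close>

definition tensor_free ::
  "('b, 'm) ring_scheme \<Rightarrow> ('c, 'n) ring_scheme \<Rightarrow> ('b \<times> 'c \<Rightarrow>\<^sub>0 int) ring" where
  "tensor_free A R =
    \<lparr>carrier = carrier (free_Abelian_group (carrier A \<times> carrier R)),
     monoid.mult = (\<lambda>x y. frag_extend (\<lambda>(a, r). frag_extend (\<lambda>(b, s).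
        frag_of (a \<otimes>\<^bsub>A\<^esub> b, r \<otimes>\<^bsub>R\<^esub> s)) y) x),
     one = frag_of (\<one>\<^bsub>A\<^esub>, \<one>\<^bsub>R\<^esub>),
     zero = 0,
     add = (+)\<rparr>"

definition tensor_relations ::
  "('b, 'm) ring_scheme \<Rightarrow> ('c, 'n) ring_scheme \<Rightarrow> ('b \<times> 'c \<Rightarrow>\<^sub>0 int) set" where
  "tensor_relations A R =
     {frag_of (a \<oplus>\<^bsub>A\<^esub> b, r) - frag_of (a, r) - frag_of (b, r) | a b r.
        a \<in> carrier A \<and> b \<in> carrier A \<and> r \<in> carrier R}
   \<union> {frag_of (a, r \<oplus>\<^bsub>R\<^esub> s) - frag_of (a, r) - frag_of (a, s) | a r s.
        a \<in> carrier A \<and> r \<in> carrier R \<and> s \<in> carrier R}"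

definition tensor_ring ::
  "('b, 'm) ring_scheme \<Rightarrow> ('c, 'n) ring_scheme \<Rightarrow> ('b \<times> 'c \<Rightarrow>\<^sub>0 int) set ring" where
  "tensor_ring A R = tensor_free A R Quot
     generate (free_Abelian_group (carrier A \<times> carrier R)) (tensor_relations A R)"

text \<open>\<open>B\<close> is isomorphic to \<open>R\<^bsub>(p)\<^esub>\<close>, where \<open>R\<^bsub>(q)\<^esub> = \<int>\<^bsub>(q)\<^esub> \<otimes> R\<close> and \<open>R\<^bsub>(\<infinity>)\<^esub> = R\<close>. The two
  rings have different types, so the case distinction is made on the level of the
  isomorphism.\<close>

definition iso_to_localization ::
  "enat \<Rightarrow> ('b, 'm) ring_scheme \<Rightarrow> ('c, 'n) ring_scheme \<Rightarrow> bool" where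
  "iso_to_localization p B R \<longleftrightarrow>
     (case p of enat q \<Rightarrow> B \<simeq> tensor_ring (Z_loc (enat q)) R | \<infinity> \<Rightarrow> B \<simeq> R)"


section \<open>Categories\<close>

record ('o, 'm) cat =
  Ob :: "'o set"
  Arr :: "'m set"
  Dom :: "'m \<Rightarrow> 'o"
  Cod :: "'m \<Rightarrow> 'o"
  Ident :: "'o \<Rightarrow> 'm"
  Comp :: "'m \<Rightarrow> 'm \<Rightarrow> 'm"

text \<open>\<open>Comp C g f\<close> is \<open>g\<close> after \<open>f\<close>, meaningful when \<open>Dom C g = Cod C f\<close>.\<close>

definition Hom :: "('o, 'm) cat \<Rightarrow> 'o \<Rightarrow> 'o \<Rightarrow> 'm set" where
  "Hom C I J = {f \<in> Arr C. Dom C f = I \<and> Cod C f = J}"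

locale category =
  fixes C :: "('o, 'm) cat"
  assumes Dom_closed: "f \<in> Arr C \<Longrightarrow> Dom C f \<in> Ob C"
    and Cod_closed: "f \<in> Arr C \<Longrightarrow> Cod C f \<in> Ob C"
    and Ident_closed: "I \<in> Ob C \<Longrightarrow> Ident C I \<in> Hom C I I"
    and Comp_closed: "\<lbrakk>f \<in> Hom C I J; g \<in> Hom C J K\<rbrakk> \<Longrightarrow> Comp C g f \<in> Hom C I K"
    and Comp_Ident_right: "f \<in> Hom C I J \<Longrightarrow> Comp C f (Ident C I) = f"
    and Comp_Ident_left: "f \<in> Hom C I J \<Longrightarrow> Comp C (Ident C J) f = f"
    and Comp_assoc: "\<lbrakk>f \<in> Hom C I J; g \<in> Hom C J K; h \<in> Hom C K L\<rbrakk>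
      \<Longrightarrow> Comp C h (Comp C g f) = Comp C (Comp C h g) f"

definition epimorphism :: "('o, 'm) cat \<Rightarrow> 'm \<Rightarrow> bool" where
  "epimorphism C e \<longleftrightarrow> e \<in> Arr C \<and>
     (\<forall>f \<in> Arr C. \<forall>g \<in> Arr C. Dom C f = Cod C e \<and> Dom C g = Cod C e \<and> Cod C f = Cod C g
        \<and> Comp C f e = Comp C g e \<longrightarrow> f = g)"

definition monomorphism :: "('o, 'm) cat \<Rightarrow> 'm \<Rightarrow> bool" where
  "monomorphism C m \<longleftrightarrow> m \<in> Arr C \<and>
     (\<forall>f \<in> Arr C. \<forall>g \<in> Arr C. Cod C f = Dom C m \<and> Cod C g = Dom C m \<and> Dom C f = Dom C g
        \<and> Comp C m f = Comp C m g \<longrightarrow> f = g)"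

definition isomorphism :: "('o, 'm) cat \<Rightarrow> 'm \<Rightarrow> bool" where
  "isomorphism C f \<longleftrightarrow> f \<in> Arr C \<and>
     (\<exists>g \<in> Hom C (Cod C f) (Dom C f).
        Comp C g f = Ident C (Dom C f) \<and> Comp C f g = Ident C (Cod C f))"

definition iso_class :: "('o, 'm) cat \<Rightarrow> 'o \<Rightarrow> 'o set" where
  "iso_class C I = {J \<in> Ob C. \<exists>f \<in> Hom C I J. isomorphism C f}"

definition iso_classes :: "('o, 'm) cat \<Rightarrow> 'o set set" where
  "iso_classes C = iso_class C ` Ob C"

definition Aut :: "('o, 'm) cat \<Rightarrow> 'o \<Rightarrow> 'm monoid" where
  "Aut C I = \<lparr>carrier = {f \<in> Hom C I I. isomorphism C f}, monoid.mult = Comp C, one = Ident C I\<rparr>"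

definition sylow_subgroup :: "nat \<Rightarrow> ('a, 'm) monoid_scheme \<Rightarrow> 'a set \<Rightarrow> bool" where
  "sylow_subgroup q A P \<longleftrightarrow> subgroup P A \<and> card P = q ^ multiplicity q (order A)"

text \<open>\<open>P\<close> is an admissible choice of \<open>Aut(I)\<^sub>p\<close>.\<close>

definition is_Aut_p :: "enat \<Rightarrow> ('o, 'm) cat \<Rightarrow> 'o \<Rightarrow> 'm set \<Rightarrow> bool" where
  "is_Aut_p p C I P \<longleftrightarrow>
     (case p of enat q \<Rightarrow> sylow_subgroup q (Aut C I) P | \<infinity> \<Rightarrow> P = carrier (Aut C I))"

definition is_coequalizer :: "('o, 'm) cat \<Rightarrow> 'm \<Rightarrow> 'm \<Rightarrow> 'm \<Rightarrow> bool" where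
  "is_coequalizer C f g c \<longleftrightarrow>
     f \<in> Arr C \<and> g \<in> Arr C \<and> Dom C f = Dom C g \<and> Cod C f = Cod C g \<and>
     c \<in> Arr C \<and> Dom C c = Cod C f \<and> Comp C c f = Comp C c g \<and>
     (\<forall>d \<in> Arr C. Dom C d = Cod C f \<and> Comp C d f = Comp C d g
        \<longrightarrow> (\<exists>!u. u \<in> Hom C (Cod C c) (Cod C d) \<and> Comp C u c = d))"

definition iso_closed :: "('o, 'm) cat \<Rightarrow> 'm set \<Rightarrow> bool" where
  "iso_closed C E \<longleftrightarrow> (\<forall>e \<in> E. \<forall>i. isomorphism C i \<longrightarrow>
     (Dom C i = Cod C e \<longrightarrow> Comp C i e \<in> E) \<and> (Cod C i = Dom C e \<longrightarrow> Comp C e i \<in> E))"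

definition epi_mono_factorization_system :: "('o, 'm) cat \<Rightarrow> 'm set \<Rightarrow> 'm set \<Rightarrow> bool" where
  "epi_mono_factorization_system C E M \<longleftrightarrow>
     (\<forall>e \<in> E. epimorphism C e) \<and> (\<forall>m \<in> M. monomorphism C m) \<and>
     iso_closed C E \<and> iso_closed C M \<and>
     (\<forall>f \<in> Arr C. \<exists>e \<in> E. \<exists>m \<in> M. Cod C e = Dom C m \<and> f = Comp C m e) \<and>
     (\<forall>e \<in> E. \<forall>m \<in> M. \<forall>e' \<in> E. \<forall>m' \<in> M.
        Cod C e = Dom C m \<and> Cod C e' = Dom C m' \<and> Dom C e = Dom C e' \<and> Cod C m = Cod C m'
        \<and> Comp C m e = Comp C m' e'
        \<longrightarrow> (\<exists>!i. i \<in> Hom C (Cod C e) (Cod C e') \<and> isomorphism C i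
               \<and> Comp C i e = e' \<and> Comp C m' i = m))"


section \<open>Abstract Burnside rings\<close>

text \<open>The free module on the isomorphism classes, equipped with a candidate multiplication
  \<open>m\<close> and identity \<open>u\<close>.\<close>

definition Burnside_module ::
  "enat \<Rightarrow> ('o, 'm) cat \<Rightarrow> (('o set \<Rightarrow>\<^sub>0 rat) \<Rightarrow> ('o set \<Rightarrow>\<^sub>0 rat) \<Rightarrow> ('o set \<Rightarrow>\<^sub>0 rat))
    \<Rightarrow> ('o set \<Rightarrow>\<^sub>0 rat) \<Rightarrow> (rat, 'o set \<Rightarrow>\<^sub>0 rat) module" where
  "Burnside_module p C m u =
    \<lparr>carrier = {x. Poly_Mapping.keys x \<subseteq> iso_classes C \<and>
                   range (Poly_Mapping.lookup x) \<subseteq> carrier (Z_loc p)},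
     monoid.mult = m, one = u, zero = 0, add = (+),
     smult = (\<lambda>c. Poly_Mapping.map (\<lambda>a. c * a))\<rparr>"

definition ghost_ring ::
  "enat \<Rightarrow> ('o, 'm) cat \<Rightarrow> (rat, 'o set \<Rightarrow> rat) module" where
  "ghost_ring p C =
    \<lparr>carrier = iso_classes C \<rightarrow>\<^sub>E carrier (Z_loc p),
     monoid.mult = (\<lambda>x y. \<lambda>A \<in> iso_classes C. x A * y A),
     one = (\<lambda>A \<in> iso_classes C. 1),
     zero = (\<lambda>A \<in> iso_classes C. 0),
     add = (\<lambda>x y. \<lambda>A \<in> iso_classes C. x A + y A),
     smult = (\<lambda>c x. \<lambda>A \<in> iso_classes C. c * x A)\<rparr>"

text \<open>\<open>|Hom(I, J)|\<close> depends only on the isomorphism classes of \<open>I\<close> and \<open>J\<close>, so any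
  representatives may be chosen.\<close>

definition hom_number :: "('o, 'm) cat \<Rightarrow> 'o set \<Rightarrow> 'o set \<Rightarrow> nat" where
  "hom_number C A B = card (Hom C (SOME I. I \<in> A) (SOME J. J \<in> B))"

definition Burnside_map :: "('o, 'm) cat \<Rightarrow> ('o set \<Rightarrow>\<^sub>0 rat) \<Rightarrow> ('o set \<Rightarrow> rat)" where
  "Burnside_map C x = (\<lambda>A \<in> iso_classes C.
     \<Sum>B \<in> Poly_Mapping.keys x. Poly_Mapping.lookup x B * of_nat (hom_number C A B))"

text \<open>The algebra structure given by \<open>m\<close> and \<open>u\<close> makes the free module an abstract Burnside
  ring. (The library's algebras are commutative; that is no restriction here, as the algebra
  embeds into the ghost ring.)\<close>

definition abstract_Burnside_structure ::
  "enat \<Rightarrow> ('o, 'm) cat \<Rightarrow> (('o set \<Rightarrow>\<^sub>0 rat) \<Rightarrow> ('o set \<Rightarrow>\<^sub>0 rat) \<Rightarrow> ('o set \<Rightarrow>\<^sub>0 rat))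
    \<Rightarrow> ('o set \<Rightarrow>\<^sub>0 rat) \<Rightarrow> bool" where
  "abstract_Burnside_structure p C m u \<longleftrightarrow>
     (let A = Burnside_module p C m u in
       algebra (Z_loc p) A \<and>
       Burnside_map C \<in> ring_hom A (ghost_ring p C) \<and>
       (\<forall>c \<in> carrier (Z_loc p). \<forall>x \<in> carrier A.
          Burnside_map C (c \<odot>\<^bsub>A\<^esub> x) = c \<odot>\<^bsub>ghost_ring p C\<^esub> Burnside_map C x) \<and>
       inj_on (Burnside_map C) (carrier A))"


section \<open>The category of elements\<close>

type_synonym ('a, 'l) el_obj = "'a set set \<times> ('a set \<Rightarrow> 'l)"

text \<open>The object \<open>(G/K, \<pi>\<^sub>s)\<close>; for \<open>(K, s)\<close> in \<^term>\<open>pairs G LL\<close> the value \<open>act r s\<close> is the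
  same for all \<open>r\<close> in a left coset of \<open>K\<close>.\<close>

definition el_obj ::
  "('a, 'm) monoid_scheme \<Rightarrow> ('a \<Rightarrow> 'l \<Rightarrow> 'l) \<Rightarrow> 'a set \<Rightarrow> 'l \<Rightarrow> ('a, 'l) el_obj" where
  "el_obj G act K s = (lcosets\<^bsub>G\<^esub> K, \<lambda>C \<in> lcosets\<^bsub>G\<^esub> K. act (SOME r. r \<in> C) s)"

text \<open>The \<open>G\<close>-map \<open>rU \<mapsto> rgK\<close>: if \<open>U \<subseteq> gKg\<^sup>-\<^sup>1\<close> then \<open>rUgK = rgK\<close> as a product of sets.\<close>

definition coset_map ::
  "('a, 'm) monoid_scheme \<Rightarrow> 'a set \<Rightarrow> 'a set \<Rightarrow> 'a \<Rightarrow> ('a set \<Rightarrow> 'a set)" where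
  "coset_map G U K g = (\<lambda>C \<in> lcosets\<^bsub>G\<^esub> U. C <#>\<^bsub>G\<^esub> (g <#\<^bsub>G\<^esub> K))"

text \<open>An arrow is a map tagged with its domain and codomain.\<close>

type_synonym ('a, 'l) el_arr = "('a, 'l) el_obj \<times> ('a set \<Rightarrow> 'a set) \<times> ('a, 'l) el_obj"

definition el_lambda ::
  "('a, 'm) monoid_scheme \<Rightarrow> ('a \<Rightarrow> 'l \<Rightarrow> 'l) \<Rightarrow> 'a set \<Rightarrow> 'l \<Rightarrow> 'a set \<Rightarrow> 'l \<Rightarrow> 'a
    \<Rightarrow> ('a, 'l) el_arr" where
  "el_lambda G act U t K s g = (el_obj G act U t, coset_map G U K g, el_obj G act K s)"

definition El ::
  "('a, 'm) monoid_scheme \<Rightarrow> ('a \<Rightarrow> 'l::lattice \<Rightarrow> 'l) \<Rightarrow> ('a set \<Rightarrow> 'l set)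
    \<Rightarrow> (('a, 'l) el_obj, ('a, 'l) el_arr) cat" where
  "El G act LL =
    \<lparr>Ob = {el_obj G act K s | K s. (K, s) \<in> pairs G LL},
     Arr = {el_lambda G act U t K s g | U t K s g.
              (U, t) \<in> pairs G LL \<and> (K, s) \<in> pairs G LL \<and>
              g \<in> carrier G \<and> U \<subseteq> conj_set G g K \<and> t \<le> act g s},
     Dom = (\<lambda>(I, f, J). I),
     Cod = (\<lambda>(I, f, J). J),
     Ident = (\<lambda>I. (I, \<lambda>C \<in> fst I. C, I)),
     Comp = (\<lambda>(J', g, L) (I, f, J). (I, compose (fst I) g f, L))\<rparr>"

definition el_sigma ::
  "('a, 'm) monoid_scheme \<Rightarrow> ('a \<Rightarrow> 'l \<Rightarrow> 'l) \<Rightarrow> 'a set \<Rightarrow> 'l \<Rightarrow> 'a \<Rightarrow> ('a, 'l) el_arr" where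
  "el_sigma G act U t g = el_lambda G act U t U t g"

definition gen_prod :: "('a, 'm) monoid_scheme \<Rightarrow> 'a \<Rightarrow> 'a set \<Rightarrow> 'a set" where
  "gen_prod G g U = generate G {g} <#>\<^bsub>G\<^esub> U"


text \<open>The data above do form a category, and the pair \<open>(K, s)\<close> can be recovered from the
  object \<open>(G/K, \<pi>\<^sub>s)\<close>.\<close>

context admissible_family begin

lemma is_grp: "group G" using group_hom group_hom.axioms(1) by blast

lemma conj_set_iff:
  assumes "subgroup K G" "g \<in> carrier G"
  shows "x \<in> conj_set G g K \<longleftrightarrow> x \<in> carrier G \<and> inv g \<otimes> x \<otimes> g \<in> K"
proof -
  interpret G: group G by (rule is_grp)
  have "K \<subseteq> carrier G" using assms(1) by (rule subgroup.subset)
  then show ?thesis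
  proof (intro iffI)
    assume "x \<in> conj_set G g K"
    then obtain k where k: "k \<in> K" "x = g \<otimes> k \<otimes> inv g"
      by (auto simp: conj_set_def r_coset_def l_coset_def)
    moreover have "k \<in> carrier G" using k \<open>K \<subseteq> carrier G\<close> by auto
    moreover have "inv g \<otimes> (g \<otimes> k) = k" if "k \<in> carrier G" for k
      using that assms by (simp add: G.m_assoc[symmetric])
    ultimately show "x \<in> carrier G \<and> inv g \<otimes> x \<otimes> g \<in> K"
      using assms by (auto simp: G.m_assoc)
  next
    assume a: "x \<in> carrier G \<and> inv g \<otimes> x \<otimes> g \<in> K"
    moreover have "g \<otimes> (inv g \<otimes> k) = k" if "k \<in> carrier G" for k
      using that assms by (simp add: G.m_assoc[symmetric])
    ultimately have "x = g \<otimes> (inv g \<otimes> x \<otimes> g) \<otimes> inv g"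
      using assms by (simp add: G.m_assoc)
    with a have "x = g \<otimes> (inv g \<otimes> x \<otimes> g) \<otimes> inv g \<and> inv g \<otimes> x \<otimes> g \<in> K" by blast
    then show "x \<in> conj_set G g K"
      unfolding conj_set_def r_coset_def l_coset_def by blast
  qed
qed

lemma conj_set_conj_set:
  assumes "subgroup K G" "g \<in> carrier G" "h \<in> carrier G" "U \<subseteq> conj_set G g H" "H \<subseteq> conj_set G h K" "subgroup H G"
  shows "U \<subseteq> conj_set G (g \<otimes> h) K"
proof
  interpret G: group G by (rule is_grp)
  fix x assume "x \<in> U"
  then have "x \<in> conj_set G g H" using assms by auto
  then have x: "x \<in> carrier G" "inv g \<otimes> x \<otimes> g \<in> H" using conj_set_iff assms by auto
  then have "inv h \<otimes> (inv g \<otimes> x \<otimes> g) \<otimes> h \<in> K" using conj_set_iff assms by auto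
  moreover have "inv h \<otimes> (inv g \<otimes> x \<otimes> g) \<otimes> h = inv (g \<otimes> h) \<otimes> x \<otimes> (g \<otimes> h)"
    using x assms by (simp add: G.m_assoc G.inv_mult_group)
  ultimately show "x \<in> conj_set G (g \<otimes> h) K" using conj_set_iff assms x by auto
qed

lemma coset_map_coset:
  assumes "subgroup U G" "subgroup K G" "g \<in> carrier G" "U \<subseteq> conj_set G g K" "r \<in> carrier G"
  shows "coset_map G U K g (r <#\<^bsub>G\<^esub> U) = (r \<otimes> g) <#\<^bsub>G\<^esub> K"
proof -
  interpret G: group G by (rule is_grp)
  have sub: "U \<subseteq> carrier G" "K \<subseteq> carrier G" using assms subgroup.subset by auto
  have "(r <#\<^bsub>G\<^esub> U) <#> (g <#\<^bsub>G\<^esub> K) = (r \<otimes> g) <#\<^bsub>G\<^esub> K"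
  proof (intro equalityI subsetI)
    fix x assume "x \<in> (r <#\<^bsub>G\<^esub> U) <#> (g <#\<^bsub>G\<^esub> K)"
    then obtain u k where uk: "u \<in> U" "k \<in> K" "x = r \<otimes> u \<otimes> (g \<otimes> k)"
      by (auto simp: l_coset_def set_mult_def)
    then have "inv g \<otimes> u \<otimes> g \<in> K" using conj_set_iff assms by auto
    then have "inv g \<otimes> u \<otimes> g \<otimes> k \<in> K" using uk assms(2) subgroup.m_closed by metis
    moreover have "x = r \<otimes> g \<otimes> (inv g \<otimes> u \<otimes> g \<otimes> k)"
    proof -
      have c: "u \<in> carrier G" "k \<in> carrier G" using uk sub by auto
      have "g \<otimes> (inv g \<otimes> (u \<otimes> (g \<otimes> k))) = u \<otimes> (g \<otimes> k)"
        using c assms by (simp add: G.m_assoc[symmetric])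
      then show ?thesis using c assms uk by (simp add: G.m_assoc)
    qed
    ultimately show "x \<in> (r \<otimes> g) <#\<^bsub>G\<^esub> K" by (auto simp: l_coset_def)
  next
    fix x assume "x \<in> (r \<otimes> g) <#\<^bsub>G\<^esub> K"
    then obtain k where k: "k \<in> K" "x = r \<otimes> g \<otimes> k" by (auto simp: l_coset_def)
    then have "x = r \<otimes> \<one> \<otimes> (g \<otimes> k)" using sub assms by (simp add: G.m_assoc subset_iff)
    then show "x \<in> (r <#\<^bsub>G\<^esub> U) <#> (g <#\<^bsub>G\<^esub> K)"
      using k subgroup.one_closed[OF assms(1)] unfolding l_coset_def set_mult_def by blast
  qed
  moreover have "r <#\<^bsub>G\<^esub> U \<in> lcosets U" using assms by (auto simp: LCOSETS_def)
  ultimately show ?thesis by (simp add: coset_map_def)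
qed

lemma self_coset: assumes "subgroup U G" shows "U \<in> lcosets U"
proof -
  interpret G: group G by (rule is_grp)
  have "\<one> <#\<^bsub>G\<^esub> U = U" using G.lcos_mult_one[OF subgroup.subset[OF assms]] .
  then show ?thesis unfolding LCOSETS_def using G.one_closed by blast
qed

lemma lcosets_inj:
  assumes "subgroup U G" "subgroup K G" "lcosets U = lcosets K" shows "U = K"
proof -
  interpret G: group G by (rule is_grp)
  have aux: "A = B" if asm: "subgroup A G" "subgroup B G" "A \<in> lcosets B" for A B
  proof -
    obtain a where a: "a \<in> carrier G" "A = a <#\<^bsub>G\<^esub> B" using asm by (auto simp: LCOSETS_def)
    have "\<one> \<in> a <#\<^bsub>G\<^esub> B" using subgroup.one_closed[OF asm(1)] a(2) by simp
    then have "\<one> <#\<^bsub>G\<^esub> B = a <#\<^bsub>G\<^esub> B" using G.l_repr_independence[OF _ a(1) asm(2)] by auto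
    then show ?thesis using a G.lcos_mult_one[OF subgroup.subset[OF asm(2)]] by simp
  qed
  show ?thesis using aux[OF assms(1,2)] self_coset[OF assms(1)] assms(3) by simp
qed

lemma el_obj_inj:
  assumes "(U, t) \<in> pairs G LL" "(K, s) \<in> pairs G LL" "el_obj G act U t = el_obj G act K s"
  shows "U = K \<and> t = s"
proof -
  have sg: "subgroup U G" "subgroup K G" "t \<in> LL U" "s \<in> LL K" using assms by (auto simp: pairs_def)
  have UK: "U = K"
    by (rule lcosets_inj[OF sg(1,2)]) (use assms(3) in \<open>simp add: el_obj_def\<close>)
  define r where "r = (SOME r. r \<in> U)"
  have r: "r \<in> U" unfolding r_def using subgroup.one_closed[OF sg(1)] by (rule someI)
  have "snd (el_obj G act U t) U = snd (el_obj G act K s) U" using assms(3) by simp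
  then have "act r t = act r s" using self_coset[OF sg(1)] UK by (simp add: el_obj_def r_def)
  moreover have "act r t = t" by (rule fixed[OF sg(1) r sg(3)])
  moreover have "act r s = s" by (rule fixed[OF sg(1) r]) (use sg(4) UK in simp)
  ultimately show ?thesis using UK by simp
qed

lemma act_comp: "\<lbrakk>g \<in> carrier G; h \<in> carrier G\<rbrakk> \<Longrightarrow> act (g \<otimes> h) s = act g (act h s)"
  by (rule composition_rule) auto

lemma act_one: "act \<one> s = s" using id_eq_one by (metis UNIV_I restrict_apply')

lemma El_arr:
  "f \<in> Arr (El G act LL) \<longleftrightarrow> (\<exists>U t K s g. f = el_lambda G act U t K s g \<and> (U, t) \<in> pairs G LL \<and> (K, s) \<in> pairs G LL \<and>
              g \<in> carrier G \<and> U \<subseteq> conj_set G g K \<and> t \<le> act g s)" by (auto simp: El_def)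

lemma coset_map_comp:
  assumes "subgroup U G" "subgroup K G" "subgroup H G" "g \<in> carrier G" "U \<subseteq> conj_set G g K" 
   "h \<in> carrier G" "K \<subseteq> conj_set G h H"
  shows "compose (lcosets U) (coset_map G K H h) (coset_map G U K g) = coset_map G U H (g \<otimes> h)"
proof
  interpret G: group G by (rule is_grp)
  have c: "U \<subseteq> conj_set G (g \<otimes> h) H" using conj_set_conj_set assms by metis
  fix C
  show "compose (lcosets U) (coset_map G K H h) (coset_map G U K g) C = coset_map G U H (g \<otimes> h) C"
  proof (cases "C \<in> lcosets U")
    case True
    then obtain r where "r \<in> carrier G" "C = r <#\<^bsub>G\<^esub> U" by (auto simp: LCOSETS_def)
    then show ?thesis using True assms c by (simp add: compose_def coset_map_coset G.m_assoc)
  qed (simp add: compose_def coset_map_def)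
qed

lemma el_comp:
  assumes "(U, t) \<in> pairs G LL" "(K, s) \<in> pairs G LL" "g \<in> carrier G" "U \<subseteq> conj_set G g K" "t \<le> act g s"
   "(H, r) \<in> pairs G LL" "h \<in> carrier G" "K \<subseteq> conj_set G h H" "s \<le> act h r"
  shows "Comp (El G act LL) (el_lambda G act K s H r h) (el_lambda G act U t K s g) = el_lambda G act U t H r (g \<otimes> h)"
    "el_lambda G act U t H r (g \<otimes> h) \<in> Arr (El G act LL)"
proof -
  interpret G: group G by (rule is_grp)
  have sg: "subgroup U G" "subgroup K G" "subgroup H G" using assms by (auto simp: pairs_def)
  show "Comp (El G act LL) (el_lambda G act K s H r h) (el_lambda G act U t K s g) = el_lambda G act U t H r (g \<otimes> h)"
    using coset_map_comp[OF sg assms(3,4,7,8)] by (simp add: El_def el_lambda_def el_obj_def)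
  have "act g s \<le> act g (act h r)" using act_mono assms by blast
  then have "t \<le> act (g \<otimes> h) r" using assms act_comp by (metis order_trans)
  moreover have "U \<subseteq> conj_set G (g \<otimes> h) H" using conj_set_conj_set assms sg by metis
  ultimately show "el_lambda G act U t H r (g \<otimes> h) \<in> Arr (El G act LL)" unfolding El_arr using assms by blast
qed

lemma El_dom_cod[simp]: "Dom (El G act LL) (el_lambda G act U t K s g) = el_obj G act U t"
  "Cod (El G act LL) (el_lambda G act U t K s g) = el_obj G act K s"
  by (auto simp: El_def el_lambda_def)

lemma El_id:
  assumes "(U, t) \<in> pairs G LL"
  shows "Ident (El G act LL) (el_obj G act U t) = el_lambda G act U t U t \<one>"
    "el_lambda G act U t U t \<one> \<in> Arr (El G act LL)"
proof -
  interpret G: group G by (rule is_grp)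
  have sg: "subgroup U G" using assms by (auto simp: pairs_def)
  have c: "U \<subseteq> conj_set G \<one> U"
    using conj_set_iff[OF sg] subgroup.subset[OF sg] by (auto simp: subset_iff)
  show "el_lambda G act U t U t \<one> \<in> Arr (El G act LL)" using c assms act_one unfolding El_arr by (metis G.one_closed order_refl)
  have "(\<lambda>C\<in>lcosets U. C) = coset_map G U U \<one>"
  proof
    fix C show "(\<lambda>C\<in>lcosets U. C) C = coset_map G U U \<one> C"
    proof (cases "C \<in> lcosets U")
      case True
      then obtain r where "r \<in> carrier G" "C = r <#\<^bsub>G\<^esub> U" by (auto simp: LCOSETS_def)
      then show ?thesis using True coset_map_coset[OF sg sg _ c] by simp
    qed (simp add: coset_map_def)
  qed
  then show "Ident (El G act LL) (el_obj G act U t) = el_lambda G act U t U t \<one>"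
    by (simp add: El_def el_lambda_def el_obj_def)
qed

lemma El_homE:
  assumes "f \<in> Hom (El G act LL) (el_obj G act U t) (el_obj G act K s)" "(U, t) \<in> pairs G LL" "(K, s) \<in> pairs G LL"
  obtains g where "f = el_lambda G act U t K s g" "g \<in> carrier G" "U \<subseteq> conj_set G g K" "t \<le> act g s"
proof -
  from assms obtain U' t' K' s' g where *: "f = el_lambda G act U' t' K' s' g" "(U', t') \<in> pairs G LL" "(K', s') \<in> pairs G LL"
      "g \<in> carrier G" "U' \<subseteq> conj_set G g K'" "t' \<le> act g s'" 
      "el_obj G act U' t' = el_obj G act U t" "el_obj G act K' s' = el_obj G act K s"
    by (auto simp: Hom_def El_arr)
  then show ?thesis using that el_obj_inj assms by metis
qed

lemma El_ob: "I \<in> Ob (El G act LL) \<longleftrightarrow> (\<exists>U t. I = el_obj G act U t \<and> (U, t) \<in> pairs G LL)"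
  by (auto simp: El_def)

lemma El_arr_ob: "f \<in> Arr (El G act LL) \<Longrightarrow> Dom (El G act LL) f \<in> Ob (El G act LL) \<and> Cod (El G act LL) f \<in> Ob (El G act LL)"
  unfolding El_arr El_ob by (metis El_dom_cod)

lemma El_HomE2:
  assumes "f \<in> Hom (El G act LL) I J"
  obtains U t K s where "I = el_obj G act U t" "J = el_obj G act K s" "(U, t) \<in> pairs G LL" "(K, s) \<in> pairs G LL"
proof -
  from assms have "I \<in> Ob (El G act LL)" "J \<in> Ob (El G act LL)" using El_arr_ob[of f] unfolding Hom_def by blast+
  then show ?thesis using that El_ob by metis
qed

lemma El_category: "category (El G act LL)"
proof
  interpret G: group G by (rule is_grp)
  let ?C = "El G act LL"
  show "f \<in> Arr ?C \<Longrightarrow> Dom ?C f \<in> Ob ?C" "f \<in> Arr ?C \<Longrightarrow> Cod ?C f \<in> Ob ?C" for f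
    using El_arr_ob[of f] by blast+
  show "Ident ?C I \<in> Hom ?C I I" if "I \<in> Ob ?C" for I
    using that El_id by (auto simp: El_ob Hom_def)
  show "Comp ?C g f \<in> Hom ?C I K" if fg: "f \<in> Hom ?C I J" "g \<in> Hom ?C J K" for f g I J K
  proof -
    obtain U t V v where 1: "I = el_obj G act U t" "J = el_obj G act V v" "(U, t) \<in> pairs G LL" "(V, v) \<in> pairs G LL"
      using El_HomE2 fg by metis
    obtain W w where 2: "K = el_obj G act W w" "(W, w) \<in> pairs G LL"
      using El_HomE2 fg by metis
    from 1 2 fg show ?thesis
      apply -
      apply (simp)
      apply (erule El_homE, assumption, assumption)
      apply (erule El_homE, assumption, assumption)
      by (auto simp: el_comp Hom_def)
  qed
  show "Comp ?C f (Ident ?C I) = f" "Comp ?C (Ident ?C J) f = f" if f: "f \<in> Hom ?C I J" for f I J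
  proof -
    obtain U t V v where 1: "I = el_obj G act U t" "J = el_obj G act V v" "(U, t) \<in> pairs G LL" "(V, v) \<in> pairs G LL"
      using El_HomE2 f by metis
    obtain g where g: "f = el_lambda G act U t V v g" "g \<in> carrier G" "U \<subseteq> conj_set G g V" "t \<le> act g v"
      using El_homE 1 f by metis
    have *: "(U, t) \<in> pairs G LL \<Longrightarrow> U \<subseteq> conj_set G \<one> U" for U t
      by (auto simp: pairs_def conj_set_iff subgroup.mem_carrier)
    show "Comp ?C f (Ident ?C I) = f" "Comp ?C (Ident ?C J) f = f"
      using g 1 *[OF 1(3)] *[OF 1(4)] by (auto simp: El_id el_comp act_one)
  qed
  show "Comp ?C h (Comp ?C g f) = Comp ?C (Comp ?C h g) f"
    if fg: "f \<in> Hom ?C I J" "g \<in> Hom ?C J K" "h \<in> Hom ?C K L" for f g h I J K L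
  proof -
    obtain U t V v where 1: "I = el_obj G act U t" "J = el_obj G act V v" "(U, t) \<in> pairs G LL" "(V, v) \<in> pairs G LL"
      using El_HomE2 fg by metis
    obtain W w Z z where 2: "K = el_obj G act W w" "L = el_obj G act Z z" "(W, w) \<in> pairs G LL" "(Z, z) \<in> pairs G LL"
      using El_HomE2 fg by metis
    obtain a where a: "f = el_lambda G act U t V v a" "a \<in> carrier G" "U \<subseteq> conj_set G a V" "t \<le> act a v"
      using El_homE 1 fg by metis
    obtain b where b: "g = el_lambda G act V v W w b" "b \<in> carrier G" "V \<subseteq> conj_set G b W" "v \<le> act b w"
      using El_homE 1 2 fg by metis
    obtain c where c: "h = el_lambda G act W w Z z c" "c \<in> carrier G" "W \<subseteq> conj_set G c Z" "w \<le> act c z"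
      using El_homE 2 fg by metis
    have sg: "subgroup U G" "subgroup V G" "subgroup W G" "subgroup Z G" using 1 2 by (auto simp: pairs_def)
    have i: "U \<subseteq> conj_set G (a \<otimes> b) W" "V \<subseteq> conj_set G (b \<otimes> c) Z"
      using conj_set_conj_set sg a b c by metis+
    have le: "t \<le> act (a \<otimes> b) w" "v \<le> act (b \<otimes> c) z"
      using act_mono[OF a(2) b(4)] act_mono[OF b(2) c(4)] act_comp a b c order_trans by metis+
    show ?thesis using 1 2 a b c i le by (simp add: el_comp G.m_assoc)
  qed
qed

end

end

theory Submission
  imports Defs "HOL-Library.Product_Order"
begin

text \<open>
  Order the pairs \<open>(K, s)\<close> componentwise: \<open>(K, s) \<le> (U, t)\<close> iff \<open>K \<subseteq> U\<close> and \<open>s \<le> t\<close>. This gives a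
  finite poset on which \<open>G\<close> acts by order automorphisms, and a morphism from \<open>x\<close> to \<open>y\<close> in the
  category of elements is a coset \<open>gK\<close>, \<open>y = (K, s)\<close>, with \<open>x \<le> g.y\<close>. All parts of the theorem
  are statements about this \<open>G\<close>-poset; part (d) is the description of morphisms just given
  (\<open>card_Hom_El\<close>).

  The action preserves the strictly increasing function \<open>rank\<close>. Hence \<open>x \<le> g.y\<close> together with
  \<open>y \<le> h.x\<close> forces \<open>x = g.y\<close>: isomorphism classes of objects are \<open>G\<close>-orbits of pairs, and every
  endomorphism is an automorphism.

  Parts (a) and (c): the \<open>G\<close>-maps between transitive \<open>G\<close>-sets are surjective, so every morphism is
  an epimorphism, and all morphisms together with the isomorphisms form a factorization system
  (\<open>epi_iso_factorization_system\<close>). A morphism \<open>gK\<close> from \<open>x\<close> to \<open>y\<close> coequalizes the automorphism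
  \<open>\<sigma>\<^sub>a\<close> and the identity iff the subgroup of the pair \<open>g.y \<ge> x\<close> contains \<open>a\<close>. Among the pairs above
  \<open>x\<close> with this property there is a least one, and it is the coequalizer (\<open>gen_pair_least\<close>,
  \<open>arrow_coequalizer\<close>).

  Part (b): the axioms of an admissible family imply that two pairs have the meet
  \<open>(K \<inter> U, s \<sqinter> t \<sqinter> sup LL\<^bsub>K \<inter> U\<^esub>)\<close> in the poset. Choosing \<open>a\<close> with \<open>x \<le> a.y\<close> and \<open>b\<close> with \<open>x \<le> b.z\<close>
  is the same as choosing \<open>h = a\<^sup>-\<^sup>1 b\<close> and \<open>a\<close> with \<open>x \<le> a.(y \<sqinter> h.z)\<close>. Grouping the \<open>h\<close> by double
  cosets and dividing by the orders of the subgroups turns this into the statement that the marks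
  \<open>|Hom(x, y)|\<close> are multiplicative for the product of the lattice Burnside ring (\<open>mark_mult\<close>).
  The table of marks is triangular with respect to \<open>rank\<close> and has a nonzero diagonal, so the Burnside
  map is injective, even with rational coefficients (\<open>hom_indep_El\<close>). Therefore the
  structure constants of the lattice Burnside ring define an algebra structure on
  \<open>\<int>\<^bsub>(p)\<^esub>\<Gamma>\<close>, and any algebra structure compatible with the Burnside map has the same structure
  constants. What remains, for a prime \<open>p\<close>, is to identify the algebra over \<open>\<int>\<^bsub>(p)\<^esub>\<close> that has these
  constants with the tensor product: the evaluation map
  \<open>\<Psi>\<close> from the free abelian group on \<open>\<int>\<^bsub>(p)\<^esub> \<times> \<Omega>\<close> is a surjective homomorphism whose kernel is
  generated by the biadditivity relations, because modulo these every element is a sum of tensors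
  \<open>k \<otimes> o\<close> with exactly one summand for each orbit \<open>o\<close> (\<open>kernel_\<Psi>\<close>).
\<close>

section \<open>Evaluating formal integer combinations\<close>

text \<open>The homomorphism from the free abelian group into the additive group of a ring that extends
  \<open>g\<close>. Counting morphisms into a formal sum of objects, taking a coefficient, and evaluating a formal
  sum of elementary tensors are all of this form.\<close>

definition frag_eval :: "('i \<Rightarrow> 'b::comm_ring_1) \<Rightarrow> ('i \<Rightarrow>\<^sub>0 int) \<Rightarrow> 'b" where
  "frag_eval g w = (\<Sum>i\<in>Poly_Mapping.keys w. of_int (Poly_Mapping.lookup w i) * g i)"

lemma frag_eval_superset:
  assumes "finite S" "Poly_Mapping.keys w \<subseteq> S"
  shows "frag_eval g w = (\<Sum>i\<in>S. of_int (Poly_Mapping.lookup w i) * g i)"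
  unfolding frag_eval_def using assms
  by (intro sum.mono_neutral_left) (auto simp: in_keys_iff)

lemma frag_eval_0 [simp]: "frag_eval g 0 = 0"
  and frag_eval_of [simp]: "frag_eval g (frag_of i) = g i"
  by (simp_all add: frag_eval_def)

lemma frag_eval_add: "frag_eval g (v + w) = frag_eval g v + frag_eval g w"
proof -
  let ?S = "Poly_Mapping.keys v \<union> Poly_Mapping.keys w"
  have "finite ?S" "Poly_Mapping.keys (v + w) \<subseteq> ?S" by (simp_all add: keys_add)
  then show ?thesis
    by (simp add: frag_eval_superset[of ?S] lookup_add sum.distrib ring_distribs)
qed

lemma frag_eval_uminus: "frag_eval g (- w) = - frag_eval g w"
  using frag_eval_add[of g w "- w"] by (simp add: add_eq_0_iff)

lemma frag_eval_diff: "frag_eval g (v - w) = frag_eval g v - frag_eval g w"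
  using frag_eval_add[of g v "- w"] by (simp add: frag_eval_uminus)

lemma frag_eval_sum: "frag_eval g (\<Sum>j\<in>J. w j) = (\<Sum>j\<in>J. frag_eval g (w j))"
  by (induction J rule: infinite_finite_induct) (simp_all add: frag_eval_add)

lemma frag_eval_extend: "frag_eval g (frag_extend f w) = frag_eval (\<lambda>i. frag_eval g (f i)) w"
proof -
  have "Poly_Mapping.keys w \<subseteq> UNIV" by simp
  then show ?thesis
    by (induction w rule: frag_induction) (simp_all add: frag_extend_diff frag_eval_diff)
qed

lemma frag_eval_cong: "(\<And>i. i \<in> Poly_Mapping.keys w \<Longrightarrow> g i = h i) \<Longrightarrow> frag_eval g w = frag_eval h w"
  by (simp add: frag_eval_def)

lemma frag_eval_mult_left: "frag_eval (\<lambda>i. k * g i) w = k * frag_eval g w"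
  and frag_eval_mult_right: "frag_eval (\<lambda>i. g i * k) w = frag_eval g w * k"
  by (simp_all add: frag_eval_def sum_distrib_left sum_distrib_right ac_simps)

text \<open>The multiplications of the lattice Burnside ring and of the tensor product are both bilinear
  extensions of a product \<open>d\<close> of generators. For such a multiplication \<^term>\<open>frag_eval g\<close> is
  multiplicative as soon as it is so on generators.\<close>

lemma frag_eval_bilinear:
  assumes d: "\<And>i j. \<lbrakk>i \<in> S; j \<in> S\<rbrakk> \<Longrightarrow> frag_eval g (d i j) = g i * g j"
    and "Poly_Mapping.keys x \<subseteq> S" "Poly_Mapping.keys y \<subseteq> S"
  shows "frag_eval g (frag_extend (\<lambda>i. frag_extend (d i) y) x) = frag_eval g x * frag_eval g y"
proof -
  have "frag_eval g (frag_extend (\<lambda>i. frag_extend (d i) y) x)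
      = frag_eval (\<lambda>i. frag_eval (\<lambda>j. frag_eval g (d i j)) y) x"
    by (simp add: frag_eval_extend)
  also have "\<dots> = frag_eval (\<lambda>i. frag_eval (\<lambda>j. g i * g j) y) x"
    using assms by (intro frag_eval_cong) (auto simp: subset_iff)
  finally show ?thesis by (simp add: frag_eval_mult_left frag_eval_mult_right)
qed

lemma keys_frag_extend_subset:
  assumes "\<And>i. i \<in> S \<Longrightarrow> Poly_Mapping.keys (f i) \<subseteq> tensors" "Poly_Mapping.keys x \<subseteq> S"
  shows "Poly_Mapping.keys (frag_extend f x) \<subseteq> tensors"
  using keys_frag_extend[of f x] assms by blast

section \<open>The ring \<open>\<int>\<^bsub>(p)\<^esub>\<close>\<close>

definition prime_or_infinity :: "enat \<Rightarrow> bool" where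
  "prime_or_infinity p \<longleftrightarrow> p = \<infinity> \<or> (\<exists>q. normalization_semidom_class.prime q \<and> p = enat q)"

lemma Z_loc_simps [simp]:
  "monoid.mult (Z_loc p) = (*)" "one (Z_loc p) = 1" "zero (Z_loc p) = 0" "add (Z_loc p) = (+)"
  by (simp_all add: Z_loc_def)

lemma Z_loc_closed:
  assumes "prime_or_infinity p"
  shows Z_loc_int: "of_int n \<in> carrier (Z_loc p)"
    and Z_loc_add: "\<lbrakk>a \<in> carrier (Z_loc p); b \<in> carrier (Z_loc p)\<rbrakk> \<Longrightarrow> a + b \<in> carrier (Z_loc p)"
    and Z_loc_mult: "\<lbrakk>a \<in> carrier (Z_loc p); b \<in> carrier (Z_loc p)\<rbrakk> \<Longrightarrow> a * b \<in> carrier (Z_loc p)"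
proof -
  show "of_int n \<in> carrier (Z_loc p)"
  proof (cases p)
    case (enat q)
    then have "\<not> int q dvd 1" using assms not_prime_1 by (auto simp: prime_or_infinity_def)
    then have "\<exists>a b. (of_int n :: rat) = of_int a / of_int b \<and> \<not> int q dvd b"
      by (intro exI[of _ n] exI[of _ 1]) simp
    then show ?thesis using enat by (simp add: Z_loc_def)
  qed (simp add: Z_loc_def)
  show "a + b \<in> carrier (Z_loc p)" "a * b \<in> carrier (Z_loc p)"
    if ab: "a \<in> carrier (Z_loc p)" "b \<in> carrier (Z_loc p)"
  proof -
    have "a + b \<in> carrier (Z_loc p) \<and> a * b \<in> carrier (Z_loc p)"
    proof (cases p)
      case (enat q)
      obtain x y where x: "a = of_int x / of_int y" "\<not> int q dvd y" using ab(1) enat by (auto simp: Z_loc_def)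
      obtain z w where z: "b = of_int z / of_int w" "\<not> int q dvd w" using ab(2) enat by (auto simp: Z_loc_def)
      have "normalization_semidom_class.prime (int q)" using assms enat by (auto simp: prime_or_infinity_def)
      then have "\<not> int q dvd y * w" using x z prime_dvd_mult_iff by blast
      moreover have "y \<noteq> 0" "w \<noteq> 0" using x z by auto
      then have "a + b = of_int (x * w + z * y) / of_int (y * w)" "a * b = of_int (x * z) / of_int (y * w)"
        using x z by (auto simp: add_frac_eq)
      ultimately show ?thesis using enat by (auto simp: Z_loc_def simp del: of_int_mult of_int_add)
    qed (use ab in \<open>auto simp: Z_loc_def\<close>)
    then show "a + b \<in> carrier (Z_loc p)" "a * b \<in> carrier (Z_loc p)" by auto
  qed
qed

lemma Z_loc_uminus: "\<lbrakk>prime_or_infinity p; a \<in> carrier (Z_loc p)\<rbrakk> \<Longrightarrow> - a \<in> carrier (Z_loc p)"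
  using Z_loc_mult[OF _ Z_loc_int[of p "-1"], of a] by simp

lemma Z_loc_0: "prime_or_infinity p \<Longrightarrow> 0 \<in> carrier (Z_loc p)"
  and Z_loc_1: "prime_or_infinity p \<Longrightarrow> 1 \<in> carrier (Z_loc p)"
  using Z_loc_int[of p 0] Z_loc_int[of p 1] by simp_all

lemma Z_loc_sum:
  "prime_or_infinity p \<Longrightarrow> (\<And>i. i \<in> I \<Longrightarrow> f i \<in> carrier (Z_loc p)) \<Longrightarrow> sum f I \<in> carrier (Z_loc p)"
  by (induction I rule: infinite_finite_induct) (auto simp: Z_loc_0 intro: Z_loc_add)

lemma Z_loc_cring: "prime_or_infinity p \<Longrightarrow> cring (Z_loc p)"
  by (intro cringI abelian_groupI comm_monoidI)
     (auto simp: Z_loc_0 Z_loc_1 Z_loc_add Z_loc_mult algebra_simps intro: bexI[of _ "- _"] Z_loc_uminus)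

section \<open>Quotients by kernels\<close>

text \<open>The fibres of \<open>\<Psi>\<close> are the cosets of its kernel, so sending an element to its fibre transports
  the operations of \<open>S\<close> to the quotient. This is the first isomorphism theorem, for an additive group
  \<open>F\<close> with a product.\<close>

lemma iso_Quot_of_surj_hom:
  assumes F: "abelian_group F" and S: "abelian_group S"
    and closed: "\<And>x y. \<lbrakk>x \<in> carrier F; y \<in> carrier F\<rbrakk> \<Longrightarrow> x \<otimes>\<^bsub>F\<^esub> y \<in> carrier F" "\<one>\<^bsub>F\<^esub> \<in> carrier F"
    and hom: "\<Psi> \<in> ring_hom F S" and surj: "carrier S \<subseteq> \<Psi> ` carrier F"
    and I: "I = {x \<in> carrier F. \<Psi> x = \<zero>\<^bsub>S\<^esub>}"
  shows "S \<simeq> F Quot I"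
proof -
  interpret F: abelian_group F by (rule F)
  interpret S: abelian_group S by (rule S)
  note \<Psi>c = ring_hom_closed[OF hom] and \<Psi>a = ring_hom_add[OF hom] and \<Psi>m = ring_hom_mult[OF hom]
    and \<Psi>1 = ring_hom_one[OF hom]
  define \<Xi> where "\<Xi> s = {x \<in> carrier F. \<Psi> x = s}" for s
  have coset: "I +>\<^bsub>F\<^esub> a = \<Xi> (\<Psi> a)" if a: "a \<in> carrier F" for a
  proof (intro equalityI subsetI)
    fix x assume "x \<in> I +>\<^bsub>F\<^esub> a"
    then show "x \<in> \<Xi> (\<Psi> a)" using a by (auto simp: a_r_coset_def' I \<Xi>_def \<Psi>a \<Psi>c)
  next
    fix x assume "x \<in> \<Xi> (\<Psi> a)"
    then have x: "x \<in> carrier F" "\<Psi> x = \<Psi> a" by (auto simp: \<Xi>_def)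
    have "x = (x \<oplus>\<^bsub>F\<^esub> (\<ominus>\<^bsub>F\<^esub> a)) \<oplus>\<^bsub>F\<^esub> a" using x a by (simp add: F.a_assoc F.l_neg)
    moreover have "\<Psi> (x \<oplus>\<^bsub>F\<^esub> (\<ominus>\<^bsub>F\<^esub> a)) = \<zero>\<^bsub>S\<^esub>"
    proof -
      have "\<Psi> (x \<oplus>\<^bsub>F\<^esub> (\<ominus>\<^bsub>F\<^esub> a)) \<oplus>\<^bsub>S\<^esub> \<Psi> a = \<Psi> a"
        using x a calculation by (metis F.a_inv_closed F.add.m_closed \<Psi>a)
      then show ?thesis using x a by (simp add: \<Psi>c S.add.r_cancel_one')
    qed
    ultimately show "x \<in> I +>\<^bsub>F\<^esub> a" using x a unfolding a_r_coset_def' I by blast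
  qed
  have ne: "\<exists>x\<in>carrier F. \<Psi> x = s" if "s \<in> carrier S" for s using that surj by blast
  have car: "carrier (F Quot I) = \<Xi> ` carrier S"
  proof -
    have "carrier (F Quot I) = (\<lambda>a. I +>\<^bsub>F\<^esub> a) ` carrier F"
      by (auto simp: FactRing_def A_RCOSETS_def')
    also have "\<dots> = (\<lambda>a. \<Xi> (\<Psi> a)) ` carrier F" using coset by (rule image_cong[OF refl])
    also have "\<dots> = \<Xi> ` carrier S" using surj \<Psi>c by (auto simp: image_iff)
    finally show ?thesis .
  qed
  have "inj_on \<Xi> (carrier S)"
  proof (rule inj_onI)
    fix s t assume st: "s \<in> carrier S" "t \<in> carrier S" "\<Xi> s = \<Xi> t"
    obtain x where "x \<in> carrier F" "\<Psi> x = s" using ne st by blast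
    then show "s = t" using st(3) unfolding \<Xi>_def by blast
  qed
  moreover have "\<Xi> \<in> ring_hom S (F Quot I)"
  proof (rule ring_hom_memI)
    show "\<Xi> s \<in> carrier (F Quot I)" if "s \<in> carrier S" for s using that car by blast
    fix s t assume st: "s \<in> carrier S" "t \<in> carrier S"
    obtain x y where xy: "x \<in> carrier F" "\<Psi> x = s" "y \<in> carrier F" "\<Psi> y = t" using ne st by metis
    have "\<Xi> s \<otimes>\<^bsub>F Quot I\<^esub> \<Xi> t = (\<Union>a\<in>\<Xi> s. \<Union>b\<in>\<Xi> t. \<Xi> (\<Psi> (a \<otimes>\<^bsub>F\<^esub> b)))"
      using closed coset by (auto simp: FactRing_def rcoset_mult_def \<Xi>_def)
    also have "\<dots> = (\<Union>a\<in>\<Xi> s. \<Union>b\<in>\<Xi> t. \<Xi> (s \<otimes>\<^bsub>S\<^esub> t))"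
      using \<Psi>m by (intro SUP_cong refl) (auto simp: \<Xi>_def)
    also have "\<dots> = \<Xi> (s \<otimes>\<^bsub>S\<^esub> t)" using xy by (auto simp: \<Xi>_def)
    finally show "\<Xi> (s \<otimes>\<^bsub>S\<^esub> t) = \<Xi> s \<otimes>\<^bsub>F Quot I\<^esub> \<Xi> t" by simp
    show "\<Xi> (s \<oplus>\<^bsub>S\<^esub> t) = \<Xi> s \<oplus>\<^bsub>F Quot I\<^esub> \<Xi> t"
    proof (intro equalityI subsetI)
      fix z assume "z \<in> \<Xi> (s \<oplus>\<^bsub>S\<^esub> t)"
      then have z: "z \<in> carrier F" "\<Psi> z = \<Psi> (x \<oplus>\<^bsub>F\<^esub> y)" using xy by (auto simp: \<Xi>_def \<Psi>a)
      then have "z \<in> I +>\<^bsub>F\<^esub> (x \<oplus>\<^bsub>F\<^esub> y)" using coset[of "x \<oplus>\<^bsub>F\<^esub> y"] xy by (simp add: \<Xi>_def)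
      then obtain i where i: "i \<in> carrier F" "\<Psi> i = \<zero>\<^bsub>S\<^esub>" "z = i \<oplus>\<^bsub>F\<^esub> (x \<oplus>\<^bsub>F\<^esub> y)"
        by (auto simp: a_r_coset_def' I)
      then have "z = (i \<oplus>\<^bsub>F\<^esub> x) \<oplus>\<^bsub>F\<^esub> y" using xy by (simp add: F.a_assoc)
      moreover have "i \<oplus>\<^bsub>F\<^esub> x \<in> \<Xi> s" "y \<in> \<Xi> t" using i xy st by (auto simp: \<Xi>_def \<Psi>a)
      ultimately show "z \<in> \<Xi> s \<oplus>\<^bsub>F Quot I\<^esub> \<Xi> t" by (auto simp: FactRing_def set_add_def')
    next
      fix z assume "z \<in> \<Xi> s \<oplus>\<^bsub>F Quot I\<^esub> \<Xi> t"
      then show "z \<in> \<Xi> (s \<oplus>\<^bsub>S\<^esub> t)" by (auto simp: FactRing_def set_add_def' \<Xi>_def \<Psi>a)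
    qed
  next
    show "\<Xi> \<one>\<^bsub>S\<^esub> = \<one>\<^bsub>F Quot I\<^esub>" using coset[OF closed(2)] \<Psi>1 by (simp add: FactRing_def)
  qed
  ultimately have "\<Xi> \<in> ring_iso S (F Quot I)" by (simp add: ring_iso_def bij_betw_def car)
  then show ?thesis unfolding is_ring_iso_def by blast
qed

section \<open>Abstract Burnside rings with integral structure constants\<close>

text \<open>A category whose isomorphism classes are indexed by \<open>X\<close>, together with integral structure
  constants \<open>c\<close> that realize the products of marks. The last assumption says that the columns of the
  table of marks are linearly independent over \<open>\<rat>\<close>. It follows that \<open>\<int>\<^bsub>(p)\<^esub>C\<close> is an
  abstract Burnside ring for every \<open>p\<close>, and that it is the localization of the ring on the free
  abelian group on \<open>X\<close> with structure constants \<open>c\<close>.\<close>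

locale burnside_basis =
  fixes C :: "('o, 'm) cat"
    and X :: "'x set"
    and \<beta> :: "'x \<Rightarrow> 'o set"
    and c :: "'x \<Rightarrow> 'x \<Rightarrow> ('x \<Rightarrow>\<^sub>0 int)"
    and e :: 'x
  assumes finite_X: "finite X"
    and bij_\<beta>: "bij_betw \<beta> X (iso_classes C)"
    and c_keys: "\<lbrakk>a \<in> X; b \<in> X\<rbrakk> \<Longrightarrow> Poly_Mapping.keys (c a b) \<subseteq> X"
    and e_in_X: "e \<in> X"
    and hom_mult: "\<lbrakk>A \<in> iso_classes C; a \<in> X; b \<in> X\<rbrakk> \<Longrightarrow>
      frag_eval (\<lambda>z. of_nat (hom_number C A (\<beta> z))) (c a b)
      = (of_nat (hom_number C A (\<beta> a)) * of_nat (hom_number C A (\<beta> b)) :: rat)"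
    and hom_one: "A \<in> iso_classes C \<Longrightarrow> hom_number C A (\<beta> e) = 1"
    and hom_indep: "\<And>f :: 'x \<Rightarrow> rat. \<lbrakk>\<And>A. A \<in> iso_classes C \<Longrightarrow>
        (\<Sum>a\<in>X. f a * of_nat (hom_number C A (\<beta> a))) = 0; b \<in> X\<rbrakk> \<Longrightarrow> f b = 0"
begin

definition homs :: "'o set \<Rightarrow> 'x \<Rightarrow> rat" where
  "homs A a = of_nat (hom_number C A (\<beta> a))"

definition basis_ring :: "('x \<Rightarrow>\<^sub>0 int) ring" where
  "basis_ring = \<lparr>carrier = carrier (free_Abelian_group X),
     monoid.mult = (\<lambda>x y. frag_extend (\<lambda>A. frag_extend (\<lambda>B. c A B) y) x),
     one = frag_of e, zero = 0, add = (+)\<rparr>"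

text \<open>The common carrier of all structures \<^term>\<open>Burnside_module p C m u\<close>.\<close>

definition \<B> :: "enat \<Rightarrow> ('o set \<Rightarrow>\<^sub>0 rat) set" where
  "\<B> p = {x. Poly_Mapping.keys x \<subseteq> iso_classes C \<and> range (Poly_Mapping.lookup x) \<subseteq> carrier (Z_loc p)}"

text \<open>Coordinates of an element of \<open>\<int>\<^bsub>(p)\<^esub>C\<close>, indexed by \<open>X\<close> in place of the isomorphism classes.\<close>

definition coef :: "('o set \<Rightarrow>\<^sub>0 rat) \<Rightarrow> 'x \<Rightarrow> rat" where
  "coef x a = Poly_Mapping.lookup x (\<beta> a)"

definition of_coef :: "('x \<Rightarrow> rat) \<Rightarrow> ('o set \<Rightarrow>\<^sub>0 rat)" where
  "of_coef f = (\<Sum>a\<in>X. Poly_Mapping.single (\<beta> a) (f a))"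

abbreviation \<Phi> where "\<Phi> \<equiv> Burnside_map C"

lemma \<beta>_in: "a \<in> X \<Longrightarrow> \<beta> a \<in> iso_classes C"
  using bij_\<beta> by (auto simp: bij_betw_def)

lemma \<beta>_eq_iff: "\<lbrakk>a \<in> X; b \<in> X\<rbrakk> \<Longrightarrow> \<beta> a = \<beta> b \<longleftrightarrow> a = b"
  using bij_\<beta> by (auto simp: bij_betw_def inj_on_def)

lemma keys_of_coef: "Poly_Mapping.keys (of_coef f) \<subseteq> iso_classes C"
  unfolding of_coef_def using \<beta>_in
  by (intro order_trans[OF keys_sum]) (auto split: if_splits)

lemma coef_of_coef: "a \<in> X \<Longrightarrow> coef (of_coef f) a = f a"
proof -
  assume a: "a \<in> X"
  have "coef (of_coef f) a = (\<Sum>b\<in>X. if b = a then f b else 0)"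
    unfolding coef_def of_coef_def lookup_sum
    using a \<beta>_eq_iff by (intro sum.cong) (auto simp: lookup_single when_def)
  then show ?thesis using a finite_X by simp
qed

lemma pm_eqI:
  assumes "Poly_Mapping.keys x \<subseteq> iso_classes C" "Poly_Mapping.keys y \<subseteq> iso_classes C"
    "\<And>a. a \<in> X \<Longrightarrow> coef x a = coef y a"
  shows "x = y"
proof (rule poly_mapping_eqI)
  fix A
  show "Poly_Mapping.lookup x A = Poly_Mapping.lookup y A"
  proof (cases "A \<in> iso_classes C")
    case True
    then obtain a where "a \<in> X" "A = \<beta> a" using bij_\<beta> by (auto simp: bij_betw_def)
    then show ?thesis using assms(3) by (simp add: coef_def)
  next
    case False
    then have "A \<notin> Poly_Mapping.keys x" "A \<notin> Poly_Mapping.keys y" using assms by auto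
    then show ?thesis by (simp add: in_keys_iff)
  qed
qed

lemma \<B>_keys: "x \<in> \<B> p \<Longrightarrow> Poly_Mapping.keys x \<subseteq> iso_classes C"
  and \<B>_coef: "x \<in> \<B> p \<Longrightarrow> coef x a \<in> carrier (Z_loc p)"
  by (auto simp: \<B>_def coef_def)

lemma \<B>I:
  assumes "prime_or_infinity p" "Poly_Mapping.keys x \<subseteq> iso_classes C"
    "\<And>a. a \<in> X \<Longrightarrow> coef x a \<in> carrier (Z_loc p)"
  shows "x \<in> \<B> p"
proof -
  have "Poly_Mapping.lookup x A \<in> carrier (Z_loc p)" for A
  proof (cases "A \<in> iso_classes C")
    case True
    then obtain a where "a \<in> X" "A = \<beta> a" using bij_\<beta> by (auto simp: bij_betw_def)
    then show ?thesis using assms(3) by (simp add: coef_def)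
  next
    case False
    then have "A \<notin> Poly_Mapping.keys x" using assms by auto
    then show ?thesis using assms(1) by (simp add: in_keys_iff Z_loc_0)
  qed
  then show ?thesis using assms(2) by (auto simp: \<B>_def)
qed

lemma of_coef_\<B>:
  "\<lbrakk>prime_or_infinity p; \<And>a. a \<in> X \<Longrightarrow> f a \<in> carrier (Z_loc p)\<rbrakk> \<Longrightarrow> of_coef f \<in> \<B> p"
  by (rule \<B>I) (simp_all add: keys_of_coef coef_of_coef)

lemma \<Phi>_outside: "A \<notin> iso_classes C \<Longrightarrow> \<Phi> x A = undefined"
  by (simp add: Burnside_map_def)

lemma Burnside_map_coef:
  assumes "Poly_Mapping.keys x \<subseteq> iso_classes C" "A \<in> iso_classes C"
  shows "\<Phi> x A = (\<Sum>a\<in>X. coef x a * homs A a)"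
proof -
  have fin: "finite (iso_classes C)" using bij_\<beta> finite_X bij_betw_finite by blast
  have "\<Phi> x A = (\<Sum>B\<in>iso_classes C. Poly_Mapping.lookup x B * of_nat (hom_number C A B))"
    unfolding Burnside_map_def using assms fin
    by (simp, intro sum.mono_neutral_left) (auto simp: in_keys_iff)
  also have "\<dots> = (\<Sum>a\<in>X. coef x a * homs A a)"
    unfolding coef_def homs_def
    by (rule sum.reindex_bij_betw[OF bij_\<beta>, symmetric])
  finally show ?thesis .
qed

lemma Burnside_map_of_coef: "A \<in> iso_classes C \<Longrightarrow> \<Phi> (of_coef f) A = (\<Sum>a\<in>X. f a * homs A a)"
  by (simp add: Burnside_map_coef keys_of_coef coef_of_coef)

text \<open>The coordinates of \<open>x - y\<close> give a vanishing linear combination of the columns of the table of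
  marks. Every identity in an abstract Burnside ring can therefore be checked in the ghost ring.\<close>

lemma Burnside_map_inject:
  assumes "Poly_Mapping.keys x \<subseteq> iso_classes C" "Poly_Mapping.keys y \<subseteq> iso_classes C"
    "\<And>A. A \<in> iso_classes C \<Longrightarrow> \<Phi> x A = \<Phi> y A"
  shows "x = y"
proof (rule pm_eqI[OF assms(1,2)])
  fix a assume "a \<in> X"
  moreover have "(\<Sum>a\<in>X. (coef x a - coef y a) * of_nat (hom_number C A (\<beta> a))) = 0"
    if "A \<in> iso_classes C" for A
    using assms(3)[OF that] that Burnside_map_coef[OF assms(1) that] Burnside_map_coef[OF assms(2) that]
    by (simp add: left_diff_distrib sum_subtractf homs_def)
  ultimately have "coef x a - coef y a = 0"
    using hom_indep[where f = "\<lambda>a. coef x a - coef y a" and b = a] by blast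
  then show "coef x a = coef y a" by simp
qed

lemma coef_add: "coef (x + y) a = coef x a + coef y a"
  by (simp add: coef_def lookup_add)

lemma coef_smult: "coef (Poly_Mapping.map (\<lambda>a. k * a) x) a = k * coef x a"
  by (simp add: coef_def Poly_Mapping.map.rep_eq when_def)

lemma keys_smult: "Poly_Mapping.keys (Poly_Mapping.map (\<lambda>a. k * a) x) \<subseteq> Poly_Mapping.keys (x :: _ \<Rightarrow>\<^sub>0 rat)"
  by (auto simp: in_keys_iff Poly_Mapping.map.rep_eq when_def)

lemma \<B>_add: "\<lbrakk>prime_or_infinity p; x \<in> \<B> p; y \<in> \<B> p\<rbrakk> \<Longrightarrow> x + y \<in> \<B> p"
  using keys_add[of x y] by (intro \<B>I) (auto simp: coef_add Z_loc_add \<B>_coef dest!: \<B>_keys)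

lemma \<B>_smult: "\<lbrakk>prime_or_infinity p; k \<in> carrier (Z_loc p); x \<in> \<B> p\<rbrakk> \<Longrightarrow> Poly_Mapping.map (\<lambda>a. k * a) x \<in> \<B> p"
  using keys_smult[of k x] by (intro \<B>I) (auto simp: coef_smult Z_loc_mult \<B>_coef dest!: \<B>_keys)

lemma \<B>_uminus: "\<lbrakk>prime_or_infinity p; x \<in> \<B> p\<rbrakk> \<Longrightarrow> - x \<in> \<B> p"
  by (intro \<B>I) (auto simp: coef_def Z_loc_uminus \<B>_coef[unfolded coef_def] keys_minus dest: \<B>_keys)

lemma \<B>_0: "prime_or_infinity p \<Longrightarrow> 0 \<in> \<B> p"
  by (intro \<B>I) (auto simp: coef_def Z_loc_0)

lemma \<B>_abelian_group: "prime_or_infinity p \<Longrightarrow> abelian_group (Burnside_module p C m u)"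
proof (intro abelian_groupI)
  assume p: "prime_or_infinity p"
  show "\<exists>y\<in>carrier (Burnside_module p C m u). y \<oplus>\<^bsub>Burnside_module p C m u\<^esub> x = \<zero>\<^bsub>Burnside_module p C m u\<^esub>"
    if "x \<in> carrier (Burnside_module p C m u)" for x
    using that \<B>_uminus[OF p] unfolding Burnside_module_def \<B>_def[symmetric] by (intro bexI[of _ "- x"]) auto
qed (auto simp: Burnside_module_def \<B>_def[symmetric] \<B>_add \<B>_0 ac_simps)

lemma \<Phi>_add:
  assumes "x \<in> \<B> p" "y \<in> \<B> p" "A \<in> iso_classes C"
  shows "\<Phi> (x + y) A = \<Phi> x A + \<Phi> y A"
proof -
  have "Poly_Mapping.keys (x + y) \<subseteq> iso_classes C" using keys_add[of x y] assms \<B>_keys by blast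
  then show ?thesis
    using assms by (simp add: Burnside_map_coef \<B>_keys coef_add ring_distribs sum.distrib)
qed

lemma \<Phi>_smult:
  assumes "x \<in> \<B> p" "A \<in> iso_classes C"
  shows "\<Phi> (Poly_Mapping.map (\<lambda>a. k * a) x) A = k * \<Phi> x A"
proof -
  have "Poly_Mapping.keys (Poly_Mapping.map (\<lambda>a. k * a) x) \<subseteq> iso_classes C"
    using keys_smult[of k x] assms \<B>_keys by blast
  then show ?thesis
    using assms by (simp add: Burnside_map_coef \<B>_keys coef_smult sum_distrib_left mult.assoc)
qed

definition burnside_mult :: "('o set \<Rightarrow>\<^sub>0 rat) \<Rightarrow> ('o set \<Rightarrow>\<^sub>0 rat) \<Rightarrow> ('o set \<Rightarrow>\<^sub>0 rat)" where
  "burnside_mult x y = of_coef (\<lambda>z. \<Sum>a\<in>X. \<Sum>b\<in>X. coef x a * coef y b * of_int (Poly_Mapping.lookup (c a b) z))"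

definition burnside_one :: "'o set \<Rightarrow>\<^sub>0 rat" where
  "burnside_one = of_coef (\<lambda>z. if z = e then 1 else 0)"

lemma burnside_mult_closed: "\<lbrakk>prime_or_infinity p; x \<in> \<B> p; y \<in> \<B> p\<rbrakk> \<Longrightarrow> burnside_mult x y \<in> \<B> p"
  unfolding burnside_mult_def by (intro of_coef_\<B> Z_loc_sum Z_loc_mult \<B>_coef Z_loc_int)

lemma burnside_one_closed: "prime_or_infinity p \<Longrightarrow> burnside_one \<in> \<B> p"
  unfolding burnside_one_def by (intro of_coef_\<B>) (auto simp: Z_loc_0 Z_loc_1)

text \<open>Both sides are bilinear, and on basis elements the equation is the defining property of the
  structure constants.\<close>

lemma \<Phi>_burnside_mult:
  assumes "x \<in> \<B> p" "y \<in> \<B> p" "A \<in> iso_classes C"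
  shows "\<Phi> (burnside_mult x y) A = \<Phi> x A * \<Phi> y A"
proof -
  have c: "(\<Sum>z\<in>X. of_int (Poly_Mapping.lookup (c a b) z) * homs A z) = homs A a * homs A b"
    if "a \<in> X" "b \<in> X" for a b
    using hom_mult[OF assms(3) that] frag_eval_superset[OF finite_X c_keys[OF that], of "homs A"]
    by (simp add: homs_def[abs_def])
  have "\<Phi> (burnside_mult x y) A = (\<Sum>z\<in>X. \<Sum>a\<in>X. \<Sum>b\<in>X. coef x a * coef y b * (of_int (Poly_Mapping.lookup (c a b) z) * homs A z))"
    unfolding burnside_mult_def by (simp add: Burnside_map_of_coef assms sum_distrib_right mult.assoc)
  also have "\<dots> = (\<Sum>a\<in>X. \<Sum>b\<in>X. \<Sum>z\<in>X. coef x a * coef y b * (of_int (Poly_Mapping.lookup (c a b) z) * homs A z))"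
    by (subst sum.swap) (intro sum.cong refl sum.swap)
  also have "\<dots> = (\<Sum>a\<in>X. \<Sum>b\<in>X. coef x a * coef y b * (homs A a * homs A b))"
    by (intro sum.cong refl) (simp add: sum_distrib_left[symmetric] c)
  also have "\<dots> = \<Phi> x A * \<Phi> y A"
    by (simp add: Burnside_map_coef[OF \<B>_keys[OF assms(1)] assms(3)] Burnside_map_coef[OF \<B>_keys[OF assms(2)] assms(3)]
      sum_product ac_simps)
  finally show ?thesis .
qed

lemma \<Phi>_burnside_one: "A \<in> iso_classes C \<Longrightarrow> \<Phi> burnside_one A = 1"
  using finite_X e_in_X hom_one[of A]
  by (simp add: burnside_one_def Burnside_map_of_coef homs_def if_distrib[of "\<lambda>x. x * _"] sum.delta' cong: if_cong)

lemma \<B>_inject: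
  "\<lbrakk>x \<in> \<B> p; y \<in> \<B> p; \<And>A. A \<in> iso_classes C \<Longrightarrow> \<Phi> x A = \<Phi> y A\<rbrakk> \<Longrightarrow> x = y"
  by (rule Burnside_map_inject) (auto dest: \<B>_keys)

lemma carrier_\<B>: "carrier (Burnside_module p C m u) = \<B> p"
  by (simp add: Burnside_module_def \<B>_def)

lemma Burnside_module_simps [simp]:
  "monoid.mult (Burnside_module p C m u) = m" "one (Burnside_module p C m u) = u"
  "zero (Burnside_module p C m u) = 0" "add (Burnside_module p C m u) = (+)"
  "smult (Burnside_module p C m u) = (\<lambda>c. Poly_Mapping.map (\<lambda>a. c * a))"
  by (simp_all add: Burnside_module_def)

text \<open>The ring and algebra axioms hold in the ghost ring, where the operations are pointwise, and are
  pulled back along the injective map \<open>\<Phi>\<close>.\<close>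

lemma abstract_Burnside_structure_burnside_mult:
  assumes p: "prime_or_infinity p"
  shows "abstract_Burnside_structure p C burnside_mult burnside_one"
proof -
  let ?A = "Burnside_module p C burnside_mult burnside_one"
  note [simp] = carrier_\<B> \<B>_add[OF p] \<B>_smult[OF p] burnside_mult_closed[OF p] burnside_one_closed[OF p] \<Phi>_add[of _ p] \<Phi>_smult[of _ p] \<Phi>_burnside_mult[of _ p] \<Phi>_burnside_one
  have "cring ?A"
  proof (intro cringI comm_monoidI)
    show "abelian_group ?A" by (rule \<B>_abelian_group[OF p])
  qed (auto simp: algebra_simps intro: \<B>_inject[of _ p])
  then have "algebra (Z_loc p) ?A"
    by (intro algebraI Z_loc_cring[OF p])
       (auto simp: Z_loc_1[OF p] Z_loc_add[OF p] Z_loc_mult[OF p] algebra_simps intro!: \<B>_inject[of _ p])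
  moreover have "\<Phi> \<in> ring_hom ?A (ghost_ring p C)"
  proof (rule ring_hom_memI)
    show "\<Phi> x \<in> carrier (ghost_ring p C)" if "x \<in> carrier ?A" for x
    proof -
      have "\<Phi> x A \<in> carrier (Z_loc p)" if "A \<in> iso_classes C" for A
        using that \<open>x \<in> carrier ?A\<close> Z_loc_int[OF p, of "int _"]
        by (auto simp: Burnside_map_coef \<B>_keys homs_def intro!: Z_loc_sum p Z_loc_mult \<B>_coef)
      then show ?thesis by (auto simp: ghost_ring_def Burnside_map_def)
    qed
  qed (auto simp: ghost_ring_def restrict_def fun_eq_iff \<Phi>_outside)
  ultimately show ?thesis
    unfolding abstract_Burnside_structure_def Let_def
    by (auto simp: fun_eq_iff ghost_ring_def restrict_def \<Phi>_outside intro!: inj_onI intro: \<B>_inject)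
qed

section \<open>Comparison with the localization\<close>

abbreviation R where "R \<equiv> basis_ring"

lemma R_simps [simp]:
  "carrier R = {r. Poly_Mapping.keys r \<subseteq> X}" "one R = frag_of e" "zero R = 0" "add R = (+)"
  "monoid.mult R = (\<lambda>x y. frag_extend (\<lambda>A. frag_extend (\<lambda>B. c A B) y) x)"
  by (auto simp: basis_ring_def)

lemma R_mult_closed: "\<lbrakk>x \<in> carrier R; y \<in> carrier R\<rbrakk> \<Longrightarrow> x \<otimes>\<^bsub>R\<^esub> y \<in> carrier R"
  by (simp add: keys_frag_extend_subset[of X] c_keys)

lemma frag_eval_basis_ring_mult:
  assumes "A \<in> iso_classes C" "x \<in> carrier R" "y \<in> carrier R"
  shows "frag_eval (homs A) (x \<otimes>\<^bsub>R\<^esub> y) = frag_eval (homs A) x * frag_eval (homs A) y"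
  using assms hom_mult[OF assms(1)]
  by (simp, intro frag_eval_bilinear[of X]) (auto simp: homs_def[abs_def])

text \<open>These properties determine \<open>m\<close> and \<open>u\<close> on the carrier, since \<open>\<Phi>\<close> is injective. They are the
  only link between an arbitrary structure \<open>(m, u)\<close> and the structure constants.\<close>

lemma abstract_Burnside_structureD:
  assumes "abstract_Burnside_structure p C m u"
  shows "u \<in> \<B> p" "\<And>x y. \<lbrakk>x \<in> \<B> p; y \<in> \<B> p\<rbrakk> \<Longrightarrow> m x y \<in> \<B> p"
    "\<And>x y A. \<lbrakk>x \<in> \<B> p; y \<in> \<B> p; A \<in> iso_classes C\<rbrakk> \<Longrightarrow> \<Phi> (m x y) A = \<Phi> x A * \<Phi> y A"
    "\<And>A. A \<in> iso_classes C \<Longrightarrow> \<Phi> u A = 1"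
proof -
  let ?A = "Burnside_module p C m u"
  have alg: "algebra (Z_loc p) ?A" and hom: "\<Phi> \<in> ring_hom ?A (ghost_ring p C)"
    using assms by (auto simp: abstract_Burnside_structure_def Let_def)
  interpret algebra "Z_loc p" ?A by (rule alg)
  show "u \<in> \<B> p" using one_closed by (simp add: carrier_\<B>)
  show "m x y \<in> \<B> p" if "x \<in> \<B> p" "y \<in> \<B> p" for x y
    using that m_closed[of x y] by (simp add: carrier_\<B>)
  show "\<Phi> (m x y) A = \<Phi> x A * \<Phi> y A" if "x \<in> \<B> p" "y \<in> \<B> p" "A \<in> iso_classes C" for x y A
    using that ring_hom_mult[OF hom, of x y] by (simp add: carrier_\<B> ghost_ring_def)
  show "\<Phi> u A = 1" if "A \<in> iso_classes C" for A
    using that ring_hom_one[OF hom] by (simp add: ghost_ring_def)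
qed

lemma sum_frag_eval_homs:
  "w \<in> carrier R \<Longrightarrow> (\<Sum>a\<in>X. of_int (Poly_Mapping.lookup w a) * homs A a) = frag_eval (homs A) w"
  by (simp add: frag_eval_superset[OF finite_X])

text \<open>For \<open>p = \<infinity>\<close> the carrier consists of the integral combinations of the basis, so only the index
  set and the coefficient type change. The map \<open>h\<close> from the basis ring preserves marks, hence
  products, and \<open>k\<close> is its inverse.\<close>

lemma iso_infinity:
  assumes str: "abstract_Burnside_structure \<infinity> C m u"
  shows "Burnside_module \<infinity> C m u \<simeq> R"
proof -
  note D = abstract_Burnside_structureD[OF str]
  define h where "h r = of_coef (\<lambda>a. of_int (Poly_Mapping.lookup r a))" for r :: "'x \<Rightarrow>\<^sub>0 int"
  define k where "k x = (\<Sum>a\<in>X. frag_cmul \<lfloor>coef x a\<rfloor> (frag_of a))" for x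
  have p: "prime_or_infinity \<infinity>" by (simp add: prime_or_infinity_def)
  have h: "h r \<in> \<B> \<infinity>" for r unfolding h_def by (intro of_coef_\<B> p Z_loc_int)
  have \<Phi>h: "\<Phi> (h r) A = frag_eval (homs A) r" if "r \<in> carrier R" "A \<in> iso_classes C" for r A
    using that by (simp add: h_def Burnside_map_of_coef sum_frag_eval_homs)
  have inj: "r = s" if "r \<in> carrier R" "s \<in> carrier R" "h r = h s" for r s
  proof (rule poly_mapping_eqI)
    fix a
    show "Poly_Mapping.lookup r a = Poly_Mapping.lookup s a"
    proof (cases "a \<in> X")
      case True
      then show ?thesis using that(3) coef_of_coef[of a] unfolding h_def by (metis of_int_eq_iff)
    next
      case False
      then have "a \<notin> Poly_Mapping.keys r" "a \<notin> Poly_Mapping.keys s" using that by auto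
      then show ?thesis by (simp add: in_keys_iff)
    qed
  qed
  have k: "k x \<in> carrier R" for x
    unfolding k_def R_simps mem_Collect_eq
    by (intro order_trans[OF keys_sum] UN_least order_trans[OF keys_cmul]) simp
  have lk: "Poly_Mapping.lookup (k x) a = \<lfloor>coef x a\<rfloor>" if "a \<in> X" for a x
    using that finite_X by (simp add: k_def lookup_sum if_distrib[of "(*) _"] sum.delta cong: if_cong)
  have hk: "h (k x) = x" if "x \<in> \<B> \<infinity>" for x
  proof (rule pm_eqI)
    fix a assume a: "a \<in> X"
    have "coef x a \<in> \<int>" using \<B>_coef[OF that, of a] by (simp add: Z_loc_def)
    then show "coef (h (k x)) a = coef x a" using a by (auto simp: h_def coef_of_coef lk elim: Ints_cases)
  qed (use that in \<open>auto simp: h_def dest: subsetD[OF keys_of_coef] \<B>_keys\<close>)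
  have kh: "k (h r) = r" if "r \<in> carrier R" for r
    using inj[OF k that] hk[OF h] by simp
  have "k \<in> ring_hom (Burnside_module \<infinity> C m u) R"
  proof (rule ring_hom_memI)
    fix x y assume xy: "x \<in> carrier (Burnside_module \<infinity> C m u)" "y \<in> carrier (Burnside_module \<infinity> C m u)"
    then have B: "x \<in> \<B> \<infinity>" "y \<in> \<B> \<infinity>" by (simp_all add: carrier_\<B>)
    have R: "k x \<otimes>\<^bsub>R\<^esub> k y \<in> carrier R" by (rule R_mult_closed[OF k k])
    have "h (k x \<otimes>\<^bsub>R\<^esub> k y) = m x y"
    proof (rule \<B>_inject[OF h D(2)[OF B]])
      fix A assume A: "A \<in> iso_classes C"
      show "\<Phi> (h (k x \<otimes>\<^bsub>R\<^esub> k y)) A = \<Phi> (m x y) A"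
        unfolding \<Phi>h[OF R A] frag_eval_basis_ring_mult[OF A k k]
        using \<Phi>h[OF k A, of x] \<Phi>h[OF k A, of y] hk B D(3)[OF B A] by simp
    qed
    then have "k x \<otimes>\<^bsub>R\<^esub> k y = k (m x y)" using kh[OF R] by simp
    then show "k (x \<otimes>\<^bsub>Burnside_module \<infinity> C m u\<^esub> y) = k x \<otimes>\<^bsub>R\<^esub> k y"
      unfolding Burnside_module_simps by (rule sym)
    have R': "k x + k y \<in> carrier R" using k[of x] k[of y] keys_add[of "k x" "k y"] by auto
    have "h (k x + k y) = x + y"
    proof (rule \<B>_inject[OF h \<B>_add[OF p B]])
      fix A assume A: "A \<in> iso_classes C"
      show "\<Phi> (h (k x + k y)) A = \<Phi> (x + y) A"
        unfolding \<Phi>h[OF R' A] frag_eval_add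
        using \<Phi>h[OF k A, of x] \<Phi>h[OF k A, of y] hk B \<Phi>_add[OF B A] by simp
    qed
    then have "k x + k y = k (x + y)" using kh[OF R'] by simp
    then show "k (x \<oplus>\<^bsub>Burnside_module \<infinity> C m u\<^esub> y) = k x \<oplus>\<^bsub>R\<^esub> k y" by simp
  next
    have e: "frag_of e \<in> carrier R" using e_in_X by simp
    have "h (frag_of e) = u"
      by (rule \<B>_inject[OF h D(1)]) (use D(4) \<Phi>h[OF e] hom_one in \<open>simp add: homs_def\<close>)
    then show "k \<one>\<^bsub>Burnside_module \<infinity> C m u\<^esub> = \<one>\<^bsub>R\<^esub>" using kh[OF e] by simp
  qed (rule k)
  moreover have "bij_betw k (carrier (Burnside_module \<infinity> C m u)) (carrier R)"
    by (rule bij_betw_byWitness[where f' = h]) (use h k hk kh in \<open>auto simp: carrier_\<B> simp del: R_simps\<close>)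
  ultimately show ?thesis unfolding is_ring_iso_def ring_iso_def by blast
qed

definition tensors :: "enat \<Rightarrow> (rat \<times> ('x \<Rightarrow>\<^sub>0 int)) set" where
  "tensors p = carrier (Z_loc p) \<times> carrier R"

text \<open>The coefficient at \<open>a\<close> of the elementary tensor \<open>k \<otimes> r\<close>.\<close>

definition tensor_coef :: "'x \<Rightarrow> rat \<times> ('x \<Rightarrow>\<^sub>0 int) \<Rightarrow> rat" where
  "tensor_coef a = (\<lambda>(k, r). k * of_int (Poly_Mapping.lookup r a))"

text \<open>The evaluation of a formal sum of elementary tensors \<open>k \<otimes> r\<close> in \<open>\<int>\<^bsub>(p)\<^esub>C\<close>, given by its
  coordinates.\<close>

definition \<Psi> :: "(rat \<times> ('x \<Rightarrow>\<^sub>0 int) \<Rightarrow>\<^sub>0 int) \<Rightarrow> ('o set \<Rightarrow>\<^sub>0 rat)" where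
  "\<Psi> w = of_coef (\<lambda>a. frag_eval (tensor_coef a) w)"

lemma tensor_free_simps [simp]:
  "carrier (tensor_free (Z_loc p) R) = {w. Poly_Mapping.keys w \<subseteq> tensors p}"
  "one (tensor_free (Z_loc p) R) = frag_of (1, \<one>\<^bsub>R\<^esub>)" "zero (tensor_free (Z_loc p) R) = 0"
  "add (tensor_free (Z_loc p) R) = (+)"
  "monoid.mult (tensor_free (Z_loc p) R) = (\<lambda>x y. frag_extend (\<lambda>(a, r). frag_extend (\<lambda>(b, s).
        frag_of (a * b, r \<otimes>\<^bsub>R\<^esub> s)) y) x)"
  by (simp_all add: tensor_free_def tensors_def free_Abelian_group_def)

lemma tensor_free_mult:
  "x \<otimes>\<^bsub>tensor_free (Z_loc p) R\<^esub> y
    = frag_extend (\<lambda>i. frag_extend (\<lambda>j. frag_of (fst i * fst j, snd i \<otimes>\<^bsub>R\<^esub> snd j)) y) x"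
  by (simp only: tensor_free_simps case_prod_unfold)

lemma tensor_free_abelian_group: "abelian_group (tensor_free (Z_loc p) R)"
proof -
  have "add_monoid (tensor_free (Z_loc p) R) = free_Abelian_group (tensors p)"
    by (simp add: tensor_free_def free_Abelian_group_def tensors_def)
  then have "comm_group (add_monoid (tensor_free (Z_loc p) R))" by (simp add: abelian_free_Abelian_group)
  then show ?thesis
    by (simp add: abelian_group_def abelian_group_axioms_def abelian_monoid_def comm_group_def)
qed

lemma \<Psi>_closed:
  assumes p: "prime_or_infinity p" and "Poly_Mapping.keys w \<subseteq> tensors p"
  shows "\<Psi> w \<in> \<B> p"
  unfolding \<Psi>_def frag_eval_def
  using assms by (intro of_coef_\<B> Z_loc_sum Z_loc_mult Z_loc_int) (auto simp: tensor_coef_def tensors_def intro!: Z_loc_mult Z_loc_int)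

lemma \<Phi>_\<Psi>:
  assumes "Poly_Mapping.keys w \<subseteq> tensors p" "A \<in> iso_classes C"
  shows "\<Phi> (\<Psi> w) A = frag_eval (\<lambda>i. fst i * frag_eval (homs A) (snd i)) w"
proof -
  have "\<Phi> (\<Psi> w) A = (\<Sum>a\<in>X. \<Sum>i\<in>Poly_Mapping.keys w. of_int (Poly_Mapping.lookup w i) * tensor_coef a i * homs A a)"
    unfolding \<Psi>_def using assms by (simp add: Burnside_map_of_coef frag_eval_def sum_distrib_right)
  also have "\<dots> = (\<Sum>i\<in>Poly_Mapping.keys w. \<Sum>a\<in>X. of_int (Poly_Mapping.lookup w i) * tensor_coef a i * homs A a)"
    by (rule sum.swap)
  also have "\<dots> = (\<Sum>i\<in>Poly_Mapping.keys w. of_int (Poly_Mapping.lookup w i) * (fst i * frag_eval (homs A) (snd i)))"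
  proof (rule sum.cong[OF refl])
    fix i assume "i \<in> Poly_Mapping.keys w"
    then have "i \<in> tensors p" using assms by blast
    then have i: "snd i \<in> carrier R" by (auto simp: tensors_def)
    show "(\<Sum>a\<in>X. of_int (Poly_Mapping.lookup w i) * tensor_coef a i * homs A a)
        = of_int (Poly_Mapping.lookup w i) * (fst i * frag_eval (homs A) (snd i))"
      unfolding sum_frag_eval_homs[OF i, symmetric] by (simp add: sum_distrib_left tensor_coef_def case_prod_beta mult.assoc)
  qed
  finally show ?thesis by (simp add: frag_eval_def)
qed

lemma of_coef_add: "of_coef (\<lambda>a. f a + g a) = of_coef f + of_coef g"
  by (simp add: of_coef_def single_add sum.distrib)

lemma \<Psi>_add: "\<Psi> (v + w) = \<Psi> v + \<Psi> w"
  by (simp add: \<Psi>_def frag_eval_add of_coef_add)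

text \<open>Multiplicativity is checked on marks. The mark of \<open>\<Psi> (k \<otimes> r)\<close> is \<open>k\<close> times the mark of \<open>r\<close>, which
  is multiplicative on elementary tensors, and \<open>frag_eval_bilinear\<close> extends this to all of them.\<close>

lemma \<Psi>_ring_hom:
  assumes p: "prime_or_infinity p" and str: "abstract_Burnside_structure p C m u"
  shows "\<Psi> \<in> ring_hom (tensor_free (Z_loc p) R) (Burnside_module p C m u)"
    "\<And>x y. \<lbrakk>x \<in> carrier (tensor_free (Z_loc p) R); y \<in> carrier (tensor_free (Z_loc p) R)\<rbrakk>
      \<Longrightarrow> x \<otimes>\<^bsub>tensor_free (Z_loc p) R\<^esub> y \<in> carrier (tensor_free (Z_loc p) R)"
    "\<one>\<^bsub>tensor_free (Z_loc p) R\<^esub> \<in> carrier (tensor_free (Z_loc p) R)"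
proof -
  note D = abstract_Burnside_structureD[OF str]
  have TI: "(fst i * fst j, snd i \<otimes>\<^bsub>R\<^esub> snd j) \<in> tensors p" if "i \<in> tensors p" "j \<in> tensors p" for i j
    using that Z_loc_mult[OF p] R_mult_closed[of "snd i" "snd j"] by (auto simp: tensors_def simp del: R_simps)
  show closed: "x \<otimes>\<^bsub>tensor_free (Z_loc p) R\<^esub> y \<in> carrier (tensor_free (Z_loc p) R)"
    if "x \<in> carrier (tensor_free (Z_loc p) R)" "y \<in> carrier (tensor_free (Z_loc p) R)" for x y
  proof -
    have "Poly_Mapping.keys (x \<otimes>\<^bsub>tensor_free (Z_loc p) R\<^esub> y) \<subseteq> tensors p"
      unfolding tensor_free_mult
    proof (rule keys_frag_extend_subset[where S = "tensors p"])
      show "Poly_Mapping.keys (frag_extend (\<lambda>j. frag_of (fst i * fst j, snd i \<otimes>\<^bsub>R\<^esub> snd j)) y) \<subseteq> tensors p"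
        if i: "i \<in> tensors p" for i
      proof (rule keys_frag_extend_subset[where S = "tensors p"])
        show "Poly_Mapping.keys (frag_of (fst i * fst j, snd i \<otimes>\<^bsub>R\<^esub> snd j)) \<subseteq> tensors p" if "j \<in> tensors p" for j
          using TI[OF i that] by (simp add: keys_frag_of del: R_simps)
      qed (use \<open>y \<in> _\<close> in simp)
    qed (use that in simp)
    then show ?thesis by (simp only: tensor_free_simps mem_Collect_eq)
  qed
  show one: "\<one>\<^bsub>tensor_free (Z_loc p) R\<^esub> \<in> carrier (tensor_free (Z_loc p) R)"
    using e_in_X Z_loc_1[OF p] by (simp add: tensors_def)
  show "\<Psi> \<in> ring_hom (tensor_free (Z_loc p) R) (Burnside_module p C m u)"
  proof (rule ring_hom_memI)
    show "\<Psi> x \<in> carrier (Burnside_module p C m u)" if "x \<in> carrier (tensor_free (Z_loc p) R)" for x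
      using that \<Psi>_closed[OF p] by (simp add: carrier_\<B>)
    show "\<Psi> (x \<oplus>\<^bsub>tensor_free (Z_loc p) R\<^esub> y) = \<Psi> x \<oplus>\<^bsub>Burnside_module p C m u\<^esub> \<Psi> y" for x y
      by (simp add: \<Psi>_add)
    show "\<Psi> (x \<otimes>\<^bsub>tensor_free (Z_loc p) R\<^esub> y) = \<Psi> x \<otimes>\<^bsub>Burnside_module p C m u\<^esub> \<Psi> y"
      if xy: "x \<in> carrier (tensor_free (Z_loc p) R)" "y \<in> carrier (tensor_free (Z_loc p) R)" for x y
      unfolding Burnside_module_simps
    proof (rule \<B>_inject[of _ p])
      have k: "Poly_Mapping.keys x \<subseteq> tensors p" "Poly_Mapping.keys y \<subseteq> tensors p"
        "Poly_Mapping.keys (x \<otimes>\<^bsub>tensor_free (Z_loc p) R\<^esub> y) \<subseteq> tensors p"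
        using xy closed[OF xy] by (simp_all del: tensor_free_simps(5))
      note B = \<Psi>_closed[OF p k(1)] \<Psi>_closed[OF p k(2)]
      show "\<Psi> (x \<otimes>\<^bsub>tensor_free (Z_loc p) R\<^esub> y) \<in> \<B> p" by (rule \<Psi>_closed[OF p k(3)])
      show "m (\<Psi> x) (\<Psi> y) \<in> \<B> p" using B by (rule D(2))
      fix A assume A: "A \<in> iso_classes C"
      let ?g = "\<lambda>i. fst i * frag_eval (homs A) (snd i)"
      have "frag_eval ?g (x \<otimes>\<^bsub>tensor_free (Z_loc p) R\<^esub> y) = frag_eval ?g x * frag_eval ?g y"
        unfolding tensor_free_mult
      proof (rule frag_eval_bilinear[OF _ k(1,2)])
        fix i j assume ij: "i \<in> tensors p" "j \<in> tensors p"
        then have "snd i \<in> carrier R" "snd j \<in> carrier R" by (auto simp: tensors_def)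
        from frag_eval_basis_ring_mult[OF A this]
        show "frag_eval ?g (frag_of (fst i * fst j, snd i \<otimes>\<^bsub>R\<^esub> snd j)) = ?g i * ?g j"
          by (simp del: R_simps)
      qed
      then show "\<Phi> (\<Psi> (x \<otimes>\<^bsub>tensor_free (Z_loc p) R\<^esub> y)) A = \<Phi> (m (\<Psi> x) (\<Psi> y)) A"
        unfolding \<Phi>_\<Psi>[OF k(3) A] D(3)[OF B A] \<Phi>_\<Psi>[OF k(1) A] \<Phi>_\<Psi>[OF k(2) A] .
    qed
    have k1: "Poly_Mapping.keys \<one>\<^bsub>tensor_free (Z_loc p) R\<^esub> \<subseteq> tensors p" using one by simp
    show "\<Psi> \<one>\<^bsub>tensor_free (Z_loc p) R\<^esub> = \<one>\<^bsub>Burnside_module p C m u\<^esub>"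
      unfolding Burnside_module_simps
    proof (rule \<B>_inject[OF \<Psi>_closed[OF p k1] D(1)])
      fix A assume "A \<in> iso_classes C"
      then show "\<Phi> (\<Psi> \<one>\<^bsub>tensor_free (Z_loc p) R\<^esub>) A = \<Phi> u A"
        using \<Phi>_\<Psi>[OF k1] D(4) hom_one by (simp add: homs_def)
    qed
  qed
qed

text \<open>The normal form of a tensor: one summand for each basis element.\<close>

definition standard_tensor :: "('x \<Rightarrow> rat) \<Rightarrow> (rat \<times> ('x \<Rightarrow>\<^sub>0 int) \<Rightarrow>\<^sub>0 int)" where
  "standard_tensor f = (\<Sum>a\<in>X. frag_of (f a, frag_of a))"

lemma \<Psi>_standard_tensor: "\<Psi> (standard_tensor f) = of_coef f"
proof (rule pm_eqI)
  fix a assume a: "a \<in> X"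
  have "coef (\<Psi> (standard_tensor f)) a = (\<Sum>b\<in>X. tensor_coef a (f b, frag_of b))"
    using a by (simp add: \<Psi>_def coef_of_coef standard_tensor_def frag_eval_sum)
  also have "\<dots> = (\<Sum>b\<in>X. if b = a then f b else 0)"
    by (intro sum.cong) (auto simp: tensor_coef_def)
  finally show "coef (\<Psi> (standard_tensor f)) a = coef (of_coef f) a" using a finite_X by (simp add: coef_of_coef)
qed (simp_all add: \<Psi>_def keys_of_coef)

lemma keys_standard_tensor: "(\<And>a. a \<in> X \<Longrightarrow> f a \<in> carrier (Z_loc p)) \<Longrightarrow> Poly_Mapping.keys (standard_tensor f) \<subseteq> tensors p"
  unfolding standard_tensor_def by (intro order_trans[OF keys_sum] UN_least) (simp add: tensors_def)

text \<open>The relations lie in the kernel because the coefficients are biadditive. Conversely, each element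
  \<open>w\<close> is congruent modulo the relations to the standard tensor with the coefficients of \<open>\<Psi> w\<close>;
  if \<open>\<Psi> w = 0\<close>, these coefficients vanish and \<open>w\<close> is congruent to a sum of tensors
  \<open>0 \<otimes> a\<close>, which are relations up to sign.\<close>

lemma kernel_\<Psi>:
  assumes p: "prime_or_infinity p"
  shows "generate (free_Abelian_group (carrier (Z_loc p) \<times> carrier R)) (tensor_relations (Z_loc p) R)
    = {w \<in> carrier (tensor_free (Z_loc p) R). \<Psi> w = 0}" (is "?J = ?K")
proof -
  let ?FA = "free_Abelian_group (tensors p)" and ?rel = "tensor_relations (Z_loc p) R"
  interpret FA: group ?FA by simp
  define I where "I = ?J"
  have I_eq: "I = generate ?FA ?rel" by (simp add: I_def tensors_def)
  have rel_sub: "?rel \<subseteq> carrier ?FA"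
  proof -
    have "Poly_Mapping.keys (frag_of x - frag_of y - frag_of z) \<subseteq> tensors p" if "x \<in> tensors p" "y \<in> tensors p" "z \<in> tensors p" for x y z
      using that keys_diff[of "frag_of x - frag_of y" "frag_of z"] keys_diff[of "frag_of x" "frag_of y"] by auto
    then have *: "frag_of x - frag_of y - frag_of z \<in> carrier ?FA" if "x \<in> tensors p" "y \<in> tensors p" "z \<in> tensors p" for x y z
      using that by simp
    have add: "r + s \<in> carrier R" if "r \<in> carrier R" "s \<in> carrier R" for r s
      using that keys_add[of r s] by auto
    show ?thesis
    proof
      fix v assume "v \<in> ?rel"
      then consider (left) a b r where "a \<in> carrier (Z_loc p)" "b \<in> carrier (Z_loc p)" "r \<in> carrier R"
          "v = frag_of (a + b, r) - frag_of (a, r) - frag_of (b, r)"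
        | (right) a r s where "a \<in> carrier (Z_loc p)" "r \<in> carrier R" "s \<in> carrier R"
          "v = frag_of (a, r + s) - frag_of (a, r) - frag_of (a, s)"
        unfolding tensor_relations_def Z_loc_simps R_simps(4) by blast
      then show "v \<in> carrier ?FA"
      proof cases
        case left
        then show ?thesis using Z_loc_add[OF p, of a b] unfolding left(4) by (intro *) (simp_all add: tensors_def)
      next
        case right
        then show ?thesis using add[of r s] unfolding right(4) by (intro *) (simp_all add: tensors_def)
      qed
    qed
  qed
  have sg: "subgroup I ?FA" unfolding I_eq by (rule FA.generate_is_subgroup[OF rel_sub])
  have I_add: "v + w \<in> I" if "v \<in> I" "w \<in> I" for v w
    using subgroup.m_closed[OF sg that] by simp
  have I_uminus: "- w \<in> I" if "w \<in> I" for w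
    using subgroup.m_inv_closed[OF sg that] subgroup.mem_carrier[OF sg that] by simp
  have I_diff: "v - w \<in> I" if "v \<in> I" "w \<in> I" for v w
    using I_add[OF that(1) I_uminus[OF that(2)]] by simp
  have I_0: "0 \<in> I" using subgroup.one_closed[OF sg] by simp
  have I_sum: "sum f J \<in> I" if "\<And>j. j \<in> J \<Longrightarrow> f j \<in> I" for f and J :: "'x set"
    using that by (induction J rule: infinite_finite_induct) (simp_all add: I_0 I_add)
  have rel1: "frag_of (a + b, r) - frag_of (a, r) - frag_of (b, r) \<in> I"
    if "a \<in> carrier (Z_loc p)" "b \<in> carrier (Z_loc p)" "r \<in> carrier R" for a b r
    using that unfolding I_eq by (intro generate.incl) (auto simp: tensor_relations_def simp del: R_simps(1))
  have rel2: "frag_of (a, r + s) - frag_of (a, r) - frag_of (a, s) \<in> I"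
    if "a \<in> carrier (Z_loc p)" "r \<in> carrier R" "s \<in> carrier R" for a r s
    using that unfolding I_eq by (intro generate.incl) (auto simp: tensor_relations_def simp del: R_simps(1))
  have zero1: "frag_of (0, r) \<in> I" if "r \<in> carrier R" for r
    using I_uminus[OF rel1[of 0 0 r]] Z_loc_0[OF p] that by simp
  have zero2: "frag_of (a, 0) \<in> I" if "a \<in> carrier (Z_loc p)" for a
    using I_uminus[OF rel2[of a 0 0]] that by simp
  have std0: "standard_tensor (\<lambda>a. 0) \<in> I"
    unfolding standard_tensor_def by (intro I_sum zero1) simp
  \<comment> \<open>Standard tensors are additive in their coefficients modulo the relations. Differences are the
    form needed for induction on free abelian groups.\<close>
  have std_diff: "standard_tensor (\<lambda>a. f a - g a) - standard_tensor f + standard_tensor g \<in> I"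
    if "\<And>a. a \<in> X \<Longrightarrow> f a \<in> carrier (Z_loc p)" "\<And>a. a \<in> X \<Longrightarrow> g a \<in> carrier (Z_loc p)" for f g
  proof -
    have "frag_of (f a - g a, frag_of a) - frag_of (f a, frag_of a) + frag_of (g a, frag_of a) \<in> I"
      if a: "a \<in> X" for a
    proof -
      have "f a - g a \<in> carrier (Z_loc p)"
        using Z_loc_add[OF p _ Z_loc_uminus[OF p]] that \<open>\<And>a. a \<in> X \<Longrightarrow> f a \<in> _\<close> \<open>\<And>a. a \<in> X \<Longrightarrow> g a \<in> _\<close> by force
      then have "frag_of ((f a - g a) + g a, frag_of a) - frag_of (f a - g a, frag_of a) - frag_of (g a, frag_of a) \<in> I"
        using a \<open>\<And>a. a \<in> X \<Longrightarrow> g a \<in> _\<close> by (intro rel1) auto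
      from I_uminus[OF this] show ?thesis by (simp add: algebra_simps)
    qed
    then have "(\<Sum>a\<in>X. frag_of (f a - g a, frag_of a) - frag_of (f a, frag_of a) + frag_of (g a, frag_of a)) \<in> I"
      by (rule I_sum)
    then show ?thesis by (simp add: standard_tensor_def sum.distrib sum_subtractf)
  qed
  \<comment> \<open>The normal form of a single elementary tensor, by induction on its second factor.\<close>
  have gen: "frag_of (k, r) - standard_tensor (\<lambda>a. tensor_coef a (k, r)) \<in> I" if k: "k \<in> carrier (Z_loc p)" and r: "r \<in> carrier R" for k r
  proof -
    have evc: "tensor_coef a (k, r) \<in> carrier (Z_loc p)" for a r
      using k by (auto simp: tensor_coef_def intro!: Z_loc_mult[OF p] Z_loc_int[OF p])
    from r have "Poly_Mapping.keys r \<subseteq> X" by simp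
    then show ?thesis
    proof (rule free_Abelian_group_induct)
      show "frag_of (k, 0) - standard_tensor (\<lambda>a. tensor_coef a (k, 0)) \<in> I"
        using I_diff[OF zero2[OF k] std0] by (simp add: tensor_coef_def)
    next
      fix x y assume xy: "Poly_Mapping.keys x \<subseteq> X" "Poly_Mapping.keys y \<subseteq> X"
        "frag_of (k, x) - standard_tensor (\<lambda>a. tensor_coef a (k, x)) \<in> I" "frag_of (k, y) - standard_tensor (\<lambda>a. tensor_coef a (k, y)) \<in> I"
      have "x - y \<in> carrier R" using xy keys_diff[of x y] by auto
      then have E3: "frag_of (k, (x - y) + y) - frag_of (k, x - y) - frag_of (k, y) \<in> I"
        using xy k by (intro rel2) simp_all
      have E4: "standard_tensor (\<lambda>a. tensor_coef a (k, x - y)) - standard_tensor (\<lambda>a. tensor_coef a (k, x)) + standard_tensor (\<lambda>a. tensor_coef a (k, y)) \<in> I"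
        using std_diff[of "\<lambda>a. tensor_coef a (k, x)" "\<lambda>a. tensor_coef a (k, y)"] evc
        by (simp add: tensor_coef_def lookup_minus right_diff_distrib)
      note I_diff[OF I_diff[OF I_diff[OF xy(3,4)] E3] E4]
      then show "frag_of (k, x - y) - standard_tensor (\<lambda>a. tensor_coef a (k, x - y)) \<in> I" by (simp add: algebra_simps)
    next
      fix b assume b: "b \<in> X"
      have "standard_tensor (\<lambda>a. tensor_coef a (k, frag_of b)) = frag_of (k, frag_of b) + (\<Sum>a\<in>X - {b}. frag_of (0, frag_of a))"
        unfolding standard_tensor_def sum.remove[OF finite_X b]
        by (intro arg_cong2[where f = "(+)"] sum.cong refl) (auto simp: tensor_coef_def)
      moreover have "(\<Sum>a\<in>X - {b}. frag_of (0, frag_of a)) \<in> I" by (intro I_sum zero1) simp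
      ultimately show "frag_of (k, frag_of b) - standard_tensor (\<lambda>a. tensor_coef a (k, frag_of b)) \<in> I"
        using I_uminus by simp
    qed
  qed
  \<comment> \<open>The normal form of an arbitrary formal sum of elementary tensors.\<close>
  have all: "w - standard_tensor (\<lambda>a. frag_eval (tensor_coef a) w) \<in> I" if "Poly_Mapping.keys w \<subseteq> tensors p" for w
    using that
  proof (rule free_Abelian_group_induct)
    show "0 - standard_tensor (\<lambda>a. frag_eval (tensor_coef a) 0) \<in> I" using I_uminus[OF std0] by simp
    show "frag_of i - standard_tensor (\<lambda>a. frag_eval (tensor_coef a) (frag_of i)) \<in> I" if "i \<in> tensors p" for i
      using that gen[of "fst i" "snd i"] by (auto simp: tensors_def)
  next
    fix x y assume xy: "Poly_Mapping.keys x \<subseteq> tensors p" "Poly_Mapping.keys y \<subseteq> tensors p"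
      "x - standard_tensor (\<lambda>a. frag_eval (tensor_coef a) x) \<in> I" "y - standard_tensor (\<lambda>a. frag_eval (tensor_coef a) y) \<in> I"
    have "frag_eval (tensor_coef a) w \<in> carrier (Z_loc p)" if "a \<in> X" "Poly_Mapping.keys w \<subseteq> tensors p" for a w
      using \<B>_coef[OF \<Psi>_closed[OF p that(2)], of a] that(1) by (simp add: \<Psi>_def coef_of_coef)
    then have E: "standard_tensor (\<lambda>a. frag_eval (tensor_coef a) x - frag_eval (tensor_coef a) y) - standard_tensor (\<lambda>a. frag_eval (tensor_coef a) x) + standard_tensor (\<lambda>a. frag_eval (tensor_coef a) y) \<in> I"
      using xy by (intro std_diff) simp_all
    note I_diff[OF I_diff[OF xy(3,4)] E]
    then show "x - y - standard_tensor (\<lambda>a. frag_eval (tensor_coef a) (x - y)) \<in> I"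
      by (simp add: frag_eval_diff algebra_simps)
  qed
  show ?thesis unfolding I_def[symmetric]
  proof (intro equalityI subsetI)
    fix w assume "w \<in> ?K"
    then have w: "Poly_Mapping.keys w \<subseteq> tensors p" "\<Psi> w = 0" by auto
    have "frag_eval (tensor_coef a) w = 0" if "a \<in> X" for a
      using w(2) coef_of_coef[OF that, of "\<lambda>a. frag_eval (tensor_coef a) w"] by (simp add: \<Psi>_def coef_def)
    then have "standard_tensor (\<lambda>a. frag_eval (tensor_coef a) w) = standard_tensor (\<lambda>a. 0)" unfolding standard_tensor_def by (intro sum.cong) simp_all
    then show "w \<in> I" using I_add[OF all[OF w(1)] std0] by simp
  next
    fix w assume w: "w \<in> I"
    have \<Psi>0: "\<Psi> 0 = 0" using \<Psi>_add[of 0 0] by simp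
    have \<Psi>m: "\<Psi> (- v) = - \<Psi> v" for v using \<Psi>_add[of v "- v"] \<Psi>0 by (simp add: add_eq_0_iff)
    have rel0: "\<Psi> v = 0" if "v \<in> ?rel" for v
    proof -
      have "frag_eval (tensor_coef a) v = 0" for a
        using that by (auto simp: tensor_relations_def frag_eval_diff tensor_coef_def lookup_add ring_distribs)
      then show ?thesis using \<Psi>0 unfolding \<Psi>_def by simp
    qed
    have "\<Psi> w = 0"
      using w unfolding I_eq
    proof (induction rule: generate.induct)
      case (inv h)
      then have "h \<in> carrier ?FA" using rel_sub by blast
      then have "Poly_Mapping.keys h \<subseteq> tensors p" by simp
      then show ?case using rel0[OF inv] by (simp add: \<Psi>m)
    qed (simp_all add: \<Psi>0 \<Psi>_add rel0)
    then show "w \<in> ?K" using subgroup.mem_carrier[OF sg w] by simp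
  qed
qed

text \<open>\<open>\<Psi>\<close> is onto, since each element of \<open>\<int>\<^bsub>(p)\<^esub>C\<close> is the image of the standard tensor with its
  coordinates.\<close>

lemma iso_tensor:
  assumes p: "prime_or_infinity p" and str: "abstract_Burnside_structure p C m u"
  shows "Burnside_module p C m u \<simeq> tensor_ring (Z_loc p) R"
  unfolding tensor_ring_def
proof (rule iso_Quot_of_surj_hom[where \<Psi> = \<Psi>])
  show "carrier (Burnside_module p C m u) \<subseteq> \<Psi> ` carrier (tensor_free (Z_loc p) R)"
  proof
    fix x assume "x \<in> carrier (Burnside_module p C m u)"
    then have x: "x \<in> \<B> p" by (simp add: carrier_\<B>)
    have "x = \<Psi> (standard_tensor (coef x))"
      unfolding \<Psi>_standard_tensor by (rule pm_eqI) (simp_all add: \<B>_keys[OF x] keys_of_coef coef_of_coef)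
    moreover have "standard_tensor (coef x) \<in> carrier (tensor_free (Z_loc p) R)"
      using keys_standard_tensor \<B>_coef[OF x] by simp
    ultimately show "x \<in> \<Psi> ` carrier (tensor_free (Z_loc p) R)" by blast
  qed
qed (use \<Psi>_ring_hom[OF p str] kernel_\<Psi>[OF p] tensor_free_abelian_group \<B>_abelian_group[OF p] in
  \<open>simp_all del: tensor_free_simps(1,2,5) R_simps\<close>)

theorem iso_to_localization_basis_ring:
  assumes "prime_or_infinity p" "abstract_Burnside_structure p C m u"
  shows "iso_to_localization p (Burnside_module p C m u) R"
  using assms iso_infinity iso_tensor by (auto simp: iso_to_localization_def split: enat.split)

end

section \<open>Factorization in categories of epimorphisms\<close>

context category
begin

lemma Hom_Arr: "f \<in> Hom C I J \<Longrightarrow> f \<in> Arr C"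
  and Arr_Hom: "f \<in> Arr C \<Longrightarrow> f \<in> Hom C (Dom C f) (Cod C f)"
  by (auto simp: Hom_def)

lemma isoE:
  assumes "isomorphism C f"
  obtains g where "f \<in> Hom C (Dom C f) (Cod C f)" "g \<in> Hom C (Cod C f) (Dom C f)"
    "Comp C g f = Ident C (Dom C f)" "Comp C f g = Ident C (Cod C f)"
  using assms Arr_Hom unfolding isomorphism_def by blast

lemma isoI:
  assumes "f \<in> Hom C I J" "g \<in> Hom C J I" "Comp C g f = Ident C I" "Comp C f g = Ident C J"
  shows "isomorphism C f"
  using assms by (auto simp: isomorphism_def Hom_def)

lemma iso_Ident: "I \<in> Ob C \<Longrightarrow> isomorphism C (Ident C I)"
  using Ident_closed[of I] Comp_Ident_left[OF Ident_closed[of I]] by (blast intro: isoI)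

lemma iso_Comp:
  assumes "isomorphism C f" "isomorphism C g" "Dom C g = Cod C f"
  shows "isomorphism C (Comp C g f)"
proof -
  obtain f' where f: "f \<in> Hom C (Dom C f) (Cod C f)" "f' \<in> Hom C (Cod C f) (Dom C f)"
    "Comp C f' f = Ident C (Dom C f)" "Comp C f f' = Ident C (Cod C f)" using isoE[OF assms(1)] .
  obtain g' where g: "g \<in> Hom C (Cod C f) (Cod C g)" "g' \<in> Hom C (Cod C g) (Cod C f)"
    "Comp C g' g = Ident C (Cod C f)" "Comp C g g' = Ident C (Cod C g)"
    using isoE[OF assms(2)] assms(3) by metis
  show ?thesis
  proof (rule isoI)
    show gf: "Comp C g f \<in> Hom C (Dom C f) (Cod C g)" using f g Comp_closed by blast
    show fg: "Comp C f' g' \<in> Hom C (Cod C g) (Dom C f)" using f g Comp_closed by blast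
    have "Comp C (Comp C f' g') (Comp C g f) = Comp C f' (Comp C (Comp C g' g) f)"
      using Comp_assoc[OF f(1) g(1) g(2)] Comp_assoc[OF gf g(2) f(2)] by simp
    then show "Comp C (Comp C f' g') (Comp C g f) = Ident C (Dom C f)"
      using f g Comp_Ident_left[OF f(1)] by simp
    have "Comp C (Comp C g f) (Comp C f' g') = Comp C g (Comp C (Comp C f f') g')"
      using Comp_assoc[OF g(2) f(2) f(1)] Comp_assoc[OF fg f(1) g(1)] by simp
    then show "Comp C (Comp C g f) (Comp C f' g') = Ident C (Cod C g)"
      using f g Comp_Ident_left[OF g(2)] by simp
  qed
qed

lemma iso_monomorphism:
  assumes "isomorphism C m"
  shows "monomorphism C m"
  unfolding monomorphism_def
proof (intro conjI ballI impI)
  obtain n where m: "m \<in> Hom C (Dom C m) (Cod C m)" "n \<in> Hom C (Cod C m) (Dom C m)"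
    "Comp C n m = Ident C (Dom C m)" "Comp C m n = Ident C (Cod C m)" using isoE[OF assms] .
  then show "m \<in> Arr C" by (simp add: Hom_Arr)
  fix f g assume "f \<in> Arr C" "g \<in> Arr C" and
    e: "Cod C f = Dom C m \<and> Cod C g = Dom C m \<and> Dom C f = Dom C g \<and> Comp C m f = Comp C m g"
  then have fg: "f \<in> Hom C (Dom C f) (Dom C m)" "g \<in> Hom C (Dom C f) (Dom C m)"
    using Arr_Hom by metis+
  have "Comp C (Comp C n m) f = Comp C (Comp C n m) g"
    using e fg m Comp_assoc by metis
  then show "f = g" using fg m Comp_Ident_left by metis
qed

text \<open>Every morphism factors as itself followed by an identity. If \<open>m e = m' e'\<close> with \<open>m\<close> and \<open>m'\<close>
  invertible, the only possible comparison map is \<open>m'\<^sup>-\<^sup>1 m\<close>.\<close>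

lemma epi_iso_factorization_system:
  assumes epi: "\<And>f. f \<in> Arr C \<Longrightarrow> epimorphism C f"
  shows "epi_mono_factorization_system C (Arr C) {m. isomorphism C m}"
  unfolding epi_mono_factorization_system_def
proof (intro conjI ballI allI impI)
  show "monomorphism C m" if "m \<in> {m. isomorphism C m}" for m
    using that iso_monomorphism by blast
  have iso_Arr: "isomorphism C f \<Longrightarrow> f \<in> Arr C" for f by (simp add: isomorphism_def)
  have comp_Arr: "Comp C g f \<in> Arr C" if "f \<in> Arr C" "g \<in> Arr C" "Dom C g = Cod C f" for f g
    using that Arr_Hom[of f] Arr_Hom[of g] Comp_closed Hom_Arr by metis
  show "iso_closed C (Arr C)" unfolding iso_closed_def by (auto intro: comp_Arr iso_Arr)
  show "iso_closed C {m. isomorphism C m}" unfolding iso_closed_def by (auto intro: iso_Comp)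
  show "\<exists>e\<in>Arr C. \<exists>m\<in>{m. isomorphism C m}. Cod C e = Dom C m \<and> f = Comp C m e"
    if f: "f \<in> Arr C" for f
  proof (rule bexI[of _ f], rule bexI[of _ "Ident C (Cod C f)"])
    show "Cod C f = Dom C (Ident C (Cod C f)) \<and> f = Comp C (Ident C (Cod C f)) f"
      using Ident_closed[OF Cod_closed[OF f]] Comp_Ident_left[OF Arr_Hom[OF f]] by (simp add: Hom_def)
    show "Ident C (Cod C f) \<in> {m. isomorphism C m}" using iso_Ident[OF Cod_closed[OF f]] by simp
  qed (rule f)
next
  fix e m e' m' assume em: "e \<in> Arr C" "m \<in> {m. isomorphism C m}" "e' \<in> Arr C" "m' \<in> {m. isomorphism C m}"
    and eq: "Cod C e = Dom C m \<and> Cod C e' = Dom C m' \<and> Dom C e = Dom C e' \<and> Cod C m = Cod C m'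
        \<and> Comp C m e = Comp C m' e'"
  obtain n' where m': "m' \<in> Hom C (Cod C e') (Cod C m)" "n' \<in> Hom C (Cod C m) (Cod C e')"
    "Comp C n' m' = Ident C (Cod C e')" "Comp C m' n' = Ident C (Cod C m)"
    using em(4) eq unfolding isomorphism_def Hom_def by auto
  have n'iso: "isomorphism C n'" using isoI[OF m'(2,1,4,3)] .
  have m: "m \<in> Hom C (Cod C e) (Cod C m)" using em eq by (simp add: isomorphism_def Hom_def)
  have e: "e \<in> Hom C (Dom C e) (Cod C e)" "e' \<in> Hom C (Dom C e) (Cod C e')"
    using em eq by (simp_all add: Hom_def)
  let ?i = "Comp C n' m"
  show "\<exists>!i. i \<in> Hom C (Cod C e) (Cod C e') \<and> isomorphism C i \<and> Comp C i e = e' \<and> Comp C m' i = m"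
  proof (rule ex1I[of _ ?i], intro conjI)
    show "isomorphism C ?i"
      using iso_Comp[of m n'] em n'iso m'(2) by (simp add: Hom_def)
    show "?i \<in> Hom C (Cod C e) (Cod C e')" using m m'(2) Comp_closed by blast
    have "Comp C ?i e = Comp C n' (Comp C m' e')" using Comp_assoc[OF e(1) m m'(2)] eq by simp
    also have "\<dots> = e'" using Comp_assoc[OF e(2) m'(1,2)] m'(3) Comp_Ident_left[OF e(2)] by simp
    finally show "Comp C ?i e = e'" .
    have "Comp C m' ?i = Comp C (Ident C (Cod C m)) m" using Comp_assoc[OF m m'(2,1)] m'(4) by simp
    also have "\<dots> = m" by (rule Comp_Ident_left[OF m])
    finally show "Comp C m' ?i = m" .
  next
    fix j assume j: "j \<in> Hom C (Cod C e) (Cod C e') \<and> isomorphism C j \<and> Comp C j e = e' \<and> Comp C m' j = m"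
    then have "Comp C n' m = Comp C (Comp C n' m') j"
      using Comp_assoc[of j _ _ m' _ n'] m'(1,2) by blast
    also have "\<dots> = j" using m'(3) Comp_Ident_left j by metis
    finally show "j = ?i" by (rule sym)
  qed
qed (rule epi)

end

section \<open>The \<open>G\<close>-poset of pairs\<close>

context admissible_family
begin

abbreviation pact where "pact \<equiv> pair_act G act"
abbreviation P where "P \<equiv> pairs G LL"

interpretation group G by (rule is_grp)

lemma pairs_iff: "x \<in> P \<longleftrightarrow> subgroup (fst x) G \<and> snd x \<in> LL (fst x)"
  by (auto simp: pairs_def)

lemma fst_pact: "fst (pact g x) = conj_set G g (fst x)"
  and snd_pact: "snd (pact g x) = act g (snd x)"
  by (simp_all add: pair_act_def split: prod.split)

lemma conj_set_one: "K \<subseteq> carrier G \<Longrightarrow> conj_set G \<one> K = K"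
  by (simp add: conj_set_def lcos_mult_one)

lemma conj_set_subgroup: "\<lbrakk>subgroup K G; g \<in> carrier G\<rbrakk> \<Longrightarrow> subgroup (conj_set G g K) G"
  using subgroup_conjugation_is_surj1[of "inv g" K] by (simp add: conj_set_def)

lemma conj_set_mult:
  assumes "subgroup K G" "g \<in> carrier G" "h \<in> carrier G"
  shows "conj_set G g (conj_set G h K) = conj_set G (g \<otimes> h) K"
  using assms by (auto simp: conj_set_iff conj_set_subgroup inv_mult_group m_assoc)

lemma card_conj_set:
  assumes "K \<subseteq> carrier G" "g \<in> carrier G"
  shows "card (conj_set G g K) = card K"
proof -
  have "conj_set G g K = (\<lambda>k. g \<otimes> k \<otimes> inv g) ` K"
    by (auto simp: conj_set_def l_coset_def r_coset_def)
  moreover have "inj_on (\<lambda>k. g \<otimes> k \<otimes> inv g) K"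
    using assms by (auto simp: inj_on_def subset_iff)
  ultimately show ?thesis by (simp add: card_image)
qed

lemma pact_pairs: "\<lbrakk>x \<in> P; g \<in> carrier G\<rbrakk> \<Longrightarrow> pact g x \<in> P"
  by (simp add: pairs_iff fst_pact snd_pact conj_set_subgroup conj_image)

lemma pact_mult: "\<lbrakk>x \<in> P; g \<in> carrier G; h \<in> carrier G\<rbrakk> \<Longrightarrow> pact g (pact h x) = pact (g \<otimes> h) x"
  by (rule prod_eqI)
     (simp_all add: pairs_iff fst_pact snd_pact conj_set_mult act_comp)

lemma pact_one: "x \<in> P \<Longrightarrow> pact \<one> x = x"
  by (rule prod_eqI)
     (simp_all add: pairs_iff fst_pact snd_pact conj_set_one subgroup.subset act_one)

lemma pact_inv: "\<lbrakk>x \<in> P; g \<in> carrier G\<rbrakk> \<Longrightarrow> pact (inv g) (pact g x) = x"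
  by (simp add: pact_mult pact_one)

lemma pact_mono: "\<lbrakk>x \<le> y; g \<in> carrier G\<rbrakk> \<Longrightarrow> pact g x \<le> pact g y"
  by (auto simp: less_eq_prod_def fst_pact snd_pact act_mono conj_set_def l_coset_def r_coset_def)

lemma pact_le_iff: "\<lbrakk>x \<in> P; y \<in> P; g \<in> carrier G\<rbrakk> \<Longrightarrow> pact g x \<le> pact g y \<longleftrightarrow> x \<le> y"
  by (metis pact_inv pact_mono inv_closed)

text \<open>The representative of a coset \<open>gK\<close> is immaterial for the translate of a pair \<open>(K, s)\<close>; this uses
  that \<open>K\<close> acts trivially on \<open>LL K\<close>.\<close>

lemma pact_fixed: "\<lbrakk>x \<in> P; k \<in> fst x\<rbrakk> \<Longrightarrow> pact k x = x"
proof (rule prod_eqI)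
  assume x: "x \<in> P" "k \<in> fst x"
  then have k: "subgroup (fst x) G" "k \<in> carrier G" "snd x \<in> LL (fst x)"
    by (auto simp: pairs_iff subgroup.mem_carrier)
  have "inv k \<otimes> y \<otimes> k \<in> fst x \<longleftrightarrow> y \<in> fst x" if "y \<in> carrier G" for y
    using k x(2) that
    by (metis subgroup.m_closed subgroup.m_inv_closed inv_closed inv_solve_left m_assoc m_closed inv_solve_right')
  then show "fst (pact k x) = fst x"
    using k conj_set_iff[of "fst x" k] by (auto simp: fst_pact subgroup.mem_carrier)
  show "snd (pact k x) = snd x" using fixed k x by (simp add: snd_pact)
qed

text \<open>A function that is strictly increasing on pairs and invariant under \<open>G\<close>. It plays the role of
  the subgroup order in the classical Burnside ring: it turns inequalities between translates of
  pairs into equalities, and the table of marks is triangular with respect to it.\<close>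

definition rank :: "'a set \<times> 'l \<Rightarrow> nat" where
  "rank x = card (fst x) + card {..snd x}"

lemma finite_subgroup: "subgroup K G \<Longrightarrow> finite K"
  using finite_group finite_subset subgroup.subset by metis

lemma rank_mono: "\<lbrakk>x \<in> P; y \<in> P; x \<le> y\<rbrakk> \<Longrightarrow> rank x \<le> rank y"
  unfolding rank_def
  by (intro add_mono card_mono) (auto simp: less_eq_prod_def pairs_iff finite_subgroup)

lemma rank_eq_imp_eq:
  assumes "x \<in> P" "y \<in> P" "x \<le> y" "rank y \<le> rank x"
  shows "x = y"
proof -
  have sub: "fst x \<subseteq> fst y" "{..snd x} \<subseteq> {..snd y}" "finite (fst y)" "finite {..snd y}"
    using assms by (auto simp: less_eq_prod_def pairs_iff finite_subgroup)
  then have "card (fst x) \<le> card (fst y)" "card {..snd x} \<le> card {..snd y}"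
    by (auto intro: card_mono)
  then have "card (fst x) = card (fst y)" "card {..snd x} = card {..snd y}"
    using assms(4) by (auto simp: rank_def)
  then have "fst x = fst y" "{..snd x} = {..snd y}"
    using sub card_subset_eq by metis+
  then show ?thesis by (auto intro: prod_eqI)
qed

lemma rank_pact: "\<lbrakk>x \<in> P; g \<in> carrier G\<rbrakk> \<Longrightarrow> rank (pact g x) = rank x"
proof -
  assume x: "x \<in> P" "g \<in> carrier G"
  have inv: "act (inv g) (act g s) = s" "act g (act (inv g) s) = s" for s
    using x act_comp[of "inv g" g] act_comp[of g "inv g"] by (simp_all add: act_one)
  have "act (inv g) s \<le> snd x" if "s \<le> act g (snd x)" for s
    using act_mono[of "inv g" s "act g (snd x)"] that x inv by simp
  then have "bij_betw (act g) {..snd x} {..act g (snd x)}"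
    using x inv act_mono by (intro bij_betwI[where g = "act (inv g)"]) auto
  then have "card {..act g (snd x)} = card {..snd x}" by (simp add: bij_betw_same_card)
  then show ?thesis
    using x by (simp add: rank_def fst_pact snd_pact card_conj_set pairs_iff subgroup.subset)
qed

text \<open>The pair attached to a double coset in the product of the lattice Burnside ring. It is the
  meet of \<open>x\<close> and \<open>y\<close> in the poset of pairs, by \<open>le_pmeet_iff\<close>.\<close>

definition pmeet :: "'a set \<times> 'l \<Rightarrow> 'a set \<times> 'l \<Rightarrow> 'a set \<times> 'l" where
  "pmeet x y = (let V = fst x \<inter> fst y in
     (V, inf_class.inf (inf_class.inf (snd x) (snd y)) (Sup_fin (LL V))))"

lemma Sup_LL:
  assumes "subgroup H G"
  shows "Sup_fin (LL H) \<in> LL H" "s \<in> LL H \<Longrightarrow> s \<le> Sup_fin (LL H)"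
proof -
  have "Sup_fin A \<in> LL H" if "A \<noteq> {}" "A \<subseteq> LL H" for A
    using finite[of A] that by (induction rule: finite_ne_induct) (auto simp: sup_closed assms)
  then show "Sup_fin (LL H) \<in> LL H" using nonempty assms by blast
  show "s \<in> LL H \<Longrightarrow> s \<le> Sup_fin (LL H)" by (simp add: Sup_fin.coboundedI)
qed

text \<open>By the restriction axiom the infima of both lattice elements with \<open>sup LL V\<close> lie in
  \<open>LL V\<close>, and so does their infimum.\<close>

lemma pmeet_pairs: "\<lbrakk>x \<in> P; y \<in> P\<rbrakk> \<Longrightarrow> pmeet x y \<in> P"
proof -
  assume *: "x \<in> P" "y \<in> P"
  define V where "V = fst x \<inter> fst y"
  have sg: "subgroup V G" using * by (auto simp: V_def pairs_iff subgroups_Inter_pair)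
  let ?S = "Sup_fin (LL V)"
  have "inf_class.inf (snd x) ?S \<in> LL V" "inf_class.inf (snd y) ?S \<in> LL V"
    using * sg restriction by (auto simp: V_def pairs_iff)
  then have "inf_class.inf (inf_class.inf (snd x) ?S) (inf_class.inf (snd y) ?S) \<in> LL V"
    using inf_closed sg by blast
  moreover have "inf_class.inf (inf_class.inf (snd x) ?S) (inf_class.inf (snd y) ?S)
      = inf_class.inf (inf_class.inf (snd x) (snd y)) ?S"
    by (simp add: ac_simps)
  ultimately show ?thesis
    using sg by (simp add: pmeet_def V_def[symmetric] pairs_iff)
qed

text \<open>The third term of the meet is no obstacle: a pair whose subgroup lies in \<open>V\<close> has its lattice element
  below \<open>sup LL V\<close>, as these suprema increase with the subgroup.\<close>

lemma le_pmeet_iff: "\<lbrakk>x \<in> P; y \<in> P; z \<in> P\<rbrakk> \<Longrightarrow> x \<le> pmeet y z \<longleftrightarrow> x \<le> y \<and> x \<le> z"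
proof -
  assume *: "x \<in> P" "y \<in> P" "z \<in> P"
  have "snd x \<le> Sup_fin (LL V)" if "fst x \<subseteq> V" "subgroup V G" for V
    using * that Sup_LL(2)[of "fst x" "snd x"] Sup_mono[of "fst x" V] by (auto simp: pairs_iff)
  moreover have "subgroup (fst y \<inter> fst z) G"
    using * by (auto simp: pairs_iff subgroups_Inter_pair)
  ultimately show ?thesis
    by (auto simp: pmeet_def Let_def less_eq_prod_def)
qed

text \<open>An order automorphism preserves meets.\<close>

lemma pact_pmeet:
  assumes "x \<in> P" "y \<in> P" "g \<in> carrier G"
  shows "pact g (pmeet x y) = pmeet (pact g x) (pact g y)"
proof (rule order.antisym)
  note cl = assms pact_pairs pmeet_pairs
  show "pact g (pmeet x y) \<le> pmeet (pact g x) (pact g y)"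
    using cl by (simp add: le_pmeet_iff pact_le_iff) (metis le_pmeet_iff order_refl pmeet_pairs)
  let ?z = "pmeet (pact g x) (pact g y)"
  have z: "?z \<in> P" "?z \<le> pact g x" "?z \<le> pact g y"
    using cl le_pmeet_iff[of ?z "pact g x" "pact g y"] by auto
  then have "pact (inv g) ?z \<le> x" "pact (inv g) ?z \<le> y"
    using cl pact_mono[of ?z _ "inv g"] pact_inv by (metis inv_closed)+
  then have "pact (inv g) ?z \<le> pmeet x y" using cl z by (simp add: le_pmeet_iff)
  then have "pact g (pact (inv g) ?z) \<le> pact g (pmeet x y)" using cl by (simp add: pact_mono)
  then show "?z \<le> pact g (pmeet x y)" using cl z by (simp add: pact_mult pact_one)
qed

section \<open>Marks\<close>

text \<open>Marks counted on group elements instead of cosets, which makes the product formula a bijection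
  between sets of pairs of group elements.\<close>

definition translate_count :: "'a set \<times> 'l \<Rightarrow> 'a set \<times> 'l \<Rightarrow> nat" where
  "translate_count x y = card {g \<in> carrier G. x \<le> pact g y}"

text \<open>If \<open>x \<le> a.y\<close> and \<open>x \<le> b.z\<close>, put \<open>h = a\<^sup>-\<^sup>1 b\<close>; then \<open>x \<le> a.(y \<sqinter> h.z)\<close>, and \<open>(h, a)\<close> determines
  \<open>(a, b)\<close>.\<close>

lemma translate_count_mult:
  assumes "x \<in> P" "y \<in> P" "z \<in> P"
  shows "translate_count x y * translate_count x z = (\<Sum>h\<in>carrier G. translate_count x (pmeet y (pact h z)))"
proof -
  let ?A = "{a \<in> carrier G. x \<le> pact a y}" and ?B = "{b \<in> carrier G. x \<le> pact b z}"
  let ?S = "SIGMA h:carrier G. {a \<in> carrier G. x \<le> pact a (pmeet y (pact h z))}"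
  note cl = assms pact_pairs pmeet_pairs
  have iff: "x \<le> pact a (pmeet y (pact h z)) \<longleftrightarrow> x \<le> pact a y \<and> x \<le> pact (a \<otimes> h) z"
    if "a \<in> carrier G" "h \<in> carrier G" for a h
    using that cl by (simp add: pact_pmeet le_pmeet_iff pact_mult)
  have "bij_betw (\<lambda>(a, b). (inv a \<otimes> b, a)) (?A \<times> ?B) ?S"
    by (rule bij_betw_byWitness[where f' = "\<lambda>(h, a). (a, a \<otimes> h)"])
       (auto simp: iff m_assoc[symmetric])
  then have "card (?A \<times> ?B) = card ?S" by (rule bij_betw_same_card)
  then show ?thesis using finite_group by (simp add: translate_count_def card_cartesian_product)
qed

lemma translate_count_pact_left:
  assumes "x \<in> P" "y \<in> P" "k \<in> carrier G"
  shows "translate_count (pact k x) y = translate_count x y"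
proof -
  have iff: "pact k x \<le> pact g y \<longleftrightarrow> x \<le> pact (inv k \<otimes> g) y" if "g \<in> carrier G" for g
    using that assms pact_le_iff[of x "pact (inv k \<otimes> g) y" k]
    by (simp add: pact_pairs pact_mult m_assoc[symmetric])
  have "bij_betw (\<lambda>g. inv k \<otimes> g) {g \<in> carrier G. pact k x \<le> pact g y} {g \<in> carrier G. x \<le> pact g y}"
    by (rule bij_betw_byWitness[where f' = "\<lambda>g. k \<otimes> g"])
       (use assms in \<open>auto simp: iff m_assoc[symmetric]\<close>)
  then show ?thesis unfolding translate_count_def by (rule bij_betw_same_card)
qed

lemma translate_count_pact_right:
  assumes "x \<in> P" "y \<in> P" "k \<in> carrier G"
  shows "translate_count x (pact k y) = translate_count x y"
proof -
  have "bij_betw (\<lambda>g. g \<otimes> k) {g \<in> carrier G. x \<le> pact g (pact k y)} {g \<in> carrier G. x \<le> pact g y}"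
    by (rule bij_betw_byWitness[where f' = "\<lambda>g. g \<otimes> inv k"])
       (use assms in \<open>auto simp: pact_mult m_assoc\<close>)
  then show ?thesis unfolding translate_count_def by (rule bij_betw_same_card)
qed

text \<open>The number of morphisms from \<open>x\<close> to \<open>y\<close>. For one-element lattices it is the classical mark, the
  number of fixed points of the subgroup of \<open>x\<close> on \<open>G/K\<close>, where \<open>K\<close> is the subgroup of \<open>y\<close>.\<close>

definition mark :: "'a set \<times> 'l \<Rightarrow> 'a set \<times> 'l \<Rightarrow> nat" where
  "mark x y = card ((\<lambda>g. g <# fst y) ` {g \<in> carrier G. x \<le> pact g y})"

lemma card_l_coset: "\<lbrakk>K \<subseteq> carrier G; g \<in> carrier G\<rbrakk> \<Longrightarrow> card (g <# K) = card K"
proof -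
  assume *: "K \<subseteq> carrier G" "g \<in> carrier G"
  then have "g <# K = (\<lambda>k. g \<otimes> k) ` K" "inj_on (\<lambda>k. g \<otimes> k) K"
    by (auto simp: l_coset_def inj_on_def subset_iff)
  then show ?thesis by (simp add: card_image)
qed

lemma translate_count_eq_mark:
  assumes "x \<in> P" "y \<in> P"
  shows "translate_count x y = card (fst y) * mark x y"
proof -
  let ?S = "{g \<in> carrier G. x \<le> pact g y}" and ?c = "\<lambda>g. g <# fst y"
  have K: "subgroup (fst y) G" using assms by (simp add: pairs_iff)
  have fib: "{g \<in> ?S. ?c g = ?c h} = ?c h" if h: "h \<in> ?S" for h
  proof (intro equalityI subsetI)
    fix g assume "g \<in> ?c h"
    moreover from this obtain k where "k \<in> fst y" "g = h \<otimes> k" by (auto simp: l_coset_def)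
    moreover from this have "k \<in> carrier G" using K by (simp add: subgroup.mem_carrier)
    ultimately show "g \<in> {g \<in> ?S. ?c g = ?c h}"
      using h assms K l_repr_independence[of g h "fst y"]
      by (auto simp: pact_mult[symmetric] pact_fixed)
  qed (use K lcos_self in blast)
  have "translate_count x y = (\<Sum>C\<in>?c ` ?S. card {g \<in> ?S. ?c g = C})"
    using sum.image_gen[of ?S "\<lambda>_. 1::nat" ?c] finite_group by (simp add: translate_count_def)
  also have "\<dots> = (\<Sum>C\<in>?c ` ?S. card (fst y))"
  proof (rule sum.cong[OF refl])
    fix C assume "C \<in> ?c ` ?S"
    then obtain h where h: "h \<in> ?S" "C = ?c h" by blast
    then show "card {g \<in> ?S. ?c g = C} = card (fst y)"
      using fib[OF h(1)] K card_l_coset[of "fst y" h] by (simp add: subgroup.subset)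
  qed
  finally show ?thesis by (simp add: mark_def)
qed

lemma double_coset_iff:
  "x \<in> (K #> h) <#> U \<longleftrightarrow> (\<exists>k\<in>K. \<exists>u\<in>U. x = k \<otimes> h \<otimes> u)"
  by (auto simp: r_coset_def set_mult_def)

text \<open>The map \<open>(k, u) \<mapsto> khu\<close> from \<open>K \<times> U\<close> onto \<open>KhU\<close> has fibres of size \<open>|K \<inter> hUh\<^sup>-\<^sup>1|\<close>: the fibre through
  \<open>(a, b)\<close> consists of the pairs \<open>(av, h\<^sup>-\<^sup>1 v\<^sup>-\<^sup>1 h b)\<close>.\<close>

lemma card_double_coset:
  assumes "subgroup K G" "subgroup U G" "h \<in> carrier G"
  shows "card ((K #> h) <#> U) * card (K \<inter> conj_set G h U) = card K * card U"
proof -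
  let ?f = "\<lambda>(k, u). k \<otimes> h \<otimes> u" and ?V = "K \<inter> conj_set G h U"
  note mc = subgroup.mem_carrier[OF assms(1)] subgroup.mem_carrier[OF assms(2)]
  have im: "?f ` (K \<times> U) = (K #> h) <#> U"
    by (auto simp: double_coset_iff image_iff) blast
  have "card {p \<in> K \<times> U. ?f p = d} = card ?V" if d: "d \<in> ?f ` (K \<times> U)" for d
  proof -
    from d obtain a b where ab: "a \<in> K" "b \<in> U" "d = a \<otimes> h \<otimes> b" by auto
    have "bij_betw (\<lambda>v. (a \<otimes> v, inv h \<otimes> inv v \<otimes> h \<otimes> b)) ?V {p \<in> K \<times> U. ?f p = d}"
    proof (rule bij_betw_byWitness[where f' = "\<lambda>(k, u). inv a \<otimes> k"])
      show "\<forall>v\<in>?V. (\<lambda>(k, u). inv a \<otimes> k) (a \<otimes> v, inv h \<otimes> inv v \<otimes> h \<otimes> b) = v"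
        using ab mc assms by (auto simp: m_assoc[symmetric])
      have u: "u = inv h \<otimes> inv (inv a \<otimes> k) \<otimes> h \<otimes> b"
        if "k \<in> K" "u \<in> U" "k \<otimes> h \<otimes> u = d" for k u
      proof -
        have "inv h \<otimes> inv (inv a \<otimes> k) \<otimes> h \<otimes> b = inv h \<otimes> inv k \<otimes> (a \<otimes> h \<otimes> b)"
          using ab that mc assms by (simp add: m_assoc inv_mult_group)
        also have "\<dots> = inv h \<otimes> inv k \<otimes> (k \<otimes> h \<otimes> u)" using ab that by simp
        also have "\<dots> = inv (k \<otimes> h) \<otimes> (k \<otimes> h) \<otimes> u"
          using that(1,2) mc assms by (simp add: m_assoc inv_mult_group)
        also have "\<dots> = u" using that mc assms by simp
        finally show ?thesis by simp
      qed
      then show "\<forall>p\<in>{p \<in> K \<times> U. ?f p = d}. (\<lambda>v. (a \<otimes> v, inv h \<otimes> inv v \<otimes> h \<otimes> b)) ((\<lambda>(k, u). inv a \<otimes> k) p) = p"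
        using ab mc assms by (auto simp: m_assoc[symmetric])
      show "(\<lambda>v. (a \<otimes> v, inv h \<otimes> inv v \<otimes> h \<otimes> b)) ` ?V \<subseteq> {p \<in> K \<times> U. ?f p = d}"
      proof clarsimp
        fix v assume v: "v \<in> K" "v \<in> conj_set G h U"
        then have vU: "inv h \<otimes> v \<otimes> h \<in> U" "v \<in> carrier G" using assms by (auto simp: conj_set_iff)
        have "inv (inv h \<otimes> v \<otimes> h) = inv h \<otimes> inv v \<otimes> h"
          using vU assms by (simp add: m_assoc inv_mult_group)
        then have "inv h \<otimes> inv v \<otimes> h \<in> U" using vU assms(2) subgroup.m_inv_closed by metis
        moreover have "a \<otimes> v \<otimes> h \<otimes> (inv h \<otimes> inv v \<otimes> h \<otimes> b) = a \<otimes> (v \<otimes> (h \<otimes> inv h) \<otimes> inv v) \<otimes> h \<otimes> b"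
          using ab mc vU assms by (simp only: m_assoc m_closed inv_closed)
        then have "a \<otimes> v \<otimes> h \<otimes> (inv h \<otimes> inv v \<otimes> h \<otimes> b) = a \<otimes> h \<otimes> b"
          using ab mc vU assms by simp
        ultimately show "a \<otimes> v \<in> K \<and> inv h \<otimes> inv v \<otimes> h \<otimes> b \<in> U \<and>
            a \<otimes> v \<otimes> h \<otimes> (inv h \<otimes> inv v \<otimes> h \<otimes> b) = d"
          using ab v assms by (simp add: subgroup.m_closed)
      qed
      show "(\<lambda>(k, u). inv a \<otimes> k) ` {p \<in> K \<times> U. ?f p = d} \<subseteq> ?V"
      proof
        fix y assume "y \<in> (\<lambda>(k, u). inv a \<otimes> k) ` {p \<in> K \<times> U. ?f p = d}"
        then obtain k u where ku: "k \<in> K" "u \<in> U" "k \<otimes> h \<otimes> u = d" "y = inv a \<otimes> k" by auto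
        define v where "v = inv a \<otimes> k"
        have v: "v \<in> K" "v \<in> carrier G"
          using ab ku assms mc by (auto simp: v_def subgroup.m_closed subgroup.m_inv_closed)
        have uc: "u \<in> carrier G" "b \<in> carrier G" "h \<in> carrier G" using ku ab mc assms by auto
        have "u = inv h \<otimes> inv v \<otimes> h \<otimes> b" using u[OF ku(1-3)] by (simp add: v_def)
        then have "b \<otimes> inv u = inv h \<otimes> v \<otimes> h"
          using v uc by (simp add: inv_mult_group m_assoc[symmetric])
        then have "inv h \<otimes> v \<otimes> h \<in> U"
          using ab ku assms by (metis subgroup.m_closed subgroup.m_inv_closed)
        then show "y \<in> ?V"
          using v assms ku(4) by (simp add: v_def[symmetric] conj_set_iff)
      qed
    qed
    then show ?thesis by (simp add: bij_betw_same_card)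
  qed
  moreover have "card (K \<times> U) = (\<Sum>d\<in>?f ` (K \<times> U). card {p \<in> K \<times> U. ?f p = d})"
    using sum.image_gen[of "K \<times> U" "\<lambda>_. 1::nat" ?f] assms by (simp add: finite_subgroup)
  ultimately show ?thesis by (simp add: im card_cartesian_product)
qed

lemma sum_double_cosets:
  assumes "subgroup K G" "subgroup U G"
    and F: "\<And>k h u. \<lbrakk>k \<in> K; h \<in> carrier G; u \<in> U\<rbrakk> \<Longrightarrow> F (k \<otimes> h \<otimes> u) = F h"
  shows "(\<Sum>h\<in>carrier G. F h) = (\<Sum>D\<in>double_cosets G K U. of_nat (card D) * (F (SOME h. h \<in> D) :: 'b::semiring_1))"
proof -
  let ?d = "\<lambda>h. (K #> h) <#> U"
  note mc = subgroup.mem_carrier[OF assms(1)] subgroup.mem_carrier[OF assms(2)]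
  have self: "h \<in> ?d h" if "h \<in> carrier G" for h
    using that assms subgroup.one_closed unfolding double_coset_iff
    by (intro bexI[of _ \<one>]) (auto simp: subgroup.one_closed)
  have sub: "?d h' \<subseteq> ?d h" if "h' \<in> ?d h" "h \<in> carrier G" for h h'
  proof
    fix x assume "x \<in> ?d h'"
    then obtain k u where ku: "k \<in> K" "u \<in> U" "x = k \<otimes> h' \<otimes> u" by (auto simp: double_coset_iff)
    obtain k' u' where ku': "k' \<in> K" "u' \<in> U" "h' = k' \<otimes> h \<otimes> u'"
      using \<open>h' \<in> ?d h\<close> by (auto simp: double_coset_iff)
    have "x = (k \<otimes> k') \<otimes> h \<otimes> (u' \<otimes> u)" using ku ku' mc that by (simp add: m_assoc)
    moreover have "k \<otimes> k' \<in> K" "u' \<otimes> u \<in> U" using ku ku' assms by (auto simp: subgroup.m_closed)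
    ultimately show "x \<in> ?d h" unfolding double_coset_iff by blast
  qed
  have sym: "h \<in> ?d h' \<and> h' \<in> carrier G" if "h' \<in> ?d h" "h \<in> carrier G" for h h'
  proof -
    obtain k u where ku: "k \<in> K" "u \<in> U" "h' = k \<otimes> h \<otimes> u"
      using \<open>h' \<in> ?d h\<close> unfolding double_coset_iff by blast
    then have "h = inv k \<otimes> k \<otimes> h \<otimes> (u \<otimes> inv u)" using mc that by simp
    also have "\<dots> = inv k \<otimes> h' \<otimes> inv u" using mc that ku by (simp only: m_assoc m_closed inv_closed)
    finally have "h = inv k \<otimes> h' \<otimes> inv u" .
    moreover have "inv k \<in> K" "inv u \<in> U" using ku assms by (auto simp: subgroup.m_inv_closed)
    ultimately have "h \<in> ?d h'" unfolding double_coset_iff by blast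
    then show ?thesis using ku mc that by simp
  qed
  have fib: "{h' \<in> carrier G. ?d h' = ?d h} = ?d h" if "h \<in> carrier G" for h
  proof (intro equalityI subsetI)
    fix h' assume "h' \<in> {h' \<in> carrier G. ?d h' = ?d h}"
    then show "h' \<in> ?d h" using self[of h'] by simp
  next
    fix h' assume "h' \<in> ?d h"
    with sym[OF this that] sub[OF this that] sub[of h h'] show "h' \<in> {h' \<in> carrier G. ?d h' = ?d h}"
      by auto
  qed
  have "(\<Sum>h\<in>carrier G. F h) = (\<Sum>D\<in>?d ` carrier G. \<Sum>h\<in>{h \<in> carrier G. ?d h = D}. F h)"
    using finite_group by (rule sum.image_gen)
  also have "\<dots> = (\<Sum>D\<in>?d ` carrier G. of_nat (card D) * F (SOME h. h \<in> D))"
  proof (rule sum.cong[OF refl])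
    fix D assume "D \<in> ?d ` carrier G"
    then obtain h where h: "h \<in> carrier G" "D = ?d h" by blast
    have const: "F h' = F h" if "h' \<in> D" for h' using that F h by (auto simp: double_coset_iff)
    have "(SOME h. h \<in> D) \<in> D" using self[OF h(1)] unfolding h(2) by (rule someI)
    then have "(\<Sum>h\<in>D. F h) = of_nat (card D) * F (SOME h. h \<in> D)" using const by simp
    then show "(\<Sum>h\<in>{h \<in> carrier G. ?d h = D}. F h) = of_nat (card D) * F (SOME h. h \<in> D)"
      using fib h by simp
  qed
  also have "?d ` carrier G = double_cosets G K U" by (auto simp: double_cosets_def)
  finally show ?thesis .
qed

lemma card_subgroup_pos: "x \<in> P \<Longrightarrow> 0 < card (fst x)"
  using finite_subgroup subgroup.one_closed by (auto simp: card_gt_0_iff pairs_iff)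

text \<open>The formula for \<open>translate_count\<close>, divided by \<open>|K| |U|\<close>. The summand at \<open>h\<close> depends only on the
  double coset of \<open>h\<close>, and \<open>|KhU|\<close> summands, each carrying the factor \<open>|K \<inter> hUh\<^sup>-\<^sup>1|\<close>, contribute
  \<open>|K| |U|\<close> times one mark.\<close>

lemma mark_mult:
  assumes "x \<in> P" "y \<in> P" "z \<in> P"
  shows "mark x y * mark x z =
    (\<Sum>D\<in>double_cosets G (fst y) (fst z). mark x (pmeet y (pact (SOME h. h \<in> D) z)))"
proof -
  have sg: "subgroup (fst y) G" "subgroup (fst z) G" using assms by (auto simp: pairs_iff)
  note mc = subgroup.mem_carrier[OF sg(1)] subgroup.mem_carrier[OF sg(2)]
  have inv: "translate_count x (pmeet y (pact (k \<otimes> h \<otimes> u) z)) = translate_count x (pmeet y (pact h z))"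
    if "k \<in> fst y" "h \<in> carrier G" "u \<in> fst z" for k h u
  proof -
    have "pmeet y (pact (k \<otimes> h \<otimes> u) z) = pmeet (pact k y) (pact k (pact h (pact u z)))"
      using that assms mc by (simp add: pact_fixed[of y] pact_mult pact_pairs m_assoc)
    also have "\<dots> = pact k (pmeet y (pact h z))"
      using that assms mc by (simp add: pact_fixed[of z] pact_pmeet pact_pairs)
    finally show ?thesis using that assms mc by (simp add: translate_count_pact_right pmeet_pairs pact_pairs)
  qed
  let ?c = "card (fst y) * card (fst z)"
  have "?c * (mark x y * mark x z) = translate_count x y * translate_count x z" using assms by (simp add: translate_count_eq_mark)
  also have "\<dots> = (\<Sum>D\<in>double_cosets G (fst y) (fst z).
      card D * translate_count x (pmeet y (pact (SOME h. h \<in> D) z)))"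
    using sum_double_cosets[OF sg, of "\<lambda>h. translate_count x (pmeet y (pact h z))"] inv assms
    by (simp add: translate_count_mult)
  also have "\<dots> = (\<Sum>D\<in>double_cosets G (fst y) (fst z). ?c * mark x (pmeet y (pact (SOME h. h \<in> D) z)))"
  proof (rule sum.cong[OF refl])
    fix D assume "D \<in> double_cosets G (fst y) (fst z)"
    then obtain h0 where h0: "h0 \<in> carrier G" "D = (fst y #> h0) <#> fst z" by (auto simp: double_cosets_def)
    define h where "h = (SOME h. h \<in> D)"
    have "\<one> \<otimes> h0 \<otimes> \<one> \<in> D" using h0 sg unfolding h0(2) double_coset_iff by (metis subgroup.one_closed)
    then have "h \<in> D" unfolding h_def by (rule someI)
    then obtain k u where ku: "k \<in> fst y" "u \<in> fst z" "h = k \<otimes> h0 \<otimes> u"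
      using h0 by (auto simp: double_coset_iff)
    then have h: "h \<in> carrier G" using mc h0 by auto
    \<comment> \<open>The chosen representative \<open>h\<close> may differ from \<open>h0\<close>, so the double coset is rewritten in terms of \<open>h\<close>
    before its elements are counted.\<close>
    have D: "D = (fst y #> h) <#> fst z"
    proof -
      have "fst y #> h = (fst y #> k) #> h0 #> u"
        using ku mc h0 sg by (simp add: coset_mult_assoc subgroup.subset m_assoc)
      also have "fst y #> k = fst y" using ku sg mc by (simp add: coset_join2)
      finally have "(fst y #> h) <#> fst z = (fst y #> h0) <#> (u <# fst z)"
        using ku mc h0 sg by (simp add: rcos_assoc_lcos subgroup.subset r_coset_subset_G)
      also have "u <# fst z = fst z" using ku sg mc by (simp add: coset_join3)
      finally show ?thesis using h0 by simp
    qed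
    have "card D * translate_count x (pmeet y (pact h z))
        = card D * card (fst y \<inter> conj_set G h (fst z)) * mark x (pmeet y (pact h z))"
      using assms h by (simp add: translate_count_eq_mark pact_pairs pmeet_pairs) (simp add: pmeet_def Let_def fst_pact)
    also have "\<dots> = ?c * mark x (pmeet y (pact h z))"
      using card_double_coset[OF sg h] D by simp
    finally show "card D * translate_count x (pmeet y (pact (SOME h. h \<in> D) z))
        = ?c * mark x (pmeet y (pact (SOME h. h \<in> D) z))" by (simp add: h_def)
  qed
  also have "\<dots> = ?c * (\<Sum>D\<in>double_cosets G (fst y) (fst z). mark x (pmeet y (pact (SOME h. h \<in> D) z)))"
    by (simp add: sum_distrib_left)
  finally show ?thesis
    using assms card_subgroup_pos[of y] card_subgroup_pos[of z] by simp
qed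

lemma mark_pact_left: "\<lbrakk>x \<in> P; y \<in> P; k \<in> carrier G\<rbrakk> \<Longrightarrow> mark (pact k x) y = mark x y"
  using translate_count_pact_left[of x y k] card_subgroup_pos[of y]
  by (simp add: translate_count_eq_mark pact_pairs)

lemma mark_pact_right: "\<lbrakk>x \<in> P; y \<in> P; k \<in> carrier G\<rbrakk> \<Longrightarrow> mark x (pact k y) = mark x y"
  using translate_count_pact_right[of x y k] card_subgroup_pos[of y] card_conj_set[of "fst y" k]
  by (simp add: translate_count_eq_mark pact_pairs fst_pact) (simp add: pairs_iff subgroup.subset)

text \<open>The largest pair. It represents the identity of the lattice Burnside ring.\<close>

definition top_pair :: "'a set \<times> 'l" where "top_pair = (carrier G, Sup_fin (LL (carrier G)))"

lemma top_pair_pairs: "top_pair \<in> P"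
  by (simp add: top_pair_def pairs_iff subgroup_self Sup_LL)

lemma le_top_pair: "x \<in> P \<Longrightarrow> x \<le> top_pair"
  using Sup_LL(2)[of "fst x" "snd x"] Sup_mono[of "fst x" "carrier G"]
  by (auto simp: top_pair_def less_eq_prod_def pairs_iff subgroup.subset subgroup_self
           intro: order_trans)

lemma mark_top_pair: "x \<in> P \<Longrightarrow> mark x top_pair = 1"
proof -
  assume x: "x \<in> P"
  have "pact g top_pair = top_pair" if "g \<in> carrier G" for g
    using that pact_fixed[OF top_pair_pairs] by (simp add: top_pair_def)
  then have "{g \<in> carrier G. x \<le> pact g top_pair} = carrier G"
    using le_top_pair[OF x] by auto
  then have "translate_count x top_pair = card (carrier G)" by (simp add: translate_count_def)
  then show ?thesis
    using x translate_count_eq_mark[OF x top_pair_pairs] card_subgroup_pos[OF top_pair_pairs] by (simp add: top_pair_def)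
qed

lemma mark_self_pos: "x \<in> P \<Longrightarrow> 0 < mark x x"
proof -
  assume x: "x \<in> P"
  then have "\<one> \<in> {g \<in> carrier G. x \<le> pact g x}" by (simp add: pact_one)
  then have "{g \<in> carrier G. x \<le> pact g x} \<noteq> {}" by blast
  then have "translate_count x x \<noteq> 0" unfolding translate_count_def using finite_group by simp
  then show ?thesis using translate_count_eq_mark[OF x x] by simp
qed

text \<open>Triangularity of the table of marks.\<close>

lemma mark_pos_imp:
  assumes "x \<in> P" "y \<in> P" "mark x y \<noteq> 0"
  shows "rank x \<le> rank y" "rank x = rank y \<Longrightarrow> \<exists>g\<in>carrier G. x = pact g y"
proof -
  obtain g where g: "g \<in> carrier G" "x \<le> pact g y"
  proof -
    have "{g \<in> carrier G. x \<le> pact g y} \<noteq> {}"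
      using assms(3) unfolding mark_def by (metis card.empty image_empty)
    then show thesis using that by blast
  qed
  then show "rank x \<le> rank y" using assms rank_mono[of x "pact g y"] by (simp add: pact_pairs rank_pact)
  show "\<exists>g\<in>carrier G. x = pact g y" if "rank x = rank y"
    using g assms that rank_eq_imp_eq[of x "pact g y"] by (auto simp: pact_pairs rank_pact)
qed

section \<open>Morphisms, isomorphism classes and factorization\<close>

abbreviation El_cat where "El_cat \<equiv> El G act LL"
abbreviation obj where "obj x \<equiv> el_obj G act (fst x) (snd x)"
abbreviation arrow where "arrow x y \<equiv> el_lambda G act (fst x) (snd x) (fst y) (snd y)"

interpretation category El_cat by (rule El_category)

lemma le_pact_iff: "x \<le> pact g y \<longleftrightarrow> fst x \<subseteq> conj_set G g (fst y) \<and> snd x \<le> act g (snd y)"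
  by (auto simp: less_eq_prod_def fst_pact snd_pact)

lemma Ob_El_iff: "I \<in> Ob El_cat \<longleftrightarrow> (\<exists>x\<in>P. I = obj x)"
  unfolding El_ob by (metis fst_conv snd_conv surj_pair prod.collapse)

lemma obj_inj: "\<lbrakk>x \<in> P; y \<in> P; obj x = obj y\<rbrakk> \<Longrightarrow> x = y"
  using el_obj_inj[of "fst x" "snd x" "fst y" "snd y"] by (simp add: prod_eq_iff)

lemma Hom_El:
  assumes "x \<in> P" "y \<in> P"
  shows "Hom El_cat (obj x) (obj y) = arrow x y ` {g \<in> carrier G. x \<le> pact g y}"
proof (intro equalityI subsetI)
  fix f assume "f \<in> Hom El_cat (obj x) (obj y)"
  then obtain g where "f = arrow x y g" "g \<in> carrier G" "fst x \<subseteq> conj_set G g (fst y)" "snd x \<le> act g (snd y)"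
    by (rule El_homE) (use assms in simp_all)
  then show "f \<in> arrow x y ` {g \<in> carrier G. x \<le> pact g y}" by (simp add: le_pact_iff)
next
  fix f assume "f \<in> arrow x y ` {g \<in> carrier G. x \<le> pact g y}"
  then show "f \<in> Hom El_cat (obj x) (obj y)"
    using assms unfolding Hom_def El_arr le_pact_iff by (auto intro: prod.collapse) (metis prod.collapse)
qed

lemma Arr_ElE:
  assumes "f \<in> Arr El_cat"
  obtains x y g where "x \<in> P" "y \<in> P" "g \<in> carrier G" "x \<le> pact g y" "f = arrow x y g"
proof -
  have f: "f \<in> Hom El_cat (Dom El_cat f) (Cod El_cat f)" using assms by (rule Arr_Hom)
  obtain x y where "x \<in> P" "y \<in> P" "Dom El_cat f = obj x" "Cod El_cat f = obj y"
    using El_arr_ob[OF assms] by (auto simp: Ob_El_iff)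
  with f obtain g where "g \<in> carrier G" "x \<le> pact g y" "f = arrow x y g" by (auto simp: Hom_El)
  then show thesis using that \<open>x \<in> P\<close> \<open>y \<in> P\<close> by blast
qed

lemma arrow_Arr: "\<lbrakk>x \<in> P; y \<in> P; g \<in> carrier G; x \<le> pact g y\<rbrakk> \<Longrightarrow> arrow x y g \<in> Arr El_cat"
  using Hom_El Hom_Arr by blast

text \<open>The value of the \<open>G\<close>-map on the base point \<open>U\<close> of \<open>G/U\<close> recovers the coset that defines it.\<close>

lemma arrow_base_coset:
  assumes "x \<in> P" "y \<in> P" "g \<in> carrier G" "x \<le> pact g y"
  shows "fst (snd (arrow x y g)) (fst x) = g <# fst y"
  using assms coset_map_coset[of "fst x" "fst y" g \<one>]
  by (simp add: el_lambda_def le_pact_iff pairs_iff lcos_mult_one subgroup.subset)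

lemma arrow_eq_iff:
  assumes "x \<in> P" "y \<in> P" "g \<in> carrier G" "x \<le> pact g y" "h \<in> carrier G" "x \<le> pact h y"
  shows "arrow x y g = arrow x y h \<longleftrightarrow> g <# fst y = h <# fst y"
proof
  assume "arrow x y g = arrow x y h"
  then show "g <# fst y = h <# fst y" using assms arrow_base_coset by metis
next
  assume "g <# fst y = h <# fst y"
  then show "arrow x y g = arrow x y h" by (simp add: el_lambda_def coset_map_def)
qed

lemma arrow_Comp:
  assumes "x \<in> P" "y \<in> P" "z \<in> P" "g \<in> carrier G" "x \<le> pact g y" "h \<in> carrier G" "y \<le> pact h z"
  shows "Comp El_cat (arrow y z h) (arrow x y g) = arrow x z (g \<otimes> h)" "x \<le> pact (g \<otimes> h) z"
proof -
  show "Comp El_cat (arrow y z h) (arrow x y g) = arrow x z (g \<otimes> h)"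
    using assms by (intro el_comp(1)) (auto simp: le_pact_iff)
  show "x \<le> pact (g \<otimes> h) z"
    using assms pact_mono[of y "pact h z" g] order_trans by (metis pact_mult)
qed

lemma arrow_one: "x \<in> P \<Longrightarrow> Ident El_cat (obj x) = arrow x x \<one>"
  using El_id(1)[of "fst x" "snd x"] by simp

lemma card_Hom_El:
  assumes "x \<in> P" "y \<in> P"
  shows "card (Hom El_cat (obj x) (obj y)) = mark x y"
proof -
  let ?S = "{g \<in> carrier G. x \<le> pact g y}" and ?b = "\<lambda>f. fst (snd f) (fst x)"
  have b: "?b (arrow x y g) = g <# fst y" if "g \<in> ?S" for g
    using that assms arrow_base_coset by simp
  have "inj_on ?b (arrow x y ` ?S)"
  proof (rule inj_onI, elim imageE)
    fix f f' g g' assume "?b f = ?b f'" and f: "f = arrow x y g" "g \<in> ?S" "f' = arrow x y g'" "g' \<in> ?S"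
    then have "g <# fst y = g' <# fst y" using b[of g] b[of g'] by simp
    then show "f = f'" using arrow_eq_iff[OF assms, of g g'] f by simp
  qed
  then have "card (arrow x y ` ?S) = card (?b ` arrow x y ` ?S)" by (simp add: card_image)
  also have "?b ` arrow x y ` ?S = (\<lambda>g. g <# fst y) ` ?S"
    unfolding image_image by (rule image_cong[OF refl b])
  finally show ?thesis using assms by (simp add: Hom_El mark_def)
qed

text \<open>The underlying map is surjective. In terms of cosets: \<open>ghH = gkH\<close> implies \<open>hH = kH\<close>.\<close>

lemma El_epimorphism:
  assumes "f \<in> Arr El_cat"
  shows "epimorphism El_cat f"
  unfolding epimorphism_def
proof (intro conjI ballI impI)
  obtain x y g where f: "x \<in> P" "y \<in> P" "g \<in> carrier G" "x \<le> pact g y" "f = arrow x y g"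
    using Arr_ElE[OF assms] .
  fix d d' assume d: "d \<in> Arr El_cat" "d' \<in> Arr El_cat" and
   e: "Dom El_cat d = Cod El_cat f \<and> Dom El_cat d' = Cod El_cat f \<and> Cod El_cat d = Cod El_cat d' \<and>
       Comp El_cat d f = Comp El_cat d' f"
  obtain y1 z h where h: "y1 \<in> P" "z \<in> P" "h \<in> carrier G" "y1 \<le> pact h z" "d = arrow y1 z h"
    using Arr_ElE[OF d(1)] .
  obtain y2 z2 k where k: "y2 \<in> P" "z2 \<in> P" "k \<in> carrier G" "y2 \<le> pact k z2" "d' = arrow y2 z2 k"
    using Arr_ElE[OF d(2)] .
  have [simp]: "y1 = y" using obj_inj[of y1 y] e f h by simp
  have [simp]: "y2 = y" using obj_inj[of y2 y] e f k by simp
  have [simp]: "z2 = z" using obj_inj[of z2 z] e h k by simp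
  have K: "fst z \<subseteq> carrier G" using h by (simp add: pairs_iff subgroup.subset)
  have "arrow x z (g \<otimes> h) = Comp El_cat d f"
    using arrow_Comp(1)[OF f(1,2) h(2) f(3,4) h(3)] h f(5) by simp
  also have "\<dots> = Comp El_cat d' f" using e by blast
  also have "\<dots> = arrow x z (g \<otimes> k)"
    using arrow_Comp(1)[OF f(1,2) h(2) f(3,4) k(3)] k f(5) by simp
  finally have "(g \<otimes> h) <# fst z = (g \<otimes> k) <# fst z"
    using arrow_eq_iff[of x z "g \<otimes> h" "g \<otimes> k"] f h k arrow_Comp(2)[OF f(1,2) h(2) f(3,4)] by simp
  then have "inv g <# ((g \<otimes> h) <# fst z) = inv g <# ((g \<otimes> k) <# fst z)" by simp
  then have "h <# fst z = k <# fst z"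
    using f(3) h(3) k(3) K by (simp add: lcos_m_assoc m_assoc[symmetric])
  then show "d = d'" using arrow_eq_iff[of y z h k] h k by simp
qed (rule assms)

lemma pact_inv_eq: "\<lbrakk>y \<in> P; g \<in> carrier G; x = pact g y\<rbrakk> \<Longrightarrow> y = pact (inv g) x"
  by (simp add: pact_inv)

text \<open>A morphism back from \<open>y\<close> to \<open>x\<close> shows that the two pairs have the same rank, so \<open>x \<le> g.y\<close> must be an
  equality.\<close>

lemma arrow_isomorphism_iff:
  assumes "x \<in> P" "y \<in> P" "g \<in> carrier G" "x \<le> pact g y"
  shows "isomorphism El_cat (arrow x y g) \<longleftrightarrow> x = pact g y"
proof
  assume "isomorphism El_cat (arrow x y g)"
  then obtain f where "f \<in> Hom El_cat (Cod El_cat (arrow x y g)) (Dom El_cat (arrow x y g))"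
    by (rule isoE)
  then have "f \<in> Hom El_cat (obj y) (obj x)" by simp
  then obtain h where h: "h \<in> carrier G" "y \<le> pact h x" using assms by (auto simp: Hom_El)
  then have "rank y \<le> rank x" using rank_mono[of y "pact h x"] assms by (simp add: rank_pact pact_pairs)
  then show "x = pact g y" using rank_eq_imp_eq[of x "pact g y"] assms by (simp add: rank_pact pact_pairs)
next
  assume eq: "x = pact g y"
  then have y: "y \<le> pact (inv g) x" using assms by (simp add: pact_inv)
  show "isomorphism El_cat (arrow x y g)"
  proof (rule isoI)
    show "arrow x y g \<in> Hom El_cat (obj x) (obj y)" "arrow y x (inv g) \<in> Hom El_cat (obj y) (obj x)"
      using assms y by (auto simp: Hom_El)
    show "Comp El_cat (arrow y x (inv g)) (arrow x y g) = Ident El_cat (obj x)"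
      using assms y arrow_Comp[of x y x g "inv g"] by (simp add: arrow_one)
    show "Comp El_cat (arrow x y g) (arrow y x (inv g)) = Ident El_cat (obj y)"
      using assms y arrow_Comp[of y x y "inv g" g] by (simp add: arrow_one)
  qed
qed

lemma iso_class_El:
  assumes "x \<in> P"
  shows "iso_class El_cat (obj x) = obj ` orbit G pact x"
proof (intro equalityI subsetI)
  fix J assume "J \<in> iso_class El_cat (obj x)"
  then obtain y f where y: "y \<in> P" "J = obj y" "f \<in> Hom El_cat (obj x) (obj y)" "isomorphism El_cat f"
    by (auto simp: iso_class_def Ob_El_iff)
  then obtain g where g: "g \<in> carrier G" "x \<le> pact g y" "f = arrow x y g" using assms by (auto simp: Hom_El)
  then have "x = pact g y" using y assms arrow_isomorphism_iff by simp
  then have "y = pact (inv g) x" using y g pact_inv_eq by blast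
  then show "J \<in> obj ` orbit G pact x" using g y by (auto simp: orbit_def)
next
  fix J assume "J \<in> obj ` orbit G pact x"
  then obtain g where g: "g \<in> carrier G" "J = obj (pact g x)" by (auto simp: orbit_def)
  let ?y = "pact g x"
  have y: "?y \<in> P" "x = pact (inv g) ?y" using g assms by (auto simp: pact_pairs pact_inv)
  then have "isomorphism El_cat (arrow x ?y (inv g))"
    using arrow_isomorphism_iff[of x ?y "inv g"] g assms by simp
  moreover have "arrow x ?y (inv g) \<in> Hom El_cat (obj x) (obj ?y)"
    using y g assms by (auto simp: Hom_El)
  ultimately show "J \<in> iso_class El_cat (obj x)" using g y by (auto simp: iso_class_def Ob_El_iff)
qed

lemma endo_fixes:
  "\<lbrakk>x \<in> P; g \<in> carrier G; x \<le> pact g x\<rbrakk> \<Longrightarrow> pact g x = x"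
  using rank_eq_imp_eq[of x "pact g x"] by (simp add: pact_pairs rank_pact)

section \<open>Coequalizers\<close>

text \<open>The pair \<open>(\<langle>g\<rangle>U, s\<^bsub>(g,t)\<^esub>)\<close> for \<open>x = (U, t)\<close>.\<close>

definition gen_pair :: "'a \<Rightarrow> 'a set \<times> 'l \<Rightarrow> 'a set \<times> 'l" where
  "gen_pair g x = (gen_prod G g (fst x), Inf_fin {s \<in> LL (gen_prod G g (fst x)). snd x \<le> s})"

text \<open>As \<open>g\<close> normalizes \<open>U\<close>, so does \<open>\<langle>g\<rangle>\<close>, and \<open>\<langle>g\<rangle>U\<close> is the subgroup generated by \<open>g\<close> and \<open>U\<close>.\<close>

lemma gen_prod_subgroup:
  assumes "x \<in> P" "g \<in> carrier G" "pact g x = x"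
  shows "subgroup (gen_prod G g (fst x)) G" "fst x \<subseteq> gen_prod G g (fst x)" "g \<in> gen_prod G g (fst x)"
    "\<And>W. \<lbrakk>subgroup W G; fst x \<subseteq> W; g \<in> W\<rbrakk> \<Longrightarrow> gen_prod G g (fst x) \<subseteq> W"
proof -
  let ?C = "generate G {g}" and ?U = "fst x" and ?V = "gen_prod G g (fst x)"
  have U: "subgroup ?U G" using assms by (simp add: pairs_iff)
  have C: "subgroup ?C G" using assms by (intro generate_is_subgroup) auto
  note mc = subgroup.mem_carrier[OF U] subgroup.mem_carrier[OF C]
  have V: "v \<in> ?V \<longleftrightarrow> (\<exists>c\<in>?C. \<exists>u\<in>?U. v = c \<otimes> u)" for v
    by (auto simp: gen_prod_def set_mult_def)
  have "subgroup {h \<in> carrier G. pact h x = x} G"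
  proof (rule subgroupI)
    show "{h \<in> carrier G. pact h x = x} \<noteq> {}" using assms by blast
    show "inv h \<in> {h \<in> carrier G. pact h x = x}" if "h \<in> {h \<in> carrier G. pact h x = x}" for h
      using that pact_inv[OF assms(1), of h] by simp
    show "h \<otimes> k \<in> {h \<in> carrier G. pact h x = x}"
      if "h \<in> {h \<in> carrier G. pact h x = x}" "k \<in> {h \<in> carrier G. pact h x = x}" for h k
      using that pact_mult[OF assms(1), of h k] by simp
  qed blast
  then have "?C \<subseteq> {h \<in> carrier G. pact h x = x}"
    using assms by (intro generate_subgroup_incl) auto
  then have fx: "pact c x = x" if "c \<in> ?C" for c using that by blast
  have norm: "inv c \<otimes> u \<otimes> c \<in> ?U" if "c \<in> ?C" "u \<in> ?U" for c u
  proof -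
    have "u \<in> conj_set G c ?U" using fst_pact[of c x] fx[OF that(1)] that(2) by simp
    then show ?thesis using conj_set_iff[OF U mc(2)[OF that(1)]] by simp
  qed
  show sub: "?U \<subseteq> ?V" and "g \<in> ?V"
  proof -
    have "u = \<one> \<otimes> u" if "u \<in> ?U" for u using that mc by simp
    then show "?U \<subseteq> ?V" using subgroup.one_closed[OF C] V by blast
    have "g = g \<otimes> \<one>" "g \<in> ?C" using assms by (simp_all add: generate.incl)
    then show "g \<in> ?V" unfolding V using subgroup.one_closed[OF U] by blast
  qed
  show "?V \<subseteq> W" if "subgroup W G" "?U \<subseteq> W" "g \<in> W" for W
  proof
    fix v assume "v \<in> ?V"
    moreover have "?C \<subseteq> W" using that by (intro generate_subgroup_incl) auto
    ultimately show "v \<in> W" using that unfolding V by (auto intro: subgroup.m_closed)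
  qed
  show "subgroup ?V G"
  proof (rule subgroupI)
    show "?V \<subseteq> carrier G" using mc by (auto simp: V)
    show "?V \<noteq> {}" using sub subgroup.one_closed[OF U] by auto
  next
    fix v assume "v \<in> ?V"
    then obtain c u where cu: "c \<in> ?C" "u \<in> ?U" "v = c \<otimes> u" by (auto simp: V)
    have ci: "inv c \<in> ?C" "inv u \<in> ?U" using cu C U by (auto intro: subgroup.m_inv_closed)
    have "inv v = inv c \<otimes> (inv (inv c) \<otimes> inv u \<otimes> inv c)"
      using cu mc by (simp add: inv_mult_group m_assoc[symmetric])
    then show "inv v \<in> ?V" unfolding V using norm[OF ci] ci(1) by blast
  next
    fix v w assume "v \<in> ?V" "w \<in> ?V"
    then obtain c u c' u' where cu: "c \<in> ?C" "u \<in> ?U" "v = c \<otimes> u" "c' \<in> ?C" "u' \<in> ?U" "w = c' \<otimes> u'"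
      by (auto simp: V)
    have cc: "c \<in> carrier G" "u \<in> carrier G" "c' \<in> carrier G" "u' \<in> carrier G" using cu mc by auto
    have "v \<otimes> w = c \<otimes> (c' \<otimes> inv c') \<otimes> u \<otimes> (c' \<otimes> u')" using cu cc by (simp add: m_assoc)
    also have "\<dots> = (c \<otimes> c') \<otimes> ((inv c' \<otimes> u \<otimes> c') \<otimes> u')"
      using cc by (simp only: m_assoc m_closed inv_closed)
    finally have "v \<otimes> w = (c \<otimes> c') \<otimes> ((inv c' \<otimes> u \<otimes> c') \<otimes> u')" .
    moreover have "c \<otimes> c' \<in> ?C" "(inv c' \<otimes> u \<otimes> c') \<otimes> u' \<in> ?U"
      using norm[OF cu(4,2)] cu C U by (auto intro: subgroup.m_closed)
    ultimately show "v \<otimes> w \<in> ?V" unfolding V by blast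
  qed
qed

text \<open>The infimum is over a nonempty set, because \<open>sup LL\<close> of the larger group is at least \<open>sup LL U \<ge> t\<close>.
  If \<open>y = (K, s)\<close> lies above \<open>x\<close> and \<open>g \<in> K\<close>, then the restriction of \<open>s\<close> to \<open>\<langle>g\<rangle>U\<close> is one of the
  elements over which the infimum is taken.\<close>

lemma gen_pair_least:
  assumes "x \<in> P" "g \<in> carrier G" "pact g x = x"
  shows "gen_pair g x \<in> P" "x \<le> gen_pair g x"
    "\<And>y. \<lbrakk>y \<in> P; x \<le> y; g \<in> fst y\<rbrakk> \<Longrightarrow> gen_pair g x \<le> y"
proof -
  let ?V = "gen_prod G g (fst x)" and ?S = "{s \<in> LL (gen_prod G g (fst x)). snd x \<le> s}"
  note V = gen_prod_subgroup[OF assms]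
  have le: "snd x \<le> Sup_fin (LL ?V)"
    using assms Sup_LL(2)[of "fst x" "snd x"] Sup_mono[of "fst x" ?V] V(1,2) by (simp add: pairs_iff)
  then have ne: "?S \<noteq> {}" using Sup_LL(1)[OF V(1)] by blast
  have "Inf_fin A \<in> ?S" if "A \<noteq> {}" "A \<subseteq> ?S" for A
    using finite[of A] that by (induction rule: finite_ne_induct) (auto simp: inf_closed[OF V(1)])
  from this[OF ne order_refl] show "gen_pair g x \<in> P" "x \<le> gen_pair g x"
    using V(1,2) by (simp_all add: gen_pair_def pairs_iff less_eq_prod_def)
  show "gen_pair g x \<le> y" if y: "y \<in> P" "x \<le> y" "g \<in> fst y" for y
  proof -
    have Vy: "?V \<subseteq> fst y" using V(4)[of "fst y"] y by (simp add: pairs_iff less_eq_prod_def)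
    have "inf_class.inf (snd y) (Sup_fin (LL ?V)) \<in> ?S"
      using y le Vy restriction[OF V(1), of "fst y" "snd y"] by (simp add: pairs_iff less_eq_prod_def)
    then have "Inf_fin ?S \<le> inf_class.inf (snd y) (Sup_fin (LL ?V))"
      by (intro Inf_fin.coboundedI finite)
    then show ?thesis using Vy by (simp add: gen_pair_def less_eq_prod_def)
  qed
qed

text \<open>A morphism \<open>h\<close> from \<open>x\<close> to \<open>y\<close> coequalizes iff \<open>ghK = hK\<close>, that is, iff \<open>g\<close> lies in the subgroup of
  \<open>h.y\<close>. By minimality of \<open>gen_pair g x\<close> the same \<open>h\<close> is then a morphism from \<open>gen_pair g x\<close> to \<open>y\<close>.
  It is the only factorization since all morphisms are epimorphisms.\<close>

lemma arrow_coequalizer: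
  assumes "x \<in> P" "g \<in> carrier G" "pact g x = x"
  shows "is_coequalizer El_cat (arrow x x g) (Ident El_cat (obj x)) (arrow x (gen_pair g x) \<one>)"
proof -
  let ?z = "gen_pair g x"
  note z = gen_pair_least[OF assms]
  have one: "x \<le> pact \<one> x" "x \<le> pact \<one> ?z" "x \<le> pact g x" using assms z by (simp_all add: pact_one)
  have gz: "g \<in> fst ?z" using gen_prod_subgroup[OF assms] by (simp add: gen_pair_def)
  have coset: "g <# fst y = \<one> <# fst y" if "y \<in> P" "g \<in> fst y" for y
    using that assms by (simp add: pairs_iff coset_join3 lcos_mult_one subgroup.subset)
  have "arrow x ?z g = arrow x ?z \<one>"
    using assms z one gz coset[OF z(1)] pact_fixed[OF z(1) gz] by (subst arrow_eq_iff) auto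
  then have comp: "Comp El_cat (arrow x ?z \<one>) (arrow x x g) = Comp El_cat (arrow x ?z \<one>) (Ident El_cat (obj x))"
    using assms z one by (simp add: arrow_one arrow_Comp)
  have univ: "\<exists>!u. u \<in> Hom El_cat (obj ?z) (Cod El_cat d) \<and> Comp El_cat u (arrow x ?z \<one>) = d"
    if d: "d \<in> Arr El_cat" "Dom El_cat d = obj x"
      "Comp El_cat d (arrow x x g) = Comp El_cat d (Ident El_cat (obj x))" for d
  proof -
    obtain x' y h where h: "x' \<in> P" "y \<in> P" "h \<in> carrier G" "x' \<le> pact h y" "d = arrow x' y h"
      using Arr_ElE[OF d(1)] .
    have [simp]: "x' = x" using d h assms obj_inj by simp
    have le: "x \<le> pact (g \<otimes> h) y"
      using h assms arrow_Comp(2)[of x x y g h] one by simp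
    have "arrow x y (g \<otimes> h) = arrow x y h" using d h assms one by (simp add: arrow_one arrow_Comp)
    then have "(g \<otimes> h) <# fst y = h <# fst y" using arrow_eq_iff[OF assms(1) h(2) _ le, of h] assms h by simp
    moreover have "g \<otimes> h \<in> (g \<otimes> h) <# fst y" using assms h by (intro lcos_self) (auto simp: pairs_iff)
    ultimately obtain k where "k \<in> fst y" "g \<otimes> h = h \<otimes> k" by (auto simp: l_coset_def)
    then have "inv h \<otimes> g \<otimes> h \<in> fst y"
      using h assms by (auto simp: m_assoc pairs_iff subgroup.mem_carrier simp flip: m_assoc[of "inv h" h])
    then have "g \<in> fst (pact h y)" using conj_set_iff[of "fst y" h g] h assms by (simp add: fst_pact pairs_iff)
    then have zy: "?z \<le> pact h y" using z(3)[of "pact h y"] h by (simp add: pact_pairs)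
    have c: "Comp El_cat (arrow ?z y h) (arrow x ?z \<one>) = d"
      using arrow_Comp(1)[OF assms(1) z(1) h(2) _ one(2) h(3) zy] h by simp
    show ?thesis
    proof (rule ex1I[of _ "arrow ?z y h"])
      show "arrow ?z y h \<in> Hom El_cat (obj ?z) (Cod El_cat d) \<and> Comp El_cat (arrow ?z y h) (arrow x ?z \<one>) = d"
        using c h z zy by (auto simp: Hom_El)
      fix u assume u: "u \<in> Hom El_cat (obj ?z) (Cod El_cat d) \<and> Comp El_cat u (arrow x ?z \<one>) = d"
      have "epimorphism El_cat (arrow x ?z \<one>)" using El_epimorphism arrow_Arr assms z one by simp
      then show "u = arrow ?z y h"
        using u c h z zy arrow_Arr[of ?z y h] unfolding epimorphism_def
        by (auto simp: Hom_def)
    qed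
  qed
  show ?thesis
    unfolding is_coequalizer_def
    using comp univ assms z one arrow_Arr[of x x g] arrow_Arr[of x x \<one>] arrow_Arr[of x ?z \<one>]
    by (simp add: arrow_one)
qed

section \<open>The table of marks and the lattice Burnside ring\<close>

abbreviation orb where "orb \<equiv> orbit G pact"
abbreviation Orbs where "Orbs \<equiv> orbits G P pact"

lemma finite_P: "finite P"
proof -
  have "P \<subseteq> Pow (carrier G) \<times> UNIV" by (auto simp: pairs_def dest: subgroup.subset)
  moreover have "finite (Pow (carrier G) \<times> (UNIV :: 'l set))" using finite_group by simp
  ultimately show ?thesis by (rule finite_subset)
qed

lemma Orbs_image: "Orbs = orb ` P"
  unfolding orbits_def by blast

lemma finite_Orbs: "finite Orbs"
  unfolding Orbs_image using finite_P by simp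

lemma orbE:
  assumes "y \<in> orb x"
  obtains g where "g \<in> carrier G" "y = pact g x"
  using assms by (auto simp: orbit_def)

lemma orb_self: "x \<in> P \<Longrightarrow> x \<in> orb x"
  using pact_one unfolding orbit_def by (metis (mono_tags, lifting) mem_Collect_eq one_closed)

lemma orb_P: "\<lbrakk>x \<in> P; y \<in> orb x\<rbrakk> \<Longrightarrow> y \<in> P"
  by (auto simp: pact_pairs elim: orbE)

lemma orb_pact:
  assumes "x \<in> P" "g \<in> carrier G"
  shows "orb (pact g x) = orb x"
proof (intro equalityI subsetI)
  fix y assume "y \<in> orb (pact g x)"
  then obtain h where "h \<in> carrier G" "y = pact h (pact g x)" by (rule orbE)
  then have "y = pact (h \<otimes> g) x" "h \<otimes> g \<in> carrier G" using assms by (simp_all add: pact_mult)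
  then show "y \<in> orb x" unfolding orbit_def by blast
next
  fix y assume "y \<in> orb x"
  then obtain h where "h \<in> carrier G" "y = pact h x" by (rule orbE)
  then have "y = pact (h \<otimes> inv g) (pact g x)" "h \<otimes> inv g \<in> carrier G"
    using assms by (simp_all add: pact_mult pact_pairs m_assoc)
  then show "y \<in> orb (pact g x)" unfolding orbit_def by blast
qed

lemma orb_eq: "\<lbrakk>x \<in> P; y \<in> orb x\<rbrakk> \<Longrightarrow> orb y = orb x"
  by (auto simp: orb_pact elim: orbE)

lemma OrbsE:
  assumes "a \<in> Orbs"
  obtains x where "x \<in> P" "a = orb x"
  using assms unfolding Orbs_image by blast

lemma orb_Orbs: "x \<in> P \<Longrightarrow> orb x \<in> Orbs"
  unfolding Orbs_image by blast

lemma mark_orb: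
  assumes "x \<in> P" "y \<in> P" "x' \<in> orb x" "y' \<in> orb y"
  shows "mark x' y' = mark x y"
proof -
  obtain g h where "g \<in> carrier G" "x' = pact g x" "h \<in> carrier G" "y' = pact h y"
    using assms(3,4) by (metis orbE)
  then show ?thesis using assms by (simp add: mark_pact_left mark_pact_right pact_pairs)
qed

lemma some_orb: "x \<in> P \<Longrightarrow> (SOME y. y \<in> orb x) \<in> orb x"
  using orb_self by (rule someI)

lemma iso_classes_El: "iso_classes El_cat = (\<lambda>a. obj ` a) ` Orbs"
proof -
  have "Ob El_cat = obj ` P" using Ob_El_iff by blast
  then have "iso_classes El_cat = (\<lambda>x. iso_class El_cat (obj x)) ` P"
    by (simp only: iso_classes_def image_image)
  also have "\<dots> = (\<lambda>x. obj ` orb x) ` P" by (rule image_cong[OF refl iso_class_El])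
  also have "\<dots> = (\<lambda>a. obj ` a) ` Orbs" by (simp only: Orbs_image image_image)
  finally show ?thesis .
qed

lemma iso_classesE:
  assumes "A \<in> iso_classes El_cat"
  obtains x where "x \<in> P" "A = obj ` orb x"
  using assms unfolding iso_classes_El Orbs_image by blast

lemma bij_iso_classes: "bij_betw (\<lambda>a. obj ` a) Orbs (iso_classes El_cat)"
  unfolding bij_betw_def iso_classes_El
proof (intro conjI inj_onI refl)
  have sub: "a \<subseteq> P" if "a \<in> Orbs" for a
  proof -
    obtain x where "x \<in> P" "a = orb x" using \<open>a \<in> Orbs\<close> by (rule OrbsE)
    then show ?thesis using orb_P by blast
  qed
  fix a b assume ab: "a \<in> Orbs" "b \<in> Orbs" "obj ` a = obj ` b"
  have "inj_on obj P" by (intro inj_onI) (rule obj_inj)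
  then show "a = b" using inj_on_image_eq_iff[of obj P a b] sub[OF ab(1)] sub[OF ab(2)] ab(3) by blast
qed

lemma hom_number_El:
  assumes "x \<in> P" "y \<in> P"
  shows "hom_number El_cat (obj ` orb x) (obj ` orb y) = mark x y"
proof -
  have some: "\<exists>z'\<in>orb z. (SOME I. I \<in> obj ` orb z) = obj z'" if "z \<in> P" for z
  proof -
    have "obj z \<in> obj ` orb z" using orb_self[OF that] by blast
    then have "(SOME I. I \<in> obj ` orb z) \<in> obj ` orb z" by (rule someI)
    then show ?thesis by blast
  qed
  obtain x' y' where "x' \<in> orb x" "(SOME I. I \<in> obj ` orb x) = obj x'"
    "y' \<in> orb y" "(SOME I. I \<in> obj ` orb y) = obj y'"
    using some[OF assms(1)] some[OF assms(2)] by blast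
  then show ?thesis
    using assms orb_P[of x x'] orb_P[of y y'] by (simp add: hom_number_def card_Hom_El mark_orb)
qed

lemma symb_orb: "symb G act K s = orb (K, s)"
  by (simp add: symb_def)

lemma pair_product_eq:
  "pair_product G act LL x y =
    (\<Sum>D\<in>double_cosets G (fst x) (fst y). frag_of (orb (pmeet x (pact (SOME h. h \<in> D) y))))"
  by (simp add: pair_product_def symb_orb pmeet_def Let_def fst_pact snd_pact split: prod.split)

lemma double_coset_rep:
  assumes "subgroup K G" "subgroup U G" "D \<in> double_cosets G K U"
  shows "(SOME h. h \<in> D) \<in> carrier G"
proof -
  obtain h where h: "h \<in> carrier G" "D = (K #> h) <#> U" using assms(3) by (auto simp: double_cosets_def)
  have "\<one> \<otimes> h \<otimes> \<one> \<in> D"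
    using subgroup.one_closed[OF assms(1)] subgroup.one_closed[OF assms(2)]
    unfolding h(2) double_coset_iff by blast
  then have "(SOME h. h \<in> D) \<in> D" by (rule someI)
  then show ?thesis
    unfolding h(2) double_coset_iff
    using h(1) subgroup.mem_carrier[OF assms(1)] subgroup.mem_carrier[OF assms(2)] by auto
qed

lemma pmeet_rep_P:
  assumes "y \<in> P" "z \<in> P" "D \<in> double_cosets G (fst y) (fst z)"
  shows "pmeet y (pact (SOME h. h \<in> D) z) \<in> P"
proof -
  have "subgroup (fst y) G" "subgroup (fst z) G" using assms(1,2) by (simp_all add: pairs_iff)
  then show ?thesis using assms double_coset_rep pmeet_pairs pact_pairs by blast
qed

text \<open>Suppose some coefficient is nonzero, and evaluate the relation at a pair \<open>x\<close> of maximal rank among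
  those with nonzero coefficient. By triangularity only the diagonal term \<open>f (orb x) * mark x x\<close> survives.\<close>

lemma hom_indep_El:
  fixes f :: "('a set \<times> 'l) set \<Rightarrow> rat"
  assumes "\<And>A. A \<in> iso_classes El_cat \<Longrightarrow> (\<Sum>a\<in>Orbs. f a * of_nat (hom_number El_cat A (obj ` a))) = 0"
    and "b \<in> Orbs"
  shows "f b = 0"
proof (rule ccontr)
  assume "f b \<noteq> 0"
  let ?S = "{x \<in> P. f (orb x) \<noteq> 0}"
  obtain x0 where "x0 \<in> P" "b = orb x0" using \<open>b \<in> Orbs\<close> by (rule OrbsE)
  then have "?S \<noteq> {}" using \<open>f b \<noteq> 0\<close> by blast
  have "finite ?S" using finite_P by simp
  then have "Max (rank ` ?S) \<in> rank ` ?S" using \<open>?S \<noteq> {}\<close> by (intro Max_in) simp_all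
  then obtain x where "Max (rank ` ?S) = rank x" "x \<in> ?S" by (rule imageE)
  then have x: "x \<in> P" "f (orb x) \<noteq> 0" "rank x = Max (rank ` ?S)" by simp_all
  have max: "rank y \<le> rank x" if "y \<in> P" "f (orb y) \<noteq> 0" for y
    unfolding x(3) using that \<open>finite ?S\<close> by (intro Max_ge) simp_all
  have zero: "f a * of_nat (hom_number El_cat (obj ` orb x) (obj ` a)) = 0" if a: "a \<in> Orbs - {orb x}" for a
  proof (rule ccontr)
    assume n: "f a * of_nat (hom_number El_cat (obj ` orb x) (obj ` a)) \<noteq> 0"
    obtain y where y: "y \<in> P" "a = orb y" using a unfolding Orbs_image by blast
    then have "f (orb y) \<noteq> 0" "mark x y \<noteq> 0" using n x by (simp_all add: hom_number_El)
    then have "rank x = rank y" using max y mark_pos_imp(1)[OF x(1) y(1)] by (simp add: le_antisym)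
    then obtain g where "g \<in> carrier G" "x = pact g y"
      using mark_pos_imp(2)[OF x(1) y(1)] \<open>mark x y \<noteq> 0\<close> by blast
    then have "orb x = orb y" using y orb_pact by simp
    then show False using a y by simp
  qed
  have "obj ` orb x \<in> iso_classes El_cat" using iso_classes_El orb_Orbs[OF x(1)] by blast
  then have "0 = (\<Sum>a\<in>Orbs. f a * of_nat (hom_number El_cat (obj ` orb x) (obj ` a)))" using assms(1) by simp
  also have "\<dots> = f (orb x) * of_nat (mark x x)"
    unfolding sum.remove[OF finite_Orbs orb_Orbs[OF x(1)]]
    using sum.neutral[OF ballI[OF zero], of "Orbs - {orb x}"] x(1) by (simp only: hom_number_El add_0_right)
  finally show False using x mark_self_pos[OF x(1)] by simp
qed

text \<open>The orbits of pairs and the products of symbols fit the abstract setting. The representatives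
  chosen in the definition of the product are again pairs in the given orbits, so \<open>mark_mult\<close> applies
  to them.\<close>

lemma burnside_basis_El:
  "burnside_basis El_cat Orbs (\<lambda>a. obj ` a) (symb_product G act LL) (symb G act (carrier G) (Sup_fin (LL (carrier G))))"
proof (rule burnside_basis.intro)
  show "finite Orbs" by (rule finite_Orbs)
  show "bij_betw (\<lambda>a. obj ` a) Orbs (iso_classes El_cat)" by (rule bij_iso_classes)
  have top: "symb G act (carrier G) (Sup_fin (LL (carrier G))) = orb top_pair"
    by (simp add: symb_orb top_pair_def)
  show "symb G act (carrier G) (Sup_fin (LL (carrier G))) \<in> Orbs"
    unfolding top by (rule orb_Orbs[OF top_pair_pairs])
  have rep: "\<exists>y\<in>P. \<exists>z\<in>P. a = orb y \<and> b = orb z \<and> symb_product G act LL a b = pair_product G act LL y z"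
    if "a \<in> Orbs" "b \<in> Orbs" for a b
  proof -
    obtain y where y: "y \<in> P" "a = orb y" using \<open>a \<in> Orbs\<close> by (rule OrbsE)
    obtain z where z: "z \<in> P" "b = orb z" using \<open>b \<in> Orbs\<close> by (rule OrbsE)
    let ?y = "SOME x. x \<in> a" and ?z = "SOME x. x \<in> b"
    have in_orb: "?y \<in> orb y" "?z \<in> orb z" unfolding y(2) z(2) by (rule some_orb[OF y(1)], rule some_orb[OF z(1)])
    have "a = orb ?y" unfolding orb_eq[OF y(1) in_orb(1)] by (rule y(2))
    moreover have "b = orb ?z" unfolding orb_eq[OF z(1) in_orb(2)] by (rule z(2))
    moreover have "symb_product G act LL a b = pair_product G act LL ?y ?z" by (simp only: symb_product_def)
    ultimately show ?thesis using orb_P[OF y(1) in_orb(1)] orb_P[OF z(1) in_orb(2)] by blast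
  qed
  show "Poly_Mapping.keys (symb_product G act LL a b) \<subseteq> Orbs" if ab: "a \<in> Orbs" "b \<in> Orbs" for a b
  proof -
    obtain y z where yz: "y \<in> P" "z \<in> P" "symb_product G act LL a b = pair_product G act LL y z"
      using rep[OF ab] by blast
    show ?thesis unfolding yz(3) pair_product_eq
      by (intro order_trans[OF keys_sum] UN_least) (simp add: orb_Orbs pmeet_rep_P yz)
  qed
  show "frag_eval (\<lambda>z. of_nat (hom_number El_cat A (obj ` z))) (symb_product G act LL a b)
      = (of_nat (hom_number El_cat A (obj ` a)) * of_nat (hom_number El_cat A (obj ` b)) :: rat)"
    if A: "A \<in> iso_classes El_cat" and ab: "a \<in> Orbs" "b \<in> Orbs" for A a b
  proof -
    obtain y z where yz: "y \<in> P" "z \<in> P" "a = orb y" "b = orb z"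
      "symb_product G act LL a b = pair_product G act LL y z" using rep[OF ab] by blast
    obtain x where x: "x \<in> P" "A = obj ` orb x" using A by (rule iso_classesE)
    have "frag_eval (\<lambda>z. of_nat (hom_number El_cat A (obj ` z))) (symb_product G act LL a b)
      = (\<Sum>D\<in>double_cosets G (fst y) (fst z). of_nat (mark x (pmeet y (pact (SOME h. h \<in> D) z))) :: rat)"
      unfolding yz(5) pair_product_eq frag_eval_sum frag_eval_of
      by (rule sum.cong[OF refl]) (simp add: x hom_number_El pmeet_rep_P yz)
    also have "\<dots> = of_nat (mark x y * mark x z)" unfolding mark_mult[OF x(1) yz(1,2)] by simp
    finally show ?thesis using x yz by (simp add: hom_number_El)
  qed
  show "hom_number El_cat A (obj ` symb G act (carrier G) (Sup_fin (LL (carrier G)))) = 1"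
    if A: "A \<in> iso_classes El_cat" for A
  proof -
    obtain x where x: "x \<in> P" "A = obj ` orb x" using A by (rule iso_classesE)
    then show ?thesis unfolding top by (simp add: hom_number_El top_pair_pairs mark_top_pair)
  qed
  show "f b = 0" if "\<And>A. A \<in> iso_classes El_cat \<Longrightarrow>
        (\<Sum>a\<in>Orbs. f a * of_nat (hom_number El_cat A (obj ` a))) = 0" "b \<in> Orbs" for f :: "_ \<Rightarrow> rat" and b
    using that by (rule hom_indep_El)
qed

lemma abstract_Burnside_El:
  assumes "prime_or_infinity p"
  shows "\<exists>m u. abstract_Burnside_structure p El_cat m u"
    "abstract_Burnside_structure p El_cat m u \<Longrightarrow>
      iso_to_localization p (Burnside_module p El_cat m u) (lattice_Burnside_ring G act LL)"
proof -
  interpret B: burnside_basis El_cat Orbs "\<lambda>a. obj ` a" "symb_product G act LL" "symb G act (carrier G) (Sup_fin (LL (carrier G)))"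
    by (rule burnside_basis_El)
  show "\<exists>m u. abstract_Burnside_structure p El_cat m u"
    using B.abstract_Burnside_structure_burnside_mult[OF assms] by blast
  have "B.basis_ring = lattice_Burnside_ring G act LL"
    by (simp add: B.basis_ring_def lattice_Burnside_ring_def)
  then show "abstract_Burnside_structure p El_cat m u \<Longrightarrow>
      iso_to_localization p (Burnside_module p El_cat m u) (lattice_Burnside_ring G act LL)"
    using B.iso_to_localization_basis_ring[OF assms] by simp
qed

lemma Aut_coequalizer:
  assumes "I \<in> Ob El_cat" "is_Aut_p p El_cat I Q" "\<sigma> \<in> Q"
  shows "\<exists>c. is_coequalizer El_cat \<sigma> (Ident El_cat I) c"
proof -
  have "\<sigma> \<in> carrier (Aut El_cat I)"
    using assms(2,3) subgroup.subset[of Q "Aut El_cat I"]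
    by (auto simp: is_Aut_p_def sylow_subgroup_def split: enat.splits)
  then have "\<sigma> \<in> Hom El_cat I I" by (simp add: Aut_def)
  moreover obtain x where x: "x \<in> P" "I = obj x" using assms(1) Ob_El_iff by blast
  ultimately obtain g where "g \<in> carrier G" "x \<le> pact g x" "\<sigma> = arrow x x g" by (auto simp: Hom_El)
  then have "is_coequalizer El_cat \<sigma> (Ident El_cat I) (arrow x (gen_pair g x) \<one>)"
    using x arrow_coequalizer[of x g] endo_fixes[of x g] by simp
  then show ?thesis by blast
qed

text \<open>If \<open>gU = nU\<close> with \<open>n\<close> in the normalizer of the pair, then \<open>g\<close> differs from \<open>n\<close> by an element of \<open>U\<close>,
  which fixes the pair as well.\<close>

lemma weyl_fixes:
  assumes "(U, t) \<in> P" "g \<in> carrier G" "g <# U \<in> carrier (pair_weyl G act U t)"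
  shows "pact g (U, t) = (U, t)"
proof -
  have U: "subgroup U G" using assms by (simp add: pairs_iff)
  obtain n where n: "n \<in> stabilizer G pact (U, t)" "g <# U = n <# U"
    using assms(3) by (auto simp: pair_weyl_def pair_normalizer_def LFactGroup_def LCOSETS_def l_coset_def)
  then have "g \<in> n <# U" using lcos_self[OF assms(2) U] by simp
  then obtain u where u: "u \<in> U" "g = n \<otimes> u" by (auto simp: l_coset_def)
  have "n \<in> carrier G" "pact n (U, t) = (U, t)" using n by (auto simp: stabilizer_def)
  moreover have "pact u (U, t) = (U, t)" using pact_fixed[OF assms(1)] u by simp
  ultimately show ?thesis
    using pact_mult[OF assms(1), of n u] u subgroup.mem_carrier[OF U] by simp
qed

lemma coequalizer_sigma:
  assumes "(U, t) \<in> P" "g \<in> carrier G" "g <# U \<in> carrier (pair_weyl G act U t)"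
  shows "\<exists>c. is_coequalizer El_cat (el_sigma G act U t g) (Ident El_cat (el_obj G act U t)) c \<and>
    Cod El_cat c = el_obj G act (gen_prod G g U) (Inf_fin {s \<in> LL (gen_prod G g U). t \<le> s})"
  using arrow_coequalizer[OF assms(1,2) weyl_fixes[OF assms]]
  by (intro exI[of _ "arrow (U, t) (gen_pair g (U, t)) \<one>"]) (simp add: el_sigma_def gen_pair_def)

lemma card_Hom_cosets:
  assumes "(K, s) \<in> P" "(U, t) \<in> P"
  shows "card (Hom El_cat (el_obj G act U t) (el_obj G act K s)) =
    card {g <# K | g. g \<in> carrier G \<and> U \<subseteq> conj_set G g K \<and> t \<le> act g s}"
proof -
  have "{g <# K | g. g \<in> carrier G \<and> U \<subseteq> conj_set G g K \<and> t \<le> act g s}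
      = (\<lambda>g. g <# K) ` {g \<in> carrier G. (U, t) \<le> pact g (K, s)}"
    by (auto simp: le_pact_iff)
  then show ?thesis using card_Hom_El[OF assms(2,1)] by (simp add: mark_def)
qed

end

theorem theorem5p5:
  fixes p :: enat
    and G :: "('a, 'm) monoid_scheme"
    and act :: "'a \<Rightarrow> 'l::{finite, lattice} \<Rightarrow> 'l"
    and LL :: "'a set \<Rightarrow> 'l set"
  assumes "p = \<infinity> \<or> (\<exists>q. normalization_semidom_class.prime q \<and> p = enat q)"
    and "admissible_family G act LL"
  shows
    "((\<exists>E M. epi_mono_factorization_system (El G act LL) E M) \<and>
      (\<forall>I \<in> Ob (El G act LL). \<forall>P. is_Aut_p p (El G act LL) I P \<longrightarrow>
         (\<forall>\<sigma> \<in> P. \<exists>c. is_coequalizer (El G act LL) \<sigma> (Ident (El G act LL) I) c)))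
   \<and> ((\<exists>m u. abstract_Burnside_structure p (El G act LL) m u) \<and>
      (\<forall>m u. abstract_Burnside_structure p (El G act LL) m u \<longrightarrow>
         iso_to_localization p (Burnside_module p (El G act LL) m u) (lattice_Burnside_ring G act LL)))
   \<and> (\<forall>U t g. (U, t) \<in> pairs G LL \<and> g \<in> carrier G \<and> g <#\<^bsub>G\<^esub> U \<in> carrier (pair_weyl G act U t) \<longrightarrow>
        (\<exists>c. is_coequalizer (El G act LL) (el_sigma G act U t g) (Ident (El G act LL) (el_obj G act U t)) c \<and>
             Cod (El G act LL) c = el_obj G act (gen_prod G g U)
                         (Inf_fin {s \<in> LL (gen_prod G g U). t \<le> s})))
   \<and> (\<forall>K s U t. (K, s) \<in> pairs G LL \<and> (U, t) \<in> pairs G LL \<longrightarrow>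
        card (Hom (El G act LL) (el_obj G act U t) (el_obj G act K s)) =
        card {g <#\<^bsub>G\<^esub> K | g. g \<in> carrier G \<and> U \<subseteq> conj_set G g K \<and> t \<le> act g s})"
proof -
  interpret admissible_family G act LL by (rule assms(2))
  have p: "prime_or_infinity p" using assms(1) by (simp add: prime_or_infinity_def)
  have fs: "\<exists>E M. epi_mono_factorization_system (El G act LL) E M"
    using category.epi_iso_factorization_system[OF El_category El_epimorphism] by blast
  show ?thesis
  proof (intro conjI allI ballI impI)
    show "\<exists>E M. epi_mono_factorization_system (El G act LL) E M" by (rule fs)
    show "\<exists>m u. abstract_Burnside_structure p (El G act LL) m u" by (rule abstract_Burnside_El(1)[OF p])
  qed (blast intro: Aut_coequalizer abstract_Burnside_El(2)[OF p] coequalizer_sigma card_Hom_cosets)+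
qed

end
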